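(* Let $R$ be an SP-domain, and let $\mathcal{M}$ be its maximal space with the inverse topology, with Gleason cover $j:E_{\mathcal{M}}\to\mathcal{M}$. Let $\Psi:\mathrm{Inv}(R)\to\mathcal{C}_c(\mathcal{M},\mathbb{Z})$ be $I\mapsto\nu_I$ and $\psi:\mathcal{C}_c(\mathcal{M},\mathbb{Z})\to\mathcal{C}_c(E_{\mathcal{M}},\mathbb{Z})$ be $f\mapsto f\circ j$. Then $\Psi$ is an isomorphism and there is an isomorphism $\beta:\mathrm{Div}(R)\to\mathcal{C}_c(E_{\mathcal{M}},\mathbb{Z})$ such that $\beta|_{\mathrm{Inv}(R)}=\psi\circ\Psi$ (i.e., the square formed by the inclusion $\mathrm{Inv}(R)\subseteq\mathrm{Div}(R)$, $\Psi$, $\beta$ and $\psi$ commutes). In particular, $\mathrm{Div}(R)\simeq\mathcal{C}_c(E_{\mathcal{M}},\mathbb{Z})$ and $\mathrm{Div}(R)/\mathrm{Inv}(R)$ are free abelian groups.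
   Context: An SP-domain is an integral domain in which every proper ideal is a finite product of radical ideals; it is an almost Dedekind domain ($R_M$ is a DVR for every maximal $M$), with valuation $v_M$. For a nonzero fractional ideal $I$, $\nu_I:\mathrm{Max}(R)\to\mathbb{Z}$, $\nu_I(M)=\inf\{v_M(i)\mid i\in I\setminus\{0\}\}$. $\mathcal{M}$ is $\mathrm{Max}(R)$ with the inverse topology (restriction of the coarsest topology on $\mathrm{Spec}(R)$ in which Zariski-open Zariski-compact sets are closed; equal to the constructible topology on $\mathrm{Max}(R)$). $\mathrm{Inv}(R)$ is the group of invertible fractional ideals; $\mathrm{Div}(R)$ is the set of divisorial fractional ideals ($(R:(R:I))=I$), a group under $I\ast J=(R:(R:IJ))$, containing $\mathrm{Inv}(R)$ as a subgroup. $\mathcal{C}_c(X,\mathbb{Z})$ is the group of continuous compactly supported functions $X\to\mathbb{Z}$ ($\mathbb{Z}$ discrete). For a regular Hausdorff space $X$, the Gleason cover is the minimal extremally disconnected space $E_X$ (closure of every open set is open) with a perfect (closed, continuous, with compact fibres) surjection $j:E_X\to X$. *)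

theory Defs
  imports "HOL-Analysis.Analysis" "HOL-Computational_Algebra.Fraction_Field"
          "HOL-Algebra.Free_Abelian_Groups" "HOL-Algebra.Coset"
begin

definition is_ideal :: "'a::idom set \<Rightarrow> bool" where
  "is_ideal I \<longleftrightarrow> 0 \<in> I \<and> (\<forall>x\<in>I. \<forall>y\<in>I. x + y \<in> I) \<and> (\<forall>r x. x \<in> I \<longrightarrow> r * x \<in> I)"

definition ideal_gen :: "'a::idom set \<Rightarrow> 'a set" where
  "ideal_gen S = \<Inter>{J. is_ideal J \<and> S \<subseteq> J}"

definition ideal_mult :: "'a::idom set \<Rightarrow> 'a set \<Rightarrow> 'a set" where
  "ideal_mult I J = ideal_gen {a * b |a b. a \<in> I \<and> b \<in> J}"

definition ideal_prod_list :: "'a::idom set list \<Rightarrow> 'a set" where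
  "ideal_prod_list Is = foldr ideal_mult Is UNIV"

definition radical_ideal :: "'a::idom set \<Rightarrow> bool" where
  "radical_ideal I \<longleftrightarrow> is_ideal I \<and> (\<forall>x (n::nat). x ^ n \<in> I \<longrightarrow> x \<in> I)"

definition maximal_ideal :: "'a::idom set \<Rightarrow> bool" where
  "maximal_ideal M \<longleftrightarrow> is_ideal M \<and> M \<noteq> UNIV \<and>
     (\<forall>J. is_ideal J \<and> M \<subseteq> J \<longrightarrow> J = M \<or> J = UNIV)"

definition Max_spec :: "'a::idom set set" where
  "Max_spec = {M. maximal_ideal M}"

text \<open>SP-domain: every proper ideal is a finite product of radical ideals.
  As usual (an SP-domain is almost Dedekind, so R_M is a DVR), R is not a field.\<close>
definition SP_domain :: "'a::idom itself \<Rightarrow> bool" where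
  "SP_domain _ \<longleftrightarrow> (\<exists>x::'a. x \<noteq> 0 \<and> \<not> x dvd 1) \<and>
     (\<forall>I::'a set. is_ideal I \<and> I \<noteq> UNIV \<longrightarrow>
        (\<exists>Is. (\<forall>J\<in>set Is. radical_ideal J) \<and> I = ideal_prod_list Is))"

definition emb :: "'a::idom \<Rightarrow> 'a fract" where
  "emb a = Fract a 1"

definition Rfr :: "'a::idom fract set" where
  "Rfr = range emb"

definition loc :: "'a::idom set \<Rightarrow> 'a fract set" where
  "loc M = {Fract a s |a s. s \<notin> M}"

definition loc_max :: "'a::idom set \<Rightarrow> 'a fract set" where
  "loc_max M = {Fract a s |a s. a \<in> M \<and> s \<notin> M}"

definition loc_units :: "'a::idom set \<Rightarrow> 'a fract set" where
  "loc_units M = {x \<in> loc M. x \<noteq> 0 \<and> inverse x \<in> loc M}"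

definition val :: "'a::idom set \<Rightarrow> 'a fract \<Rightarrow> int" where
  "val M x = (THE n::int. \<exists>t. t \<in> loc M \<and> loc_max M = {t * y |y. y \<in> loc M} \<and>
                 x * t powi (- n) \<in> loc_units M)"

definition R_submodule :: "'a::idom fract set \<Rightarrow> bool" where
  "R_submodule I \<longleftrightarrow> 0 \<in> I \<and> (\<forall>x\<in>I. \<forall>y\<in>I. x + y \<in> I) \<and> (\<forall>r\<in>Rfr. \<forall>x\<in>I. r * x \<in> I)"

definition frac_ideal :: "'a::idom fract set \<Rightarrow> bool" where
  "frac_ideal I \<longleftrightarrow> R_submodule I \<and> I \<noteq> {0} \<and>
     (\<exists>d. d \<noteq> 0 \<and> (\<forall>x\<in>I. emb d * x \<in> Rfr))"

definition frac_mult :: "'a::idom fract set \<Rightarrow> 'a fract set \<Rightarrow> 'a fract set" where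
  "frac_mult I J = \<Inter>{N. R_submodule N \<and> {a * b |a b. a \<in> I \<and> b \<in> J} \<subseteq> N}"

definition colon :: "'a::idom fract set \<Rightarrow> 'a fract set" where
  "colon I = {x. \<forall>i\<in>I. x * i \<in> Rfr}"

definition Inv :: "'a::idom fract set set" where
  "Inv = {I. frac_ideal I \<and> (\<exists>J. frac_ideal J \<and> frac_mult I J = Rfr)}"

definition Div :: "'a::idom fract set set" where
  "Div = {I. frac_ideal I \<and> colon (colon I) = I}"

definition InvG :: "'a::idom fract set monoid" where
  "InvG = \<lparr>carrier = Inv, monoid.mult = frac_mult, one = Rfr\<rparr>"

definition DivG :: "'a::idom fract set monoid" where
  "DivG = \<lparr>carrier = Div, monoid.mult = (\<lambda>I J. colon (colon (frac_mult I J))), one = Rfr\<rparr>"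

definition nu :: "'a::idom fract set \<Rightarrow> 'a set \<Rightarrow> int" where
  "nu I M = (INF i \<in> I - {0}. val M i)"

text \<open>Inverse topology: generated by the complements V(J) of the Zariski quasi-compact
  opens, J finitely generated (V(J) = {P. F \<subseteq> P} for J generated by finite F),
  restricted to Max(R).\<close>
definition inverse_topology_Max :: "'a::idom set topology" where
  "inverse_topology_Max =
     subtopology (topology_generated_by {{P. F \<subseteq> P} |F. finite F}) Max_spec"

definition extremally_disconnected :: "'e topology \<Rightarrow> bool" where
  "extremally_disconnected E \<longleftrightarrow> (\<forall>U. openin E U \<longrightarrow> openin E (E closure_of U))"

definition perfect_map :: "'e topology \<Rightarrow> 'x topology \<Rightarrow> ('e \<Rightarrow> 'x) \<Rightarrow> bool" where
  "perfect_map E X j \<longleftrightarrow> continuous_map E X j \<and> closed_map E X j \<and>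
     (\<forall>x\<in>topspace X. compactin E {e \<in> topspace E. j e = x})"

definition gleason_cover :: "'x topology \<Rightarrow> 'e topology \<Rightarrow> ('e \<Rightarrow> 'x) \<Rightarrow> bool" where
  "gleason_cover X E j \<longleftrightarrow> Hausdorff_space E \<and> extremally_disconnected E \<and>
     perfect_map E X j \<and> j ` topspace E = topspace X \<and>
     (\<forall>C. closedin E C \<and> C \<noteq> topspace E \<longrightarrow> j ` C \<noteq> topspace X)"

definition Cc :: "'x topology \<Rightarrow> ('x \<Rightarrow> int) set" where
  "Cc X = {f. continuous_map X euclidean f \<and>
              compactin X (X closure_of {x \<in> topspace X. f x \<noteq> 0}) \<and>
              (\<forall>x. x \<notin> topspace X \<longrightarrow> f x = 0)}"

definition CcG :: "'x topology \<Rightarrow> ('x \<Rightarrow> int) monoid" where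
  "CcG X = \<lparr>carrier = Cc X, monoid.mult = (\<lambda>f g x. f x + g x), one = (\<lambda>x. 0)\<rparr>"

definition Psi :: "'a::idom fract set \<Rightarrow> ('a set \<Rightarrow> int)" where
  "Psi I = (\<lambda>M. if M \<in> Max_spec then nu I M else 0)"

definition psi :: "'e topology \<Rightarrow> ('e \<Rightarrow> 'x) \<Rightarrow> ('x \<Rightarrow> int) \<Rightarrow> ('e \<Rightarrow> int)" where
  "psi E j f = (\<lambda>e. if e \<in> topspace E then f (j e) else 0)"

end

theory Submission
  imports Defs "HOL-Library.Function_Algebras"
begin

text \<open>
  Localizing at a prime that is minimal over a nonzero principal ideal makes the radical factors of a
  principal ideal principal, so the maximal ideal is generated by some \<open>t\<close>; a radical generator
  cannot lie in \<open>(t\<^sup>2)\<close>, hence the localization is a discrete valuation ring.  A proper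
  inclusion of nonzero primes is excluded by factoring \<open>P + (x\<^sup>2)\<close> and \<open>(a) + P\<^sup>2\<close>.

  For nonzero \<open>x\<close>, the radical factorization exhibits the function of \<open>M\<close> given by \<open>v\<^sub>M(x)\<close> as an
  integer combination of characteristic functions of compact open sets.  Conversely any function in
  \<open>C\<^sub>c\<close> is attained at a prescribed point by some \<open>x\<close> whose valuations lie above the function
  elsewhere.  This inverts \<open>\<Psi>\<close>.

  For \<open>\<phi>\<close> in \<open>C\<^sub>c(E)\<close> put \<open>D(\<phi>) = {x. v(x) \<circ> j \<ge> \<phi>}\<close>.  Irreducibility of the cover makes
  \<open>\<phi>\<close> the infimum of the functions \<open>w \<circ> j \<ge> \<phi>\<close>, so \<open>(R : D(\<phi>)) = D(-\<phi>)\<close>; extremal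
  disconnectedness supplies, for a divisorial ideal \<open>I\<close>, the largest continuous function below
  \<open>\<nu>\<^sub>I \<circ> j\<close>.  So \<open>D\<close> is the inverse of \<open>\<beta>\<close>.

  Both freeness statements are Noebeling's theorem.  Finite sets of well-ordered letters are
  compared by the largest letter in which they differ; the monomials outside the span of the smaller ones form a
  basis, and ordering the letters of a subfamily first makes part of it a basis of the subgroup.
\<close>

section \<open>Independent systems of characteristic functions\<close>

text \<open>The quotient by \<open>Inv\<close> forces a relative form of Noebeling's theorem: a
  quotient of free abelian groups need not be free, so a basis of the functions pulled back from the
  maximal space must extend to a basis of all of \<open>Cc E\<close>. Whether a set of letters is
  good depends only on smaller sets, and these stay inside an initial segment of the letters; so one
  notion of goodness serves the subfamily and the whole family at once.

  On the ring side the hypothesis speaks of factorizations only. At a prime minimal over a principal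
  ideal the valuation ring is found directly; the obstacle is that such a prime might lie properly
  inside a maximal ideal. Once this is excluded, nonzero primes are maximal, which also yields the
  compactness of the set of maximal ideals containing a nonzero element.

  The duality between D(\<phi>) and D(-\<phi>) never needs an ideal whose value function is \<phi>:
  it suffices to reach \<phi> from above at one point of any given nonempty open set of the
  cover.\<close>

interpretation int_fun: module "\<lambda>(c::int) (f::'x \<Rightarrow> int) x. c * f x"
  by unfold_locales (auto simp: fun_eq_iff algebra_simps)

text \<open>A point is the set \<open>T\<close> of the letters that take the value 1 at it, so \<open>mono_fun A\<close> is the product of
  the letters in \<open>A\<close> and \<open>dep_funs L\<close> is the ring generated by the letters in \<open>L\<close>.  Instead of
  restricting functions to a closed set of points, we work modulo an ideal \<open>J\<close> of functions that is
  closed under shrinking the support.\<close>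

definition mono_fun :: "'i set \<Rightarrow> 'i set \<Rightarrow> int" where
  "mono_fun A T = of_bool (A \<subseteq> T)"

definition dep_funs :: "'i set \<Rightarrow> ('i set \<Rightarrow> int) set" where
  "dep_funs L = {f. \<exists>F. finite F \<and> F \<subseteq> L \<and> (\<forall>T. f T = f (T \<inter> F))}"

definition supp_ideal :: "'i set \<Rightarrow> ('i set \<Rightarrow> int) set \<Rightarrow> bool" where
  "supp_ideal L J \<longleftrightarrow> J \<subseteq> dep_funs L \<and> 0 \<in> J \<and> (\<forall>f\<in>J. \<forall>g\<in>J. f + g \<in> J) \<and>
     (\<forall>f\<in>dep_funs L. \<forall>g\<in>J. (\<forall>T. g T = 0 \<longrightarrow> f T = 0) \<longrightarrow> f \<in> J)"

lemma supp_ideal_dep: "supp_ideal L J \<Longrightarrow> f \<in> J \<Longrightarrow> f \<in> dep_funs L"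
  and supp_ideal_0: "supp_ideal L J \<Longrightarrow> 0 \<in> J"
  and supp_ideal_add: "supp_ideal L J \<Longrightarrow> f \<in> J \<Longrightarrow> g \<in> J \<Longrightarrow> f + g \<in> J"
  and supp_ideal_supp: "supp_ideal L J \<Longrightarrow> f \<in> dep_funs L \<Longrightarrow> g \<in> J \<Longrightarrow> (\<And>T. g T = 0 \<Longrightarrow> f T = 0) \<Longrightarrow> f \<in> J"
  unfolding supp_ideal_def by blast+

lemma dep_funs_I: "finite F \<Longrightarrow> F \<subseteq> L \<Longrightarrow> (\<And>T. f T = f (T \<inter> F)) \<Longrightarrow> f \<in> dep_funs L"
  unfolding dep_funs_def by blast

lemma dep_funs_mono: "L \<subseteq> L' \<Longrightarrow> dep_funs L \<subseteq> dep_funs L'"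
  unfolding dep_funs_def by blast

text \<open>An arbitrary operation is allowed because \<open>colon_ideal\<close> combines three
  functions by a case distinction, which is no ring operation.\<close>

lemma dep_funs_comb3:
  assumes "f \<in> dep_funs L" "g \<in> dep_funs L" "h \<in> dep_funs L"
  shows "(\<lambda>T. op (f T) (g T) (h T)) \<in> dep_funs L"
proof -
  obtain F G H where *: "finite F" "F \<subseteq> L" "\<And>T. f T = f (T \<inter> F)"
    "finite G" "G \<subseteq> L" "\<And>T. g T = g (T \<inter> G)" "finite H" "H \<subseteq> L" "\<And>T. h T = h (T \<inter> H)"
    using assms unfolding dep_funs_def by blast
  show ?thesis
  proof (rule dep_funs_I[of "F \<union> G \<union> H"])
    fix T
    have "(T \<inter> (F \<union> G \<union> H)) \<inter> F = T \<inter> F" "(T \<inter> (F \<union> G \<union> H)) \<inter> G = T \<inter> G"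
      "(T \<inter> (F \<union> G \<union> H)) \<inter> H = T \<inter> H" by auto
    then have "f (T \<inter> (F \<union> G \<union> H)) = f T" "g (T \<inter> (F \<union> G \<union> H)) = g T"
      "h (T \<inter> (F \<union> G \<union> H)) = h T" using *(3,6,9) by metis+
    then show "op (f T) (g T) (h T) = op (f (T \<inter> (F \<union> G \<union> H))) (g (T \<inter> (F \<union> G \<union> H))) (h (T \<inter> (F \<union> G \<union> H)))"
      by simp
  qed (use * in auto)
qed

lemma dep_funs_comb2:
  assumes "f \<in> dep_funs L" "g \<in> dep_funs L"
  shows "(\<lambda>T. op (f T) (g T)) \<in> dep_funs L"
  using dep_funs_comb3[OF assms assms(2), of "\<lambda>a b c. op a b"] .

lemma dep_funs_add: "f \<in> dep_funs L \<Longrightarrow> g \<in> dep_funs L \<Longrightarrow> f + g \<in> dep_funs L"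
  using dep_funs_comb2[of f L g "(+)"] by (simp add: plus_fun_def)

lemma dep_funs_cmul: "f \<in> dep_funs L \<Longrightarrow> (\<lambda>T. c * f T) \<in> dep_funs L"
  using dep_funs_comb2[of f L f "\<lambda>a b. c * a"] by simp

lemma dep_funs_0: "0 \<in> dep_funs L"
  by (rule dep_funs_I[of "{}"]) auto

lemma mono_fun_dep: "finite A \<Longrightarrow> A \<subseteq> L \<Longrightarrow> mono_fun A \<in> dep_funs L"
  by (rule dep_funs_I[of A]) (auto simp: mono_fun_def)

lemma dep_funs_sum:
  "(\<And>A. A \<in> \<F> \<Longrightarrow> f A \<in> dep_funs L) \<Longrightarrow> (\<lambda>T. \<Sum>A\<in>\<F>. c A * f A T) \<in> dep_funs L"
proof (induction \<F> rule: infinite_finite_induct)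
  case (insert A \<F>)
  then have "(\<lambda>T. c A * f A T) + (\<lambda>T. \<Sum>A\<in>\<F>. c A * f A T) \<in> dep_funs L"
    by (intro dep_funs_add dep_funs_cmul) auto
  then show ?case using insert by (simp add: plus_fun_def)
qed (use dep_funs_0 in \<open>auto simp: zero_fun_def\<close>)

lemma mono_fun_Un: "mono_fun A * mono_fun B = mono_fun (A \<union> B)"
  by (auto simp: mono_fun_def fun_eq_iff)

lemma mult_span:
  assumes "f \<in> int_fun.span S" "\<And>g. g \<in> S \<Longrightarrow> h * g \<in> int_fun.span S'"
  shows "h * f \<in> int_fun.span S'"
  using assms(1)
proof (induction rule: int_fun.span_induct_alt)
  case base then show ?case using int_fun.span_zero[of S'] by (simp only: mult_zero_right)
next
  case (step c x y)
  have "h * ((\<lambda>T. c * x T) + y) = (\<lambda>T. c * (h * x) T) + h * y"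
    by (auto simp: fun_eq_iff algebra_simps)
  then show ?case using step assms(2) by (metis int_fun.span_add int_fun.span_scale)
qed

lemma dep_funs_span: "f \<in> dep_funs L \<Longrightarrow> f \<in> int_fun.span (mono_fun ` {B. finite B \<and> B \<subseteq> L})"
proof -
  have "(\<And>T. f T = f (T \<inter> F)) \<Longrightarrow> f \<in> int_fun.span (mono_fun ` Pow F)" if "finite F" for F :: "'a set" and f
    using that
  proof (induction F arbitrary: f)
    case empty
    have "f = (\<lambda>T. f {} * mono_fun {} T)"
      using empty[of T for T] by (auto simp: mono_fun_def fun_eq_iff)
    moreover have "\<dots> \<in> int_fun.span (mono_fun ` Pow {})" by (intro int_fun.span_scale int_fun.span_base) auto
    ultimately show ?case by simp
  next
    case (insert e F)
    \<comment> \<open>Split off the letter e: g is f with e switched off and h is the jump when e is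
      switched on, so f = g + e * h, and neither g nor h depends on e.\<close>
    define g where "g = (\<lambda>T. f (T - {e}))"
    define h where "h = (\<lambda>T. f (insert e T) - f (T - {e}))"
    have fe: "f = g + mono_fun {e} * h"
      by (auto simp: g_def h_def mono_fun_def fun_eq_iff insert_absorb)
    have dT: "(T - {e}) \<inter> insert e F = (T \<inter> F - {e}) \<inter> insert e F"
      "insert e T \<inter> insert e F = insert e (T \<inter> F) \<inter> insert e F" for T by auto
    have "g T = g (T \<inter> F)" "h T = h (T \<inter> F)" for T
      unfolding g_def h_def using insert.prems dT by metis+
    then have gh: "g \<in> int_fun.span (mono_fun ` Pow F)" "h \<in> int_fun.span (mono_fun ` Pow F)"
      using insert.IH by blast+
    have "g \<in> int_fun.span (mono_fun ` Pow (insert e F))"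
      by (rule subsetD[OF int_fun.span_mono gh(1)]) auto
    moreover have "mono_fun {e} * h \<in> int_fun.span (mono_fun ` Pow (insert e F))"
      by (rule mult_span[OF gh(2)]) (auto intro!: int_fun.span_base simp: mono_fun_Un)
    ultimately show ?case using fe int_fun.span_add by metis
  qed
  then have *: "finite F \<Longrightarrow> (\<And>T. f T = f (T \<inter> F)) \<Longrightarrow> f \<in> int_fun.span (mono_fun ` Pow F)" for F by blast
  assume "f \<in> dep_funs L"
  then obtain F where F: "finite F" "F \<subseteq> L" "\<And>T. f T = f (T \<inter> F)" unfolding dep_funs_def by blast
  have "mono_fun ` Pow F \<subseteq> mono_fun ` {B. finite B \<and> B \<subseteq> L}"
    by (rule image_mono) (use F(1,2) rev_finite_subset in blast)
  from subsetD[OF int_fun.span_mono[OF this] *[OF F(1,3)]] show ?thesis .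
qed

section \<open>Noebeling's order on finite sets of letters\<close>

locale letters =
  fixes r :: "'i rel"
  assumes wfr: "wf r" and totr: "a \<noteq> b \<Longrightarrow> (a,b) \<in> r \<or> (b,a) \<in> r" and transr: "trans r"
begin

definition mless :: "'i set \<Rightarrow> 'i set \<Rightarrow> bool" where
  "mless A B \<longleftrightarrow> (\<exists>b\<in>B - A. \<forall>a\<in>A - B. (a,b) \<in> r)"

definition smaller :: "'i set \<Rightarrow> 'i set set" where
  "smaller A = {B. finite B \<and> mless B A}"

definition good :: "('i set \<Rightarrow> int) set \<Rightarrow> 'i set \<Rightarrow> bool" where
  "good J A \<longleftrightarrow> (\<forall>j\<in>J. \<forall>s\<in>int_fun.span (mono_fun ` smaller A). mono_fun A \<noteq> j + s)"

definition down :: "'i set \<Rightarrow> bool" where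
  "down L \<longleftrightarrow> (\<forall>a b. (a,b) \<in> r \<and> b \<in> L \<longrightarrow> a \<in> L)"

lemma irr: "(a,a) \<notin> r"
  using wfr by auto

text \<open>A and B share A \<inter> B, and the rest of A is dominated by one letter in the rest of
  B, so their multisets are one step apart in the well-founded multiset order.\<close>

lemma wf_mless: "wf {(A,B). finite A \<and> finite B \<and> mless A B}"
proof (rule wf_subset[OF wf_inv_image[OF wf_mult[OF wfr], of mset_set]], clarsimp)
  fix A B :: "'i set" assume AB: "finite A" "finite B" "mless A B"
  have "(mset_set (A \<inter> B) + mset_set (A - B), mset_set (A \<inter> B) + mset_set (B - A)) \<in> Multiset.mult r"
    by (rule one_step_implies_mult) (use AB in \<open>auto simp: mless_def mset_set_empty_iff\<close>)
  moreover have "mset_set (A \<inter> B) + mset_set (A - B) = mset_set A"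
    using AB mset_set_Union[of "A \<inter> B" "A - B"]
    by (metis Diff_disjoint Int_Diff Int_Diff_Un Int_commute finite_Diff finite_Int inf_bot_right)
  moreover have "mset_set (A \<inter> B) + mset_set (B - A) = mset_set B"
    using AB mset_set_Union[of "A \<inter> B" "B - A"]
    by (metis Diff_disjoint Int_Diff Int_Diff_Un Int_commute finite_Diff finite_Int inf_bot_right)
  ultimately show "(mset_set A, mset_set B) \<in> Multiset.mult r" by simp
qed

lemma smaller_down: "B \<in> smaller A \<Longrightarrow> down L \<Longrightarrow> A \<subseteq> L \<Longrightarrow> B \<subseteq> L"
  unfolding smaller_def mless_def down_def by blast

lemma finite_has_max:
  assumes "finite U" "U \<noteq> {}" shows "\<exists>e\<in>U. \<forall>a\<in>U. a \<noteq> e \<longrightarrow> (a,e) \<in> r"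
  using assms
proof (induction U rule: finite_ne_induct)
  case (insert x F)
  then obtain e where e: "e \<in> F" "\<forall>a\<in>F. a \<noteq> e \<longrightarrow> (a,e) \<in> r" by blast
  show ?case
  proof (cases "(e,x) \<in> r")
    case True then show ?thesis using e transr by (metis insert_iff transD)
  next
    case False then show ?thesis using e totr by (metis insert_iff)
  qed
qed auto

text \<open>Modulo \<open>J\<close>, where \<open>g\<close> does not vanish the letter \<open>e\<close> is the indicator of \<open>s = g\<close>; this turns
  \<open>e * g = s + j\<close> into a similar equation for every \<open>f\<close> supported in the support of \<open>g\<close>.\<close>

lemma colon_ideal:
  assumes J: "supp_ideal L J" and L: "down L" "e \<in> L"
  defines "L' \<equiv> {i. (i,e) \<in> r}"
  defines "J' \<equiv> {f \<in> dep_funs L'. \<exists>s\<in>dep_funs L'. \<exists>j\<in>J. mono_fun {e} * f = s + j}"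
  shows "supp_ideal L' J'"
  unfolding supp_ideal_def
proof (intro conjI ballI impI)
  have LL: "dep_funs L' \<subseteq> dep_funs L" using L unfolding L'_def down_def by (intro dep_funs_mono) auto
  show "J' \<subseteq> dep_funs L'" unfolding J'_def by auto
  show "0 \<in> J'" using supp_ideal_0[OF J] dep_funs_0[of L'] unfolding J'_def
    by (auto intro!: bexI[of _ 0])
  fix f g assume g: "g \<in> J'"
  from g obtain s j where sj: "g \<in> dep_funs L'" "s \<in> dep_funs L'" "j \<in> J" "mono_fun {e} * g = s + j"
    unfolding J'_def by blast
  { assume f: "f \<in> J'"
    from f obtain s' j' where sj': "f \<in> dep_funs L'" "s' \<in> dep_funs L'" "j' \<in> J" "mono_fun {e} * f = s' + j'"
      unfolding J'_def by blast
    have "mono_fun {e} * (f + g) = (s' + s) + (j' + j)" using sj sj' by (simp add: algebra_simps)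
    moreover have "f + g \<in> dep_funs L'" "s' + s \<in> dep_funs L'" "j' + j \<in> J"
      using sj sj' J by (auto intro: dep_funs_add supp_ideal_add)
    ultimately show "f + g \<in> J'" unfolding J'_def by blast }
  assume f: "f \<in> dep_funs L'" and z: "\<forall>T. g T = 0 \<longrightarrow> f T = 0"
  define s' where "s' = (\<lambda>T. if g T \<noteq> 0 \<and> s T = g T then f T else 0)"
  have s': "s' \<in> dep_funs L'" unfolding s'_def
    using dep_funs_comb3[OF f sj(1,2), of "\<lambda>f g s. if g \<noteq> 0 \<and> s = g then f else 0"] .
  define j' where "j' = (\<lambda>T. mono_fun {e} T * f T - s' T)"
  have j'd: "j' \<in> dep_funs L" unfolding j'_def
    by (rule dep_funs_comb3[of "mono_fun {e}" L f s' "\<lambda>p f s. p * f - s"])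
      (use f s' LL L in \<open>auto intro: mono_fun_dep\<close>)
  \<comment> \<open>The support of \<open>j'\<close> lies in that of j, so closure of J under
    shrinking the support puts \<open>j'\<close> into J.\<close>
  have "j' T = 0" if "j T = 0" for T
  proof -
    have *: "mono_fun {e} T * g T = s T" using fun_cong[OF sj(4), of T] that by simp
    show ?thesis using z * unfolding j'_def s'_def mono_fun_def by auto
  qed
  then have "j' \<in> J" using supp_ideal_supp[OF J j'd sj(3)] by blast
  moreover have "mono_fun {e} * f = s' + j'" by (auto simp: fun_eq_iff j'_def)
  ultimately show "f \<in> J'" using f s' unfolding J'_def by blast
qed

text \<open>Multiplying a reduction of \<open>A - {e}\<close> modulo the new ideal by the letter e
  gives a reduction of A modulo J: the part s involves only letters below e, and inserting e into
  sets smaller than \<open>A - {e}\<close> gives sets smaller than A.\<close>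

lemma good_colon:
  assumes A: "finite A" "e \<in> A" "A \<subseteq> insert e {i. (i,e) \<in> r}" and g: "good J A"
  shows "good {f \<in> dep_funs {i. (i,e) \<in> r}. \<exists>s\<in>dep_funs {i. (i,e) \<in> r}. \<exists>j\<in>J. mono_fun {e} * f = s + j}
           (A - {e})"
  unfolding good_def
proof (clarify)
  fix j' s0 s j
  assume s0: "s0 \<in> int_fun.span (mono_fun ` smaller (A - {e}))" and eq: "mono_fun (A - {e}) = j' + s0"
    and s: "s \<in> dep_funs {i. (i,e) \<in> r}" and j: "j \<in> J" and eq2: "mono_fun {e} * j' = s + j"
  have "mono_fun A = mono_fun {e} * mono_fun (A - {e})" using A by (simp add: mono_fun_Un insert_absorb)
  also have "\<dots> = j + (s + mono_fun {e} * s0)" unfolding eq distrib_left eq2 by (simp add: add_ac)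
  finally have main: "mono_fun A = j + (s + mono_fun {e} * s0)" .
  \<comment> \<open>A set of letters below e is smaller than A because e itself is the deciding
    letter.\<close>
  have "mono_fun ` {B. finite B \<and> B \<subseteq> {i. (i,e) \<in> r}} \<subseteq> mono_fun ` smaller A"
    using A irr by (auto simp: smaller_def mless_def intro!: imageI bexI[of _ e])
  then have 1: "s \<in> int_fun.span (mono_fun ` smaller A)"
    using dep_funs_span[OF s] int_fun.span_mono by blast
  have 2: "mono_fun {e} * s0 \<in> int_fun.span (mono_fun ` smaller A)"
  proof (rule mult_span[OF s0])
    fix f assume "f \<in> mono_fun ` smaller (A - {e})"
    then obtain B where B: "finite B" "mless B (A - {e})" "f = mono_fun B" by (auto simp: smaller_def)
    have "insert e B \<in> smaller A"
      using B A by (auto simp: smaller_def mless_def)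
    then show "mono_fun {e} * f \<in> int_fun.span (mono_fun ` smaller A)"
      using B by (auto intro!: int_fun.span_base simp: mono_fun_Un)
  qed
  have "s + mono_fun {e} * s0 \<in> int_fun.span (mono_fun ` smaller A)" using 1 2 int_fun.span_add by blast
  then show False using g j main unfolding good_def by blast
qed

text \<open>Induction on the number of letters, for all ideals J at once. With e the largest letter,
  the part of the relation containing e is e * f with f in the ideal of \<open>colon_ideal\<close>,
  where the induction hypothesis kills its coefficients; the rest of the relation then has fewer
  letters and lies in J.\<close>

lemma good_independent:
  assumes "supp_ideal L J" "down L" "finite \<F>"
    "\<And>A. A \<in> \<F> \<Longrightarrow> finite A \<and> A \<subseteq> L \<and> good J A"
    "(\<lambda>T. \<Sum>A\<in>\<F>. c A * mono_fun A T) \<in> J" "A \<in> \<F>"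
  shows "c A = 0"
  using assms
proof (induction "card (\<Union>\<F>)" arbitrary: L J \<F> c A rule: less_induct)
  case less
  let ?U = "\<Union>\<F>"
  have finU: "finite ?U" using less.prems by auto
  show ?case
  proof (cases "?U = {}")
    case True
    then have F: "\<F> = {{}}" "A = {}" using less.prems(6) by auto
    have inJ: "(\<lambda>T. c {} * mono_fun {} T) \<in> J" using less.prems(5) F by simp
    have "mono_fun {} \<in> J" if "c {} \<noteq> 0"
    proof -
      have "mono_fun {} \<in> dep_funs L" by (rule mono_fun_dep) auto
      then show ?thesis by (rule supp_ideal_supp[OF less.prems(1) _ inJ]) (use that in simp)
    qed
    moreover have "mono_fun {} \<notin> J"
      using less.prems(4)[of "{}"] F int_fun.span_zero unfolding good_def by (metis add.right_neutral singletonI)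
    ultimately show ?thesis using F by auto
  next
    case False
    obtain e where e: "e \<in> ?U" "\<And>a. a \<in> ?U \<Longrightarrow> a \<noteq> e \<Longrightarrow> (a,e) \<in> r"
      using finite_has_max[OF finU False] by blast
    define L' where "L' = {i. (i,e) \<in> r}"
    define J' where "J' = {f \<in> dep_funs L'. \<exists>s\<in>dep_funs L'. \<exists>j\<in>J. mono_fun {e} * f = s + j}"
    have eL: "e \<in> L" using e(1) less.prems(4) by blast
    have J': "supp_ideal L' J'" unfolding J'_def L'_def
      by (rule colon_ideal[OF less.prems(1,2) eL])
    have dL': "down L'" unfolding down_def L'_def using transr by (auto dest: transD)
    have FL: "A \<subseteq> insert e L'" if "A \<in> \<F>" for A using e(2) that unfolding L'_def by blast
    define F1 where "F1 = {A\<in>\<F>. e \<in> A}"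
    define F0 where "F0 = {A\<in>\<F>. e \<notin> A}"
    define F1' where "F1' = (\<lambda>A. A - {e}) ` F1"
    have fin: "finite F0" "finite F1" using less.prems(3) by (auto simp: F0_def F1_def)
    have split: "(\<Sum>A\<in>\<F>. c A * mono_fun A T) = (\<Sum>A\<in>F0. c A * mono_fun A T) + (\<Sum>A\<in>F1. c A * mono_fun A T)" for T
    proof -
      have "\<F> = F0 \<union> F1" "F0 \<inter> F1 = {}" unfolding F0_def F1_def by auto
      then show ?thesis using sum.union_disjoint[OF fin] by metis
    qed
    have inj: "inj_on (\<lambda>A. A - {e}) F1" unfolding F1_def inj_on_def by blast
    have sum1: "(\<Sum>A\<in>F1. c A * mono_fun A T) = mono_fun {e} T * (\<Sum>B\<in>F1'. c (insert e B) * mono_fun B T)" for T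
      unfolding F1'_def sum.reindex[OF inj] sum_distrib_left o_def
    proof (rule sum.cong[OF refl])
      fix A assume "A \<in> F1"
      then have "e \<in> A" by (simp add: F1_def)
      then have "insert e (A - {e}) = A" "{e} \<union> (A - {e}) = A" by auto
      then show "c A * mono_fun A T = mono_fun {e} T * (c (insert e (A - {e})) * mono_fun (A - {e}) T)"
        using fun_cong[OF mono_fun_Un[of "{e}" "A - {e}"], of T] by (simp add: algebra_simps)
    qed
    have s0: "(\<lambda>T. \<Sum>A\<in>F0. c A * mono_fun A T) \<in> dep_funs L'"
    proof (rule dep_funs_sum, rule mono_fun_dep)
      fix A assume A: "A \<in> F0"
      then have "A \<in> \<F>" "e \<notin> A" by (auto simp: F0_def)
      then show "finite A" "A \<subseteq> L'" using FL less.prems(4) by blast+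
    qed
    have F1'L: "finite B \<and> B \<subseteq> L' \<and> good J' B" if B: "B \<in> F1'" for B
    proof -
      obtain A where A: "A \<in> F1" "B = A - {e}" using B unfolding F1'_def by blast
      then have A': "A \<in> \<F>" "e \<in> A" by (auto simp: F1_def)
      have "good J' B" unfolding A(2) J'_def L'_def
        by (rule good_colon[OF _ A'(2)]) (use less.prems(4)[OF A'(1)] FL[OF A'(1), unfolded L'_def] in blast)+
      then show ?thesis using A(2) FL[OF A'(1)] less.prems(4)[OF A'(1)] by blast
    qed
    have inJ': "(\<lambda>T. \<Sum>B\<in>F1'. c (insert e B) * mono_fun B T) \<in> J'"
    proof -
      let ?f = "\<lambda>T. \<Sum>B\<in>F1'. c (insert e B) * mono_fun B T"
      let ?s = "\<lambda>T. - 1 * (\<Sum>A\<in>F0. c A * mono_fun A T)"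
      have 1: "?f \<in> dep_funs L'" using F1'L by (intro dep_funs_sum mono_fun_dep) blast+
      have 2: "?s \<in> dep_funs L'" using dep_funs_cmul[OF s0] .
      \<comment> \<open>The relation, solved for the terms containing e, is exactly the equation
        that defines membership in \<open>J'\<close>.\<close>
      have "mono_fun {e} * ?f = ?s + (\<lambda>T. \<Sum>A\<in>\<F>. c A * mono_fun A T)"
        using split sum1 by (auto simp: fun_eq_iff)
      then show ?thesis unfolding J'_def using 1 2 less.prems(5) by blast
    qed
    have U1: "card (\<Union>F1') < card ?U"
    proof (rule psubset_card_mono[OF finU])
      show "\<Union>F1' \<subset> ?U" using e(1) unfolding F1'_def F1_def by auto
    qed
    have c1: "c A = 0" if "A \<in> F1" for A
    proof -
      have "A - {e} \<in> F1'" using that by (auto simp: F1'_def)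
      moreover have "finite F1'" using fin by (simp add: F1'_def)
      ultimately have "c (insert e (A - {e})) = 0"
        using less.hyps[OF U1 J' dL' _ F1'L inJ'] by blast
      moreover have "insert e (A - {e}) = A" using that by (auto simp: F1_def)
      ultimately show ?thesis by simp
    qed
    have "(\<lambda>T. \<Sum>A\<in>\<F>. c A * mono_fun A T) = (\<lambda>T. \<Sum>A\<in>F0. c A * mono_fun A T)"
      unfolding split using c1 by simp
    then have inJ0: "(\<lambda>T. \<Sum>A\<in>F0. c A * mono_fun A T) \<in> J" using less.prems(5) by metis
    have U0: "card (\<Union>F0) < card ?U"
    proof (rule psubset_card_mono[OF finU])
      show "\<Union>F0 \<subset> ?U" using e(1) unfolding F0_def by auto
    qed
    have "c A = 0" if "A \<in> F0" for A
      by (rule less.hyps[OF U0 less.prems(1,2) fin(1) _ inJ0 that]) (use less.prems(4) F0_def in blast)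
    then show ?thesis using c1 less.prems(6) unfolding F0_def F1_def by blast
  qed
qed

text \<open>Well-founded induction: a set that is not good is replaced, modulo J, by smaller ones.
  Since L is an initial segment these stay inside L, so the same J serves for the subfamily and for
  the whole family.\<close>

lemma good_spans:
  assumes J: "supp_ideal L0 J" and L: "down L" and "finite A" "A \<subseteq> L"
  shows "\<exists>j\<in>J. \<exists>s\<in>int_fun.span (mono_fun ` {B. finite B \<and> B \<subseteq> L \<and> good J B}). mono_fun A = j + s"
  using assms(3,4)
proof (induction A rule: wf_induct_rule[OF wf_mless])
  case (1 A)
  let ?G = "mono_fun ` {B. finite B \<and> B \<subseteq> L \<and> good J B}"
  show ?case
  proof (cases "good J A")
    case True
    then have "mono_fun A \<in> int_fun.span ?G" using 1(2,3) by (intro int_fun.span_base) blast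
    moreover have "0 \<in> J" using supp_ideal_0[OF J] .
    ultimately show ?thesis by (intro bexI[of _ 0] bexI[of _ "mono_fun A"]) simp_all
  next
    case False
    then obtain j s where js: "j \<in> J" "s \<in> int_fun.span (mono_fun ` smaller A)" "mono_fun A = j + s"
      unfolding good_def by blast
    have JJ: "(\<lambda>T. k * g T) \<in> J" if "g \<in> J" for g k
    proof -
      have "(\<lambda>T. k * g T) \<in> dep_funs L0" using that supp_ideal_dep[OF J] dep_funs_cmul by blast
      then show ?thesis by (rule supp_ideal_supp[OF J _ that]) simp
    qed
    have "\<exists>j\<in>J. \<exists>s'\<in>int_fun.span ?G. s = j + s'"
      using js(2)
    proof (induction rule: int_fun.span_induct_alt)
      case base
      have "0 \<in> J" using supp_ideal_0[OF J] .
      then show ?case using int_fun.span_zero[of ?G] by (intro bexI[of _ 0]) auto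
    next
      case (step k x y)
      then obtain B where B: "B \<in> smaller A" "x = mono_fun B" by blast
      have "B \<subseteq> L" using smaller_down[OF B(1) L 1(3)] .
      then obtain j1 s1 where 2: "j1 \<in> J" "s1 \<in> int_fun.span ?G" "x = j1 + s1"
        using 1(1)[of B] 1(2) B unfolding smaller_def by blast
      obtain j2 s2 where 3: "j2 \<in> J" "s2 \<in> int_fun.span ?G" "y = j2 + s2" using step by blast
      have "(\<lambda>T. k * x T) + y = ((\<lambda>T. k * j1 T) + j2) + ((\<lambda>T. k * s1 T) + s2)"
        using 2 3 by (auto simp: fun_eq_iff algebra_simps)
      moreover have "(\<lambda>T. k * j1 T) + j2 \<in> J" using JJ 2 3 supp_ideal_add[OF J] by blast
      moreover have "(\<lambda>T. k * s1 T) + s2 \<in> int_fun.span ?G" using 2 3 by (intro int_fun.span_add int_fun.span_scale)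
      ultimately show ?case by blast
    qed
    then obtain j' s' where "j' \<in> J" "s' \<in> int_fun.span ?G" "s = j' + s'" by blast
    then show ?thesis using js supp_ideal_add[OF J, of j j']
      by (intro bexI[of _ "j + j'"] bexI[of _ s']) (simp_all add: add.assoc)
  qed
qed

end

section \<open>Bases of characteristic functions adapted to a subfamily\<close>

definition char_fn :: "'x set \<Rightarrow> 'x \<Rightarrow> int" where
  "char_fn U x = of_bool (x \<in> U)"

definition char_fn_independent :: "'x set set \<Rightarrow> bool" where
  "char_fn_independent H \<longleftrightarrow> (\<forall>F c. finite F \<and> F \<subseteq> H \<and> (\<forall>x. (\<Sum>U\<in>F. c U * char_fn U x) = 0) \<longrightarrow> (\<forall>U\<in>F. c U = 0))"

text \<open>The point is \<open>G \<subseteq> H\<close>: the quotient of the two spans is then free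
  on H - G. Closure under intersection turns every nonempty monomial in letters of a family into the
  characteristic function of a member of that family.\<close>

lemma noebeling:
  fixes \<AA> \<BB> :: "'x set set"
  assumes sub: "\<AA> \<subseteq> \<BB>"
    and intA: "\<And>U V. U \<in> \<AA> \<Longrightarrow> V \<in> \<AA> \<Longrightarrow> U \<inter> V \<in> \<AA>"
    and intB: "\<And>U V. U \<in> \<BB> \<Longrightarrow> V \<in> \<BB> \<Longrightarrow> U \<inter> V \<in> \<BB>"
  obtains G H where "G \<subseteq> H" "G \<subseteq> \<AA>" "H \<subseteq> \<BB>"
    "int_fun.span (char_fn ` \<AA>) = int_fun.span (char_fn ` G)" "int_fun.span (char_fn ` \<BB>) = int_fun.span (char_fn ` H)"
    "char_fn_independent H"
proof -
  obtain r0 :: "'x set rel" where r0: "well_order_on UNIV r0" using well_order_on by blast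
  \<comment> \<open>The rank 0, 1, 2 is compared first, which makes both families initial segments;
    rank 2 takes the remaining sets, so that the order is total on the type.\<close>
  define r where "r = inv_image (less_than <*lex*> (r0 - Id)) (\<lambda>U. ((if U \<in> \<AA> then 0 else if U \<in> \<BB> then 1 else 2::nat), U))"
  have wf0: "wf (r0 - Id)" "trans (r0 - Id)" and tot0: "\<And>a b. a \<noteq> b \<Longrightarrow> (a,b) \<in> r0 - Id \<or> (b,a) \<in> r0 - Id"
  proof -
    have *: "linear_order_on UNIV r0" "wf (r0 - Id)" using r0 unfolding well_order_on_def by blast+
    then show "wf (r0 - Id)" by blast
    show "trans (r0 - Id)" using *(1)
      unfolding linear_order_on_def partial_order_on_def preorder_on_def by (intro trans_diff_Id) blast+
    show "a \<noteq> b \<Longrightarrow> (a,b) \<in> r0 - Id \<or> (b,a) \<in> r0 - Id" for a b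
      using *(1) unfolding linear_order_on_def total_on_def by blast
  qed
  interpret letters r
  proof
    show "wf r" unfolding r_def using wf0 by (intro wf_inv_image wf_lex_prod) auto
    show "trans r" unfolding r_def using wf0 by (intro trans_inv_image trans_lex_prod) auto
    show "a \<noteq> b \<Longrightarrow> (a,b) \<in> r \<or> (b,a) \<in> r" for a b using tot0[of a b] unfolding r_def by auto
  qed
  have "(b \<in> \<AA> \<longrightarrow> a \<in> \<AA>) \<and> (b \<in> \<BB> \<longrightarrow> a \<in> \<BB>)" if "(a,b) \<in> r" for a b
    using that sub unfolding r_def by (auto split: if_splits)
  then have down: "down \<AA>" "down \<BB>" unfolding down_def by blast+
  \<comment> \<open>At the point C x exactly the letters containing x have value 1, so evaluation at
    C x turns a function of letters into a function on the space, and monomials into characteristic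
    functions of intersections.\<close>
  define C where "C x = {U\<in>\<BB>. x \<in> U}" for x
  \<comment> \<open>The condition at \<open>{}\<close> separates the constant 1, the empty monomial, from the others.\<close>
  define J :: "('x set set \<Rightarrow> int) set" where "J = {f\<in>dep_funs UNIV. (\<forall>x. f (C x) = 0) \<and> f {} = 0}"
  have J: "supp_ideal UNIV J" unfolding supp_ideal_def
  proof (intro conjI ballI impI)
    show "J \<subseteq> dep_funs UNIV" "0 \<in> J" using dep_funs_0 unfolding J_def by auto
    show "f + g \<in> J" if "f \<in> J" "g \<in> J" for f g using that dep_funs_add unfolding J_def by auto
    show "f \<in> J" if "f \<in> dep_funs UNIV" "g \<in> J" "\<forall>T. g T = 0 \<longrightarrow> f T = 0" for f g
      using that unfolding J_def by blast
  qed
  have mono_C: "mono_fun A (C x) = char_fn (\<Inter>A) x" if "A \<subseteq> \<BB>" for A x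
    using that by (auto simp: mono_fun_def C_def char_fn_def)
  have Inter_mem: "\<Inter>A \<in> \<CC>" if "finite A" "A \<noteq> {}" "A \<subseteq> \<CC>" "\<And>U V. U \<in> \<CC> \<Longrightarrow> V \<in> \<CC> \<Longrightarrow> U \<inter> V \<in> \<CC>"
    for A \<CC> using that by (induction A rule: finite_ne_induct) auto
  \<comment> \<open>The empty set is left out because its intersection is the whole type, which need
    not belong to the family.\<close>
  define GG where "GG L = {A. finite A \<and> A \<noteq> {} \<and> A \<subseteq> L \<and> good J A}" for L
  have spanL: "int_fun.span (char_fn ` L) = int_fun.span (char_fn ` (Inter ` GG L))"
    if L: "down L" "L \<subseteq> \<BB>" "\<And>U V. U \<in> L \<Longrightarrow> V \<in> L \<Longrightarrow> U \<inter> V \<in> L" for L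
  proof (intro equalityI int_fun.span_minimal int_fun.subspace_span)
    show "char_fn ` Inter ` GG L \<subseteq> int_fun.span (char_fn ` L)"
      using Inter_mem[OF _ _ _ L(3)] unfolding GG_def by (auto intro!: int_fun.span_base)
    show "char_fn ` L \<subseteq> int_fun.span (char_fn ` (Inter ` GG L))"
    proof clarify
      fix U assume U: "U \<in> L"
      let ?S = "{B. finite B \<and> B \<subseteq> L \<and> good J B}"
      obtain j s where js: "j \<in> J" "s \<in> int_fun.span (mono_fun ` ?S)" "mono_fun {U} = j + s"
        using good_spans[OF J L(1), of "{U}"] U by auto
      have "mono_fun ` ?S \<subseteq> insert (mono_fun {}) (mono_fun ` GG L)" unfolding GG_def by auto
      then have "s \<in> int_fun.span (insert (mono_fun {}) (mono_fun ` GG L))" using js(2) int_fun.span_mono by blast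
      then obtain k where k: "s - (\<lambda>T. k * mono_fun {} T) \<in> int_fun.span (mono_fun ` GG L)"
        unfolding int_fun.span_insert by blast
      have res: "f {} = 0 \<and> (\<lambda>x. f (C x)) \<in> int_fun.span (char_fn ` (Inter ` GG L))" if "f \<in> int_fun.span (mono_fun ` GG L)" for f
        using that
      proof (induction rule: int_fun.span_induct_alt)
        case base then show ?case using int_fun.span_zero by (simp add: zero_fun_def)
      next
        case (step c f g)
        then obtain A where A: "A \<in> GG L" "f = mono_fun A" by blast
        have "(\<lambda>x. f (C x)) = char_fn (\<Inter>A)" using A L(2) mono_C unfolding GG_def by (auto simp: fun_eq_iff)
        then have "(\<lambda>x. f (C x)) \<in> int_fun.span (char_fn ` (Inter ` GG L))"
          using A by (auto intro!: int_fun.span_base)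
        then have "(\<lambda>x. c * f (C x)) \<in> int_fun.span (char_fn ` (Inter ` GG L))"
          using int_fun.span_scale by blast
        then have "(\<lambda>x. c * f (C x)) + (\<lambda>x. g (C x)) \<in> int_fun.span (char_fn ` (Inter ` GG L))"
          using step int_fun.span_add by blast
        moreover have "f {} = 0" using A by (auto simp: GG_def mono_fun_def)
        ultimately show ?case using step by (simp add: plus_fun_def)
      qed
      \<comment> \<open>At the point {} every nonempty monomial vanishes, so the equation reads 0 =
        k there and the constant term disappears.\<close>
      have "mono_fun {U} {} = 0" "mono_fun {} ({} :: 'x set set) = 1" "j {} = 0" using js(1) by (auto simp: mono_fun_def J_def)
      moreover have "mono_fun {U} {} = j {} + s {}" using js(3) by (metis plus_fun_apply)
      ultimately have "k = 0" using res[OF k] by auto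
      then have s: "s \<in> int_fun.span (mono_fun ` GG L)" using k by (simp add: fun_diff_def)
      have "char_fn U x = s (C x)" for x
        using fun_cong[OF js(3), of "C x"] js(1) mono_C[of "{U}" x] U L(2) by (auto simp: J_def)
      then have "char_fn U = (\<lambda>x. s (C x))" by auto
      then show "char_fn U \<in> int_fun.span (char_fn ` (Inter ` GG L))" using res[OF s] by simp
    qed
  qed
  have indep: "c A = 0" if FF: "finite \<F>" "\<F> \<subseteq> GG \<BB>" "\<And>x. (\<Sum>A\<in>\<F>. c A * char_fn (\<Inter>A) x) = 0" "A \<in> \<F>" for \<F> c A
  proof (rule good_independent[OF J _ FF(1) _ _ FF(4)])
    show "down UNIV" by (simp add: down_def)
    show "\<And>A. A \<in> \<F> \<Longrightarrow> finite A \<and> A \<subseteq> UNIV \<and> good J A" using FF(2) by (auto simp: GG_def)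
    have "(\<lambda>T. \<Sum>A\<in>\<F>. c A * mono_fun A T) \<in> dep_funs UNIV"
      using FF(2) by (intro dep_funs_sum mono_fun_dep) (auto simp: GG_def)
    moreover have "(\<Sum>A\<in>\<F>. c A * mono_fun A (C x)) = 0" for x
    proof -
      have "(\<Sum>A\<in>\<F>. c A * mono_fun A (C x)) = (\<Sum>A\<in>\<F>. c A * char_fn (\<Inter>A) x)"
        by (rule sum.cong) (use FF(2) mono_C in \<open>auto simp: GG_def\<close>)
      then show ?thesis using FF(3) by simp
    qed
    moreover have "(\<Sum>A\<in>\<F>. c A * mono_fun A {}) = 0"
      by (rule sum.neutral) (use FF(2) in \<open>auto simp: GG_def mono_fun_def\<close>)
    ultimately show "(\<lambda>T. \<Sum>A\<in>\<F>. c A * mono_fun A T) \<in> J" unfolding J_def by blast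
  qed
  \<comment> \<open>Two sets with the same intersection would give a relation with coefficients 1
    and -1.\<close>
  have injI: "inj_on Inter (GG \<BB>)"
  proof (rule inj_onI, rule ccontr)
    fix A B assume AB: "A \<in> GG \<BB>" "B \<in> GG \<BB>" "\<Inter>A = \<Inter>B" "A \<noteq> B"
    let ?c = "\<lambda>D. if D = A then 1 else -1::int"
    have "(\<Sum>D\<in>{A,B}. ?c D * char_fn (\<Inter>D) x) = 0" for x
      using AB(3,4) by simp
    then have "?c A = 0" by (intro indep[of "{A,B}" ?c A]) (use AB(1,2) in blast)+
    then show False by simp
  qed
  show thesis
  proof (rule that[of "Inter ` GG \<AA>" "Inter ` GG \<BB>"])
    have "GG \<AA> \<subseteq> GG \<BB>" using sub unfolding GG_def by blast
    then show "Inter ` GG \<AA> \<subseteq> Inter ` GG \<BB>" by (rule image_mono)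
    have "\<Inter>A \<in> \<AA>" if "A \<in> GG \<AA>" for A
      by (rule Inter_mem[OF _ _ _ intA]) (use that in \<open>simp_all add: GG_def\<close>)
    then show "Inter ` GG \<AA> \<subseteq> \<AA>" by blast
    have "\<Inter>A \<in> \<BB>" if "A \<in> GG \<BB>" for A
      by (rule Inter_mem[OF _ _ _ intB]) (use that in \<open>simp_all add: GG_def\<close>)
    then show "Inter ` GG \<BB> \<subseteq> \<BB>" by blast
    show "int_fun.span (char_fn ` \<AA>) = int_fun.span (char_fn ` (Inter ` GG \<AA>))"
      "int_fun.span (char_fn ` \<BB>) = int_fun.span (char_fn ` (Inter ` GG \<BB>))"
      using spanL[OF down(1) sub intA] spanL[OF down(2) order_refl intB] by auto
    show "char_fn_independent (Inter ` GG \<BB>)" unfolding char_fn_independent_def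
    proof (intro allI impI ballI, elim conjE)
      fix F c U assume F: "finite F" "F \<subseteq> Inter ` GG \<BB>" "\<forall>x. (\<Sum>U\<in>F. c U * char_fn U x) = 0" "U \<in> F"
      obtain \<F> where \<F>: "\<F> \<subseteq> GG \<BB>" "F = Inter ` \<F>" using F(2) by (meson subset_imageE)
      have inj: "inj_on Inter \<F>" using \<F>(1) injI inj_on_subset by blast
      then have fin: "finite \<F>" using F(1) \<F>(2) finite_image_iff by blast
      have "(\<Sum>A\<in>\<F>. c (\<Inter>A) * char_fn (\<Inter>A) x) = 0" for x
        using F(3)[rule_format, of x] unfolding \<F>(2) sum.reindex[OF inj] by simp
      then have "c (\<Inter>A) = 0" if "A \<in> \<F>" for A using indep[OF fin \<F>(1), of "\<lambda>A. c (\<Inter>A)"] that by blast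
      then show "c U = 0" using F(4) \<F>(2) by auto
    qed
  qed
qed

section \<open>Factorization into radical ideals in subrings of a field\<close>

definition add_closed :: "'k::field set \<Rightarrow> bool" where
  "add_closed N \<longleftrightarrow> 0 \<in> N \<and> (\<forall>x\<in>N. \<forall>y\<in>N. x + y \<in> N)"

text \<open>No ring occurs in this product of additive sets. Hence one operation serves for the
  ideals of any subring, and the extension of an ideal I to a localization B is written
  \<open>iprod I B\<close>.\<close>

inductive_set iprod :: "'k::field set \<Rightarrow> 'k set \<Rightarrow> 'k set" for I J where
  iprod_0: "0 \<in> iprod I J"
| iprod_step: "x \<in> I \<Longrightarrow> y \<in> J \<Longrightarrow> z \<in> iprod I J \<Longrightarrow> x * y + z \<in> iprod I J"

definition is_subring :: "'k::field set \<Rightarrow> bool" where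
  "is_subring A \<longleftrightarrow> add_closed A \<and> 1 \<in> A \<and> (\<forall>x\<in>A. - x \<in> A) \<and> (\<forall>x\<in>A. \<forall>y\<in>A. x * y \<in> A)"

definition is_submodule :: "'k::field set \<Rightarrow> 'k set \<Rightarrow> bool" where
  "is_submodule A I \<longleftrightarrow> add_closed I \<and> (\<forall>r\<in>A. \<forall>x\<in>I. r * x \<in> I)"

definition iprod_list :: "'k::field set \<Rightarrow> 'k set list \<Rightarrow> 'k set" where
  "iprod_list A Js = foldr iprod Js A"

definition radical_in :: "'k::field set \<Rightarrow> 'k set \<Rightarrow> bool" where
  "radical_in A J \<longleftrightarrow> is_submodule A J \<and> J \<subseteq> A \<and> (\<forall>x\<in>A. \<forall>n::nat. x ^ n \<in> J \<longrightarrow> x \<in> J)"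

definition prime_in :: "'k::field set \<Rightarrow> 'k set \<Rightarrow> bool" where
  "prime_in A P \<longleftrightarrow> is_submodule A P \<and> P \<subseteq> A \<and> 1 \<notin> P \<and> (\<forall>x\<in>A. \<forall>y\<in>A. x * y \<in> P \<longrightarrow> x \<in> P \<or> y \<in> P)"

definition SP_subring :: "'k::field set \<Rightarrow> bool" where
  "SP_subring A \<longleftrightarrow> (\<forall>I. is_submodule A I \<and> I \<subseteq> A \<and> 1 \<notin> I \<longrightarrow> (\<exists>Js. (\<forall>J\<in>set Js. radical_in A J) \<and> I = iprod_list A Js))"

definition local_with :: "'k::field set \<Rightarrow> 'k set \<Rightarrow> bool" where
  "local_with A M \<longleftrightarrow> is_subring A \<and> prime_in A M \<and> (\<forall>x\<in>A - M. inverse x \<in> A)"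

definition localize :: "'k::field set \<Rightarrow> 'k set \<Rightarrow> 'k set" where
  "localize A P = {x / s |x s. x \<in> A \<and> s \<in> A - P}"

definition cyclic_mod :: "'k::field set \<Rightarrow> 'k \<Rightarrow> 'k set" where
  "cyclic_mod A a = (*) a ` A"

section \<open>Submodules of a field and their products\<close>

lemma add_closedD: "add_closed N \<Longrightarrow> 0 \<in> N" "add_closed N \<Longrightarrow> x \<in> N \<Longrightarrow> y \<in> N \<Longrightarrow> x + y \<in> N"
  unfolding add_closed_def by blast+

lemma is_subringD: "is_subring A \<Longrightarrow> 0 \<in> A" "is_subring A \<Longrightarrow> 1 \<in> A" "is_subring A \<Longrightarrow> x \<in> A \<Longrightarrow> y \<in> A \<Longrightarrow> x + y \<in> A"
  "is_subring A \<Longrightarrow> x \<in> A \<Longrightarrow> y \<in> A \<Longrightarrow> x * y \<in> A" "is_subring A \<Longrightarrow> x \<in> A \<Longrightarrow> - x \<in> A"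
  unfolding is_subring_def add_closed_def by blast+

lemma is_subring_diff: "is_subring A \<Longrightarrow> x \<in> A \<Longrightarrow> y \<in> A \<Longrightarrow> x - y \<in> A"
  using is_subringD(3)[of A x "-y"] is_subringD(5) by fastforce

lemma is_subring_power: "is_subring A \<Longrightarrow> x \<in> A \<Longrightarrow> x ^ (n::nat) \<in> A"
  by (induction n) (auto simp: is_subringD)

lemma is_submoduleD: "is_submodule A I \<Longrightarrow> 0 \<in> I" "is_submodule A I \<Longrightarrow> x \<in> I \<Longrightarrow> y \<in> I \<Longrightarrow> x + y \<in> I"
  "is_submodule A I \<Longrightarrow> r \<in> A \<Longrightarrow> x \<in> I \<Longrightarrow> r * x \<in> I" "is_submodule A I \<Longrightarrow> r \<in> A \<Longrightarrow> x \<in> I \<Longrightarrow> x * r \<in> I"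
  unfolding is_submodule_def add_closed_def by (auto simp: mult.commute)

lemma is_submodule_uminus: "is_subring A \<Longrightarrow> is_submodule A I \<Longrightarrow> x \<in> I \<Longrightarrow> - x \<in> I"
  using is_submoduleD(3)[of A I "-1" x] is_subringD(2,5)[of A] by auto

lemma is_submodule_diff: "is_subring A \<Longrightarrow> is_submodule A I \<Longrightarrow> x \<in> I \<Longrightarrow> y \<in> I \<Longrightarrow> x - y \<in> I"
  using is_submodule_uminus[of A I y] is_submoduleD(2)[of A I x "- y"] by simp

lemma is_submodule_addc: "is_submodule A I \<Longrightarrow> add_closed I"
  unfolding is_submodule_def by blast

lemma is_subring_modl: "is_subring A \<Longrightarrow> is_submodule A A"
  unfolding is_subring_def is_submodule_def by blast

lemma iprod_least: "add_closed N \<Longrightarrow> (\<And>x y. x \<in> I \<Longrightarrow> y \<in> J \<Longrightarrow> x * y \<in> N) \<Longrightarrow> iprod I J \<subseteq> N"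
proof
  fix z assume *: "add_closed N" "\<And>x y. x \<in> I \<Longrightarrow> y \<in> J \<Longrightarrow> x * y \<in> N" and "z \<in> iprod I J"
  from this(3) show "z \<in> N" by induction (auto intro: add_closedD * )
qed

lemma iprod_mem: "x \<in> I \<Longrightarrow> y \<in> J \<Longrightarrow> x * y \<in> iprod I J"
  using iprod_step[OF _ _ iprod_0] by fastforce

lemma iprod_addc: "add_closed (iprod I J)"
proof -
  have "x + y \<in> iprod I J" if "x \<in> iprod I J" "y \<in> iprod I J" for x y
    using that by (induction) (auto simp: add.assoc intro: iprod_step)
  then show ?thesis unfolding add_closed_def using iprod_0 by blast
qed

lemma iprod_mono: "I \<subseteq> I' \<Longrightarrow> J \<subseteq> J' \<Longrightarrow> iprod I J \<subseteq> iprod I' J'"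
  by (rule iprod_least[OF iprod_addc]) (auto intro: iprod_mem)

lemma iprod_comm: "iprod I J = iprod J I"
proof -
  have "iprod I J \<subseteq> iprod J I" for I J :: "'a set"
    by (rule iprod_least[OF iprod_addc]) (metis mult.commute iprod_mem)
  then show ?thesis by blast
qed

lemma iprod_assoc_le: "iprod (iprod I J) L \<subseteq> iprod I (iprod J L)"
proof (rule iprod_least[OF iprod_addc])
  fix x y assume x: "x \<in> iprod I J" and y: "y \<in> L"
  have "add_closed {x. x * y \<in> iprod I (iprod J L)}"
    using iprod_addc[of I "iprod J L"] unfolding add_closed_def by (auto simp: algebra_simps)
  then have "iprod I J \<subseteq> {x. x * y \<in> iprod I (iprod J L)}"
    by (rule iprod_least) (use y in \<open>auto simp: mult.assoc intro: iprod_mem\<close>)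
  then show "x * y \<in> iprod I (iprod J L)" using x by blast
qed

lemma iprod_assoc: "iprod (iprod I J) L = iprod I (iprod J L)"
proof
  show "iprod I (iprod J L) \<subseteq> iprod (iprod I J) L"
    using iprod_assoc_le[of L J I] by (simp add: iprod_comm)
qed (rule iprod_assoc_le)

lemma iprod_left_comm: "iprod I (iprod J L) = iprod J (iprod I L)"
  by (metis iprod_assoc iprod_comm)

lemma iprod_modl: assumes "is_submodule A I" shows "is_submodule A (iprod I J)"
proof -
  have "r * x \<in> iprod I J" if "r \<in> A" "x \<in> iprod I J" for r x
    using that(2)
  proof induction
    case (iprod_step x y z)
    then have "r * x * y + r * z \<in> iprod I J" using assms that(1) by (intro iprod.iprod_step) (auto intro: is_submoduleD)
    then show ?case by (simp add: algebra_simps)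
  qed (simp add: iprod_0)
  then show ?thesis unfolding is_submodule_def using iprod_addc by blast
qed

lemma iprod_sub: "is_submodule A I \<Longrightarrow> iprod I A \<subseteq> I"
  by (rule iprod_least) (auto intro: is_submodule_addc is_submoduleD)

lemma iprod_unit: "is_subring A \<Longrightarrow> is_submodule A I \<Longrightarrow> iprod I A = I"
  using iprod_sub iprod_mem[of _ I 1 A] is_subringD(2) by fastforce

lemma iprod_list_split: "iprod_list A (xs @ J # ys) = iprod J (iprod_list A (xs @ ys))"
  by (induction xs) (auto simp: iprod_list_def iprod_left_comm)

lemma iprod_list_Cons: "iprod_list A (J # Js) = iprod J (iprod_list A Js)"
  by (simp add: iprod_list_def)

lemma iprod_list_modl:
  assumes "is_subring A" "\<And>J. J \<in> set Js \<Longrightarrow> is_submodule A J \<and> J \<subseteq> A"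
  shows "is_submodule A (iprod_list A Js) \<and> iprod_list A Js \<subseteq> A"
  using assms(2)
proof (induction Js)
  case Nil then show ?case by (auto simp: iprod_list_def is_subring_modl assms)
next
  case (Cons J Js)
  then have *: "is_submodule A J" "J \<subseteq> A" "is_submodule A (iprod_list A Js)" "iprod_list A Js \<subseteq> A" by auto
  have "iprod J (iprod_list A Js) \<subseteq> iprod J A" using * iprod_mono by blast
  then show ?case using * iprod_modl iprod_sub unfolding iprod_list_Cons by blast
qed

lemma iprod_list_sub:
  assumes "is_subring A" "\<And>J. J \<in> set Js \<Longrightarrow> is_submodule A J \<and> J \<subseteq> A" "J \<in> set Js"
  shows "iprod_list A Js \<subseteq> J"
proof -
  obtain xs ys where *: "Js = xs @ J # ys" using assms(3) split_list by metis
  have "iprod_list A (xs @ ys) \<subseteq> A" using iprod_list_modl[of A "xs @ ys"] assms * by auto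
  then have "iprod_list A Js \<subseteq> iprod J A" unfolding * iprod_list_split using iprod_mono by blast
  then show ?thesis using iprod_sub assms by blast
qed

lemma cyclic_mod_modl: "is_subring A \<Longrightarrow> is_submodule A (cyclic_mod A a)"
  unfolding is_submodule_def add_closed_def cyclic_mod_def
  by (auto simp: image_iff mult.left_commute distrib_left[symmetric] intro: is_subringD bexI[of _ 0])

lemma cyclic_mod_self: "is_subring A \<Longrightarrow> a \<in> cyclic_mod A a"
  unfolding cyclic_mod_def using is_subringD(2) by (metis image_eqI mult.right_neutral)

lemma cyclic_mod_sub: "is_submodule A I \<Longrightarrow> a \<in> I \<Longrightarrow> cyclic_mod A a \<subseteq> I"
  unfolding cyclic_mod_def by (auto intro: is_submoduleD)

lemma cyclic_modI: "r \<in> A \<Longrightarrow> a * r \<in> cyclic_mod A a" "r \<in> A \<Longrightarrow> r * a \<in> cyclic_mod A a"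
  unfolding cyclic_mod_def by (auto simp: mult.commute)

lemma radical_in_modl: "radical_in A J \<Longrightarrow> is_submodule A J \<and> J \<subseteq> A"
  unfolding radical_in_def by blast

lemma prime_inD: "prime_in A P \<Longrightarrow> is_submodule A P" "prime_in A P \<Longrightarrow> P \<subseteq> A" "prime_in A P \<Longrightarrow> 1 \<notin> P"
  "prime_in A P \<Longrightarrow> x \<in> A \<Longrightarrow> y \<in> A \<Longrightarrow> x * y \<in> P \<Longrightarrow> x \<in> P \<or> y \<in> P"
  "prime_in A P \<Longrightarrow> 0 \<in> P"
  unfolding prime_in_def is_submodule_def add_closed_def by blast+

lemma prime_compl_mult: "is_subring A \<Longrightarrow> prime_in A P \<Longrightarrow> s \<in> A - P \<Longrightarrow> t \<in> A - P \<Longrightarrow> s * t \<in> A - P"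
  using prime_inD(4) is_subringD(4) by blast

lemma prime_power: "is_subring A \<Longrightarrow> prime_in A P \<Longrightarrow> x \<in> A \<Longrightarrow> x ^ (n::nat) \<in> P \<Longrightarrow> x \<in> P"
  by (induction n) (use prime_inD is_subring_power in \<open>fastforce+\<close>)

lemma iprod_list_prime:
  assumes "is_subring A" "prime_in A P" "\<And>J. J \<in> set Js \<Longrightarrow> is_submodule A J \<and> J \<subseteq> A" "iprod_list A Js \<subseteq> P"
  shows "\<exists>J\<in>set Js. J \<subseteq> P"
  using assms(3,4)
proof (induction Js)
  case Nil then show ?case using prime_inD(3)[OF assms(2)] is_subringD(2)[OF assms(1)] by (auto simp: iprod_list_def)
next
  case (Cons J Js)
  show ?case
  proof (rule ccontr)
    assume neg: "\<not> (\<exists>J\<in>set (J # Js). J \<subseteq> P)"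
    then obtain x where x: "x \<in> J" "x \<notin> P" by auto
    have "\<not> iprod_list A Js \<subseteq> P" using Cons.IH Cons.prems(1) neg by auto
    then obtain y where y: "y \<in> iprod_list A Js" "y \<notin> P" by blast
    have "x * y \<in> P" using iprod_mem[OF x(1) y(1)] Cons.prems(2) unfolding iprod_list_Cons by blast
    moreover have "y \<in> A" using iprod_list_modl[of A Js] assms(1) Cons.prems(1) y by auto
    ultimately show False using prime_inD(4)[OF assms(2)] x y Cons.prems(1) by auto
  qed
qed

section \<open>Localization at a prime and extension of ideals\<close>

lemma localizeI: "x \<in> A \<Longrightarrow> s \<in> A - P \<Longrightarrow> x / s \<in> localize A P"
  unfolding localize_def by blast

text \<open>B = B B provides one copy of B for each factor, so extension to a localization commutes
  with products.\<close>

lemma iprod_distrib: "iprod B B = B \<Longrightarrow> iprod (iprod J L) B = iprod (iprod J B) (iprod L B)"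
  by (simp add: iprod_assoc iprod_left_comm[of B L B])

text \<open>Common denominators turn a sum of fractions into one fraction. Membership in an extended
  ideal is tested through this description throughout.\<close>

lemma iprod_lo:
  assumes A: "is_subring A" "prime_in A P" and I: "is_submodule A I"
  shows "iprod I (localize A P) = {x / s |x s. x \<in> I \<and> s \<in> A - P}"
proof
  have nz: "s \<noteq> 0" if "s \<in> A - P" for s using that prime_inD(5)[OF A(2)] by auto
  show "iprod I (localize A P) \<subseteq> {x / s |x s. x \<in> I \<and> s \<in> A - P}"
  proof (rule iprod_least)
    have "x / s + y / t \<in> {x / s |x s. x \<in> I \<and> s \<in> A - P}" if "x \<in> I" "y \<in> I" "s \<in> A - P" "t \<in> A - P" for x y s t
    proof -
      have "x / s + y / t = (x * t + y * s) / (s * t)" using nz that by (simp add: add_frac_eq)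
      moreover have "x * t + y * s \<in> I" using that I is_submoduleD by (metis DiffD1)
      ultimately show ?thesis using prime_compl_mult[OF A] that by blast
    qed
    moreover have "0 \<in> {x / s |x s. x \<in> I \<and> s \<in> A - P}"
    proof -
      have "0 \<in> I" "1 \<in> A - P" "0 = 0 / (1 :: 'a)"
        using is_submoduleD(1)[OF I] is_subringD(2)[OF A(1)] prime_inD(3)[OF A(2)] by auto
      then show ?thesis by blast
    qed
    ultimately show "add_closed {x / s |x s. x \<in> I \<and> s \<in> A - P}" unfolding add_closed_def by blast
    fix x y assume xy: "x \<in> I" "y \<in> localize A P"
    then obtain b s where "b \<in> A" "s \<in> A - P" "y = b / s" unfolding localize_def by blast
    then have "x * y = (x * b) / s" "x * b \<in> I" "s \<in> A - P" using is_submoduleD(4)[OF I _ xy(1)] by auto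
    then show "x * y \<in> {x / s |x s. x \<in> I \<and> s \<in> A - P}" by blast
  qed
  show "{x / s |x s. x \<in> I \<and> s \<in> A - P} \<subseteq> iprod I (localize A P)"
  proof clarify
    fix x s assume "x \<in> I" "s \<in> A" "s \<notin> P"
    then have "1 / s \<in> localize A P" unfolding localize_def using is_subringD(2)[OF A(1)] by blast
    then show "x / s \<in> iprod I (localize A P)" using iprod_mem[OF \<open>x \<in> I\<close>] by fastforce
  qed
qed

lemma localize_sring: assumes A: "is_subring A" "prime_in A P" shows "is_subring (localize A P)"
proof -
  have localize: "localize A P = iprod A (localize A P)" using iprod_lo[OF A is_subring_modl[OF A(1)]] unfolding localize_def by simp
  have 1: "1 \<in> localize A P" using is_subringD(2)[OF A(1)] prime_inD(3)[OF A(2)] localizeI[of 1 A 1 P] by auto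
  have "- x \<in> localize A P" if x: "x \<in> localize A P" for x
  proof -
    obtain b s where "b \<in> A" "s \<in> A - P" "x = b / s" using x unfolding localize_def by blast
    then show ?thesis using localizeI[of "- b" A s P] is_subringD(5)[OF A(1)] by auto
  qed
  moreover have "x * y \<in> localize A P" if x: "x \<in> localize A P" and y: "y \<in> localize A P" for x y
  proof -
    obtain b s where b: "b \<in> A" "s \<in> A - P" "x = b / s" using x unfolding localize_def by blast
    obtain c t where c: "c \<in> A" "t \<in> A - P" "y = c / t" using y unfolding localize_def by blast
    have "b * c \<in> A" "s * t \<in> A - P" using b c is_subringD(4)[OF A(1)] prime_compl_mult[OF A] by auto
    moreover have "x * y = (b * c) / (s * t)" using b c by simp
    ultimately show ?thesis unfolding localize_def by blast
  qed
  moreover have "add_closed (localize A P)" using localize iprod_addc by metis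
  ultimately show ?thesis unfolding is_subring_def using 1 by blast
qed

lemma localize_mem: "prime_in A P \<Longrightarrow> is_subring A \<Longrightarrow> x \<in> A \<Longrightarrow> x \<in> localize A P"
  using is_subringD(2)[of A] prime_inD(3)[of A P] localizeI[of x A 1 P] by auto

lemma localize_inverse: "prime_in A P \<Longrightarrow> is_subring A \<Longrightarrow> s \<in> A - P \<Longrightarrow> inverse s \<in> localize A P"
  using is_subringD(2)[of A] localizeI[of 1 A s P] by (simp add: divide_inverse)

text \<open>Since Q lies in P, a denominator outside P is outside Q as well and can be cancelled
  modulo the prime Q: the extension of Q contracts back to Q.\<close>

lemma iprod_lo_prime:
  assumes A: "is_subring A" "prime_in A P" "prime_in A Q" "Q \<subseteq> P" and x: "x \<in> A" "s \<in> A - P" "x / s \<in> iprod Q (localize A P)"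
  shows "x \<in> Q"
proof -
  obtain y t where y: "y \<in> Q" "t \<in> A - P" "x / s = y / t"
    using x(3) iprod_lo[OF A(1,2) prime_inD(1)[OF A(3)]] by blast
  have "s \<noteq> 0" "t \<noteq> 0" using x y prime_inD(5)[OF A(2)] by auto
  then have "x * t = y * s" using y(3) by (simp add: field_simps)
  then have "x * t \<in> Q" using y x is_submoduleD(4)[OF prime_inD(1)[OF A(3)]] by simp
  then show ?thesis using prime_inD(4)[OF A(3)] x y A(4) by blast
qed

lemma localize_primel:
  assumes A: "is_subring A" "prime_in A P" "prime_in A Q" "Q \<subseteq> P"
  shows "prime_in (localize A P) (iprod Q (localize A P))"
  unfolding prime_in_def
proof (intro conjI ballI impI)
  have S: "is_subring (localize A P)" by (rule localize_sring[OF A(1,2)])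
  have mQ: "is_submodule A Q" using A(3) prime_inD by blast
  show "is_submodule (localize A P) (iprod Q (localize A P))" using iprod_modl[OF is_subring_modl[OF S], of Q] by (simp add: iprod_comm)
  have "Q \<subseteq> localize A P" using prime_inD(2)[OF A(3)] localize_mem[OF A(2,1)] by blast
  then show "iprod Q (localize A P) \<subseteq> localize A P"
    using iprod_mono[of Q "localize A P" "localize A P" "localize A P"] iprod_unit[OF S is_subring_modl[OF S]] by blast
  show "1 \<notin> iprod Q (localize A P)"
  proof
    assume "1 \<in> iprod Q (localize A P)"
    then have "1 / 1 \<in> iprod Q (localize A P)" by simp
    moreover have "(1::'a) \<in> A - P" using is_subringD(2)[OF A(1)] prime_inD(3)[OF A(2)] by blast
    ultimately have "1 \<in> Q" using iprod_lo_prime[OF A, of 1 1] by blast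
    then show False using prime_inD(3)[OF A(3)] by blast
  qed
  fix x y assume x: "x \<in> localize A P" and y: "y \<in> localize A P" and xy: "x * y \<in> iprod Q (localize A P)"
  obtain b s where b: "b \<in> A" "s \<in> A - P" "x = b / s" using x unfolding localize_def by blast
  obtain c t where c: "c \<in> A" "t \<in> A - P" "y = c / t" using y unfolding localize_def by blast
  have "b * c \<in> Q"
    by (rule iprod_lo_prime[OF A, of _ "s * t"])
      (use b c xy is_subringD(4)[OF A(1)] prime_compl_mult[OF A(1,2)] in auto)
  then have "b \<in> Q \<or> c \<in> Q" using prime_inD(4)[OF A(3)] b c by blast
  then show "x \<in> iprod Q (localize A P) \<or> y \<in> iprod Q (localize A P)"
    using b c unfolding iprod_lo[OF A(1,2) mQ] by blast
qed

lemma localize_lcl: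
  assumes A: "is_subring A" "prime_in A P"
  shows "local_with (localize A P) (iprod P (localize A P))"
  unfolding local_with_def
proof (intro conjI ballI)
  show "is_subring (localize A P)" by (rule localize_sring[OF A])
  show "prime_in (localize A P) (iprod P (localize A P))" by (rule localize_primel[OF A A(2)]) simp
  fix x assume x: "x \<in> localize A P - iprod P (localize A P)"
  then obtain b s where b: "b \<in> A" "s \<in> A - P" "x = b / s" unfolding localize_def by blast
  have "b \<notin> P" using x b iprod_lo[OF A prime_inD(1)[OF A(2)]] by blast
  then show "inverse x \<in> localize A P" using b unfolding localize_def by auto
qed

text \<open>An ideal of the localization is the extension of its contraction to A. The contraction
  is factored in A, and extension respects products and radical ideals.\<close>

lemma localize_SPr:
  assumes A: "is_subring A" "prime_in A P" "SP_subring A"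
  shows "SP_subring (localize A P)"
  unfolding SP_subring_def
proof (intro allI impI, elim conjE)
  let ?B = "localize A P"
  have S: "is_subring ?B" by (rule localize_sring[OF A(1,2)])
  have BB: "iprod ?B ?B = ?B" using iprod_unit[OF S is_subring_modl[OF S]] .
  fix I assume I: "is_submodule ?B I" "I \<subseteq> ?B" "1 \<notin> I"
  have AB: "A \<subseteq> ?B" using localize_mem[OF A(2,1)] by blast
  have mIA: "is_submodule A (I \<inter> A)"
    unfolding is_submodule_def add_closed_def using is_submoduleD[OF I(1)] is_subringD[OF A(1)] AB by auto
  then obtain Js where Js: "\<And>J. J \<in> set Js \<Longrightarrow> radical_in A J" "I \<inter> A = iprod_list A Js"
    using A(3) I(3) unfolding SP_subring_def by (metis IntD1 Int_lower2)
  have "I = iprod (I \<inter> A) ?B"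
  proof
    show "iprod (I \<inter> A) ?B \<subseteq> I" using iprod_mono[of "I \<inter> A" I ?B ?B] iprod_sub[OF I(1)] by blast
    show "I \<subseteq> iprod (I \<inter> A) ?B"
    proof
      fix x assume x: "x \<in> I"
      then obtain b s where b: "b \<in> A" "s \<in> A - P" "x = b / s" using I(2) unfolding localize_def by blast
      have "s \<noteq> 0" using b prime_inD(5)[OF A(2)] by auto
      then have bx: "x * s = b" using b by simp
      have "x * s \<in> I" by (rule is_submoduleD(4)[OF I(1) _ x]) (use b AB in blast)
      then have "b \<in> I" unfolding bx .
      then show "x \<in> iprod (I \<inter> A) ?B" using b iprod_lo[OF A(1,2) mIA] by blast
    qed
  qed
  moreover have "iprod (iprod_list A Ls) ?B = iprod_list ?B (map (\<lambda>J. iprod J ?B) Ls)" for Ls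
  proof (induction Ls)
    case Nil
    show ?case using iprod_lo[OF A(1,2) is_subring_modl[OF A(1)]] by (simp add: iprod_list_def localize_def)
  next
    case (Cons J Ls)
    have "iprod (iprod J (iprod_list A Ls)) ?B = iprod (iprod J ?B) (iprod (iprod_list A Ls) ?B)"
      using iprod_distrib[OF BB] .
    then show ?case using Cons by (simp add: iprod_list_Cons)
  qed
  moreover have "radical_in ?B (iprod J ?B)" if J: "J \<in> set Js" for J
    unfolding radical_in_def
  proof (intro conjI ballI allI impI)
    have J': "is_submodule A J" "J \<subseteq> A" using Js(1)[OF J] radical_in_modl by auto
    show "is_submodule ?B (iprod J ?B)" using iprod_modl[OF is_subring_modl[OF S], of J] by (simp add: iprod_comm)
    show "iprod J ?B \<subseteq> ?B" using J' AB BB iprod_mono[of J ?B ?B ?B] by blast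
    fix x and n :: nat assume x: "x \<in> ?B" "x ^ n \<in> iprod J ?B"
    obtain b s where b: "b \<in> A" "s \<in> A - P" "x = b / s" using x(1) unfolding localize_def by blast
    obtain c t where c: "c \<in> J" "t \<in> A - P" "x ^ n = c / t" using x(2) iprod_lo[OF A(1,2) J'(1)] by blast
    have nz: "s \<noteq> 0" "t \<noteq> 0" using b c prime_inD(5)[OF A(2)] by auto
    then have "b = x * s" "c = t * x ^ n" using b c by auto
    then have "t * b ^ n = c * s ^ n" by (simp add: power_mult_distrib mult.assoc)
    moreover have "s ^ n \<in> A" using is_subring_power[OF A(1)] b by blast
    ultimately have tJ: "t * b ^ n \<in> J" using is_submoduleD(4)[OF J'(1)] c by metis
    have "t * b \<in> J"
    proof (cases n)
      case 0 then show ?thesis using tJ is_submoduleD(4)[OF J'(1)] b by simp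
    next
      case (Suc m)
      \<comment> \<open>Clearing denominators leaves a single factor t; multiplying by t ^ m
        completes an n-th power of t * b, to which radicality applies.\<close>
      have "(t * b) ^ n = t ^ m * (t * b ^ n)" using Suc by (simp add: power_mult_distrib)
      moreover have "t ^ m \<in> A" using is_subring_power[OF A(1)] c by blast
      ultimately have "(t * b) ^ n \<in> J" using is_submoduleD(3)[OF J'(1)] tJ by simp
      moreover have "t * b \<in> A" using b c is_subringD(4)[OF A(1)] by blast
      ultimately show ?thesis using Js(1)[OF J] unfolding radical_in_def by blast
    qed
    moreover have "x = (t * b) / (t * s)" using b nz by simp
    moreover have "t * s \<in> A - P" using prime_compl_mult[OF A(1,2)] b c by blast
    ultimately show "x \<in> iprod J ?B" unfolding iprod_lo[OF A(1,2) J'(1)] by blast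
  qed
  ultimately show "\<exists>Ks. (\<forall>J\<in>set Ks. radical_in ?B J) \<and> I = iprod_list ?B Ks"
    using Js(2) by (intro exI[of _ "map (\<lambda>J. iprod J ?B) Js"]) auto
qed

section \<open>Minimal primes over an ideal\<close>

lemma is_submodule_binomial:
  assumes "is_subring A" "is_submodule A I" "x \<in> A" "y \<in> A" "u \<in> A" "u * x ^ n \<in> I" "u * y ^ m \<in> I"
  shows "u * (x + y) ^ (n + m) \<in> I"
  using assms(5-)
\<comment> \<open>Instead of a binomial expansion, one factor x + y is split off and the chosen
  summand is absorbed into u, which is therefore generalized.\<close>
proof (induction "n + m" arbitrary: n m u)
  case 0 then show ?case by simp
next
  case (Suc k)
  have p: "(x + y) ^ i \<in> A" "x ^ i \<in> A" "y ^ i \<in> A" for i :: nat using is_subring_power[OF assms(1)] is_subringD(3)[OF assms(1)] assms(3,4) by auto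
  show ?case
  proof (cases "n = 0 \<or> m = 0")
    case True
    then have "u \<in> I" using Suc by auto
    then show ?thesis using is_submoduleD(4)[OF assms(2)] p by blast
  next
    case False
    then obtain n' m' where nm: "n = Suc n'" "m = Suc m'" using not0_implies_Suc by blast
    have ux: "u * x \<in> A" "u * y \<in> A" using is_subringD(4)[OF assms(1)] Suc.prems assms by auto
    have "u * x * (x + y) ^ (n' + m) \<in> I"
    proof (rule Suc.hyps(1)[OF _ ux(1)])
      show "u * x * x ^ n' \<in> I" using Suc.prems(2) nm by (simp add: algebra_simps)
      show "u * x * y ^ m \<in> I" using is_submoduleD(3)[OF assms(2,3) Suc.prems(3)] by (simp add: algebra_simps)
    qed (use Suc nm in auto)
    moreover have "u * y * (x + y) ^ (n + m') \<in> I"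
    proof (rule Suc.hyps(1)[OF _ ux(2)])
      show "u * y * y ^ m' \<in> I" using Suc.prems(3) nm by (simp add: algebra_simps)
      show "u * y * x ^ n \<in> I" using is_submoduleD(3)[OF assms(2,4) Suc.prems(2)] by (simp add: algebra_simps)
    qed (use Suc nm in auto)
    ultimately have "u * x * (x + y) ^ (n' + m) + u * y * (x + y) ^ (n + m') \<in> I"
      using is_submoduleD(2)[OF assms(2)] by blast
    moreover have "u * x * (x + y) ^ (n' + m) + u * y * (x + y) ^ (n + m') = u * (x + y) ^ (n + m)"
      using nm by (simp add: algebra_simps)
    ultimately show ?thesis by simp
  qed
qed

text \<open>P is the complement of a multiplicative set that is maximal among those containing A - M
  and avoiding I. The last clause is minimality in usable form: after inverting an element outside
  P, every element of P has a power in I.\<close>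

lemma minimal_prime:
  assumes A: "is_subring A" "is_submodule A I" "prime_in A M" "I \<subseteq> M"
  shows "\<exists>P. prime_in A P \<and> I \<subseteq> P \<and> P \<subseteq> M \<and> (\<forall>x\<in>P. \<exists>s\<in>A - P. \<exists>n::nat. s * x ^ n \<in> I)"
proof -
  define \<S> where "\<S> = {S. S \<subseteq> A \<and> A - M \<subseteq> S \<and> (\<forall>x\<in>S. \<forall>y\<in>S. x * y \<in> S) \<and> S \<inter> I = {}}"
  have "A - M \<in> \<S>" unfolding \<S>_def using prime_compl_mult[OF A(1,3)] A(4) by auto
  moreover have "\<Union>\<C> \<in> \<S>" if "\<C> \<noteq> {}" "subset.chain \<S> \<C>" for \<C>
  proof -
    have C: "\<And>S. S \<in> \<C> \<Longrightarrow> S \<in> \<S>" "\<And>S T. S \<in> \<C> \<Longrightarrow> T \<in> \<C> \<Longrightarrow> S \<subseteq> T \<or> T \<subseteq> S"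
      using that(2) unfolding subset.chain_def by auto
    have "x * y \<in> \<Union>\<C>" if "x \<in> \<Union>\<C>" "y \<in> \<Union>\<C>" for x y
    proof -
      obtain S T where ST: "S \<in> \<C>" "T \<in> \<C>" "x \<in> S" "y \<in> T" using \<open>x \<in> \<Union>\<C>\<close> \<open>y \<in> \<Union>\<C>\<close> by blast
      then obtain W where "W \<in> \<C>" "x \<in> W" "y \<in> W" using C(2)[OF ST(1,2)] by blast
      then show ?thesis using C(1) unfolding \<S>_def by blast
    qed
    then show ?thesis using that(1) C(1) unfolding \<S>_def by blast
  qed
  ultimately obtain S where S: "S \<in> \<S>" "\<And>X. X \<in> \<S> \<Longrightarrow> S \<subseteq> X \<Longrightarrow> X = S"
    using subset_Zorn_nonempty[of \<S>] by blast
  have S': "S \<subseteq> A" "A - M \<subseteq> S" "\<And>x y. x \<in> S \<Longrightarrow> y \<in> S \<Longrightarrow> x * y \<in> S" "S \<inter> I = {}"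
    using S(1) unfolding \<S>_def by auto
  have 1: "1 \<in> S" using S'(2) is_subringD(2)[OF A(1)] prime_inD(3)[OF A(3)] by blast
  \<comment> \<open>By maximality the multiplicative set generated by S and x must meet I.\<close>
  have ex: "\<exists>s\<in>S. \<exists>n::nat. s * x ^ n \<in> I" if x: "x \<in> A - S" for x
  proof (rule ccontr)
    assume neg: "\<not> ?thesis"
    let ?T = "{s * x ^ n |s (n::nat). s \<in> S}"
    have "?T \<in> \<S>" unfolding \<S>_def
    proof (safe)
      fix s and n :: nat assume "s \<in> S" then show "s * x ^ n \<in> A"
        using S'(1) x is_subring_power[OF A(1)] is_subringD(4)[OF A(1)] by blast
    next
      fix y assume "y \<in> A" "y \<notin> M"
      then show "\<exists>s n. y = s * x ^ n \<and> s \<in> S" using S'(2) by (intro exI[of _ y] exI[of _ 0]) auto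
    next
      fix s n s' n' assume "s \<in> S" "s' \<in> S"
      then show "\<exists>t k. s * x ^ n * (s' * x ^ n') = t * x ^ k \<and> t \<in> S"
        using S'(3) by (intro exI[of _ "s * s'"] exI[of _ "n + n'"]) (auto simp: power_add algebra_simps)
    next
      fix s n assume "s \<in> S" "s * x ^ n \<in> I" then show "s * x ^ n \<in> {}" using neg by blast
    qed
    moreover have "S \<subseteq> ?T"
    proof
      fix s assume "s \<in> S"
      moreover have "s = s * x ^ (0::nat)" by simp
      ultimately show "s \<in> ?T" by blast
    qed
    ultimately have "?T = S" using S(2) by blast
    moreover have "1 * x ^ 1 \<in> ?T" using 1 by blast
    ultimately show False using x by simp
  qed
  have "prime_in A (A - S)" unfolding prime_in_def is_submodule_def add_closed_def
  proof (intro conjI ballI impI)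
    show "0 \<in> A - S" using is_submoduleD(1)[OF A(2)] S'(4) is_subringD(1)[OF A(1)] by blast
    show "1 \<notin> A - S" using 1 by blast
    fix x y assume "x \<in> A - S" "y \<in> A - S"
    then obtain s n t m where st: "s \<in> S" "s * x ^ n \<in> I" "t \<in> S" "t * y ^ m \<in> I" "x \<in> A" "y \<in> A"
      using ex by (metis Diff_iff)
    have "s * t * (x + y) ^ (n + m) \<in> I"
    proof (rule is_submodule_binomial[OF A(1,2) st(5,6)])
      show "s * t \<in> A" using st S'(1) is_subringD(4)[OF A(1)] by blast
      show "s * t * x ^ n \<in> I" using is_submoduleD(3)[OF A(2) _ st(2), of t] st S'(1) by (auto simp: algebra_simps)
      show "s * t * y ^ m \<in> I" using is_submoduleD(3)[OF A(2) _ st(4), of s] st S'(1) by (auto simp: algebra_simps)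
    qed
    moreover have "s * t * (x + y) ^ (n + m) \<in> S" if "x + y \<in> S"
    proof -
      have "(x + y) ^ k \<in> S" for k :: nat by (induction k) (use 1 that S'(3) in auto)
      then show ?thesis using S'(3) st by blast
    qed
    ultimately show "x + y \<in> A - S" using S'(4) st is_subringD(3)[OF A(1)] by blast
  next
    fix r x assume "r \<in> A" "x \<in> A - S"
    then obtain s n where sn: "s \<in> S" "s * x ^ n \<in> I" "x \<in> A" using ex by (metis Diff_iff)
    have "s * (r * x) ^ n = r ^ n * (s * x ^ n)" by (simp add: power_mult_distrib)
    then have "s * (r * x) ^ n \<in> I" using is_submoduleD(3)[OF A(2) is_subring_power[OF A(1) \<open>r \<in> A\<close>] sn(2)] by metis
    moreover have "s * (r * x) ^ n \<in> S" if "r * x \<in> S"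
    proof -
      have "(r * x) ^ k \<in> S" for k :: nat by (induction k) (use 1 that S'(3) in auto)
      then show ?thesis using S'(3) sn by blast
    qed
    ultimately show "r * x \<in> A - S" using S'(4) sn \<open>r \<in> A\<close> is_subringD(4)[OF A(1)] by blast
  qed (use S'(3) in auto)
  moreover have "I \<subseteq> A - S" using S'(4) A(4) prime_inD(2)[OF A(3)] by blast
  moreover have "A - S \<subseteq> M" using S'(2) by blast
  moreover have "\<forall>x\<in>A - S. \<exists>s\<in>A - (A - S). \<exists>n::nat. s * x ^ n \<in> I" using ex S'(1) by blast
  ultimately show ?thesis by blast
qed

section \<open>Principal ideals in local rings with radical factorization\<close>

lemma inv_principal:
  assumes A: "local_with A M" and J: "is_submodule A J" "is_submodule A B" "iprod J B = cyclic_mod A a" "a \<noteq> 0"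
  shows "\<exists>c\<in>J. J = cyclic_mod A c"
proof -
  have S: "is_subring A" "prime_in A M" using A unfolding local_with_def by auto
  \<comment> \<open>If all products lay in a M, so would a itself, and 1 would be in M. Hence some x
    * y is a times a unit, and this x generates J.\<close>
  have "\<exists>x\<in>J. \<exists>y\<in>B. x * y \<notin> cyclic_mod M a"
  proof (rule ccontr)
    assume "\<not> ?thesis"
    moreover have "add_closed (cyclic_mod M a)"
      using prime_inD(1)[OF S(2)] unfolding is_submodule_def add_closed_def cyclic_mod_def
      by (auto simp: image_iff distrib_left[symmetric])
    ultimately have "iprod J B \<subseteq> cyclic_mod M a" by (intro iprod_least) auto
    then have "a \<in> cyclic_mod M a" using J(3) cyclic_mod_self[OF S(1)] by blast
    then have "1 \<in> M" using J(4) unfolding cyclic_mod_def by auto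
    then show False using prime_inD(3)[OF S(2)] by blast
  qed
  then obtain x y where xy: "x \<in> J" "y \<in> B" "x * y \<notin> cyclic_mod M a" by blast
  then obtain u where u: "u \<in> A" "x * y = a * u" using iprod_mem[OF xy(1,2)] J(3) unfolding cyclic_mod_def by blast
  have "u \<notin> M" using xy u unfolding cyclic_mod_def by blast
  then have iu: "inverse u \<in> A" "u \<noteq> 0" using A u prime_inD(5)[OF S(2)] unfolding local_with_def by auto
  have "y \<noteq> 0" using u J(4) iu by auto
  have "J \<subseteq> cyclic_mod A x"
  proof
    fix m assume "m \<in> J"
    then obtain r where r: "r \<in> A" "m * y = a * r" using iprod_mem[OF _ xy(2)] J(3) unfolding cyclic_mod_def by blast
    have "x * y * inverse u = a * (u * inverse u)" unfolding u(2) by (simp only: mult.assoc)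
    then have "a = x * y * inverse u" using iu by simp
    then have "m * y = (x * y * inverse u) * r" using r(2) by metis
    then have "m * y = x * inverse u * r * y" by (simp only: mult_ac)
    then have "m = x * inverse u * r" using \<open>y \<noteq> 0\<close> mult_right_cancel by blast
    then have "m = x * (inverse u * r)" by (simp only: mult.assoc)
    then show "m \<in> cyclic_mod A x" using iu r is_subringD(4)[OF S(1)] cyclic_modI(1) by metis
  qed
  then show ?thesis using cyclic_mod_sub[OF J(1) xy(1)] xy(1) by blast
qed

lemma radical_in_unit_or_local:
  assumes "local_with A M" "radical_in A J"
  shows "J = A \<or> J \<subseteq> M"
proof -
  have S: "is_subring A" "prime_in A M" using assms unfolding local_with_def by auto
  have "J = A" if "x \<in> J" "x \<notin> M" for x
  proof -
    have "x \<in> A" using that assms(2) radical_in_modl by blast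
    then have "inverse x \<in> A" "x \<noteq> 0" using that assms(1) prime_inD(5)[OF S(2)] unfolding local_with_def by auto
    then have "1 \<in> J" using is_submoduleD(4)[of A J "inverse x" x] that(1) assms(2) radical_in_modl by auto
    then show ?thesis using is_submoduleD(4)[of A J _ 1] assms(2) radical_in_modl by fastforce
  qed
  then show ?thesis by blast
qed

lemma SP_subring_cyc:
  assumes "SP_subring A" "is_subring A" "q \<noteq> 0" "inverse q \<notin> A" "q \<in> A"
  obtains Js where "\<And>J. J \<in> set Js \<Longrightarrow> radical_in A J" "cyclic_mod A q = iprod_list A Js"
proof -
  have "1 \<notin> cyclic_mod A q"
  proof
    assume "1 \<in> cyclic_mod A q"
    then obtain r where "r \<in> A" "1 = q * r" unfolding cyclic_mod_def by blast
    then have "inverse q = r" using assms(3) by (simp add: inverse_unique)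
    then show False using \<open>r \<in> A\<close> assms(4) by simp
  qed
  then have "\<exists>Js. (\<forall>J\<in>set Js. radical_in A J) \<and> cyclic_mod A q = iprod_list A Js"
    using assms(1)[unfolded SP_subring_def, rule_format, of "cyclic_mod A q"] cyclic_mod_modl[OF assms(2), of q]
      cyclic_mod_sub[OF is_subring_modl[OF assms(2)] assms(5)] by blast
  then show thesis using that by blast
qed

text \<open>A radical factor J of (a) inside M contains a, and every element of M has a power in
  (a), so J = M. As a factor of a nonzero principal ideal, M is then principal by
  \<open>inv_principal\<close>.\<close>

lemma local_minimal_principal:
  assumes A: "local_with A M" "SP_subring A" and a: "a \<in> M" "a \<noteq> 0" "\<And>x. x \<in> M \<Longrightarrow> \<exists>n::nat. x ^ n \<in> cyclic_mod A a"
  shows "\<exists>t\<in>M. M = cyclic_mod A t"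
proof -
  have S: "is_subring A" "prime_in A M" using A unfolding local_with_def by auto
  have aA: "a \<in> A" using a prime_inD(2)[OF S(2)] by blast
  have "inverse a \<notin> A"
  proof
    assume "inverse a \<in> A"
    then have "1 \<in> M" using is_submoduleD(4)[OF prime_inD(1)[OF S(2)] _ a(1)] a(2) by fastforce
    then show False using prime_inD(3)[OF S(2)] by blast
  qed
  then obtain Js where Js: "\<And>J. J \<in> set Js \<Longrightarrow> radical_in A J" "cyclic_mod A a = iprod_list A Js"
    using SP_subring_cyc[OF A(2) S(1) a(2) _ aA] by metis
  have Jm: "\<And>J. J \<in> set Js \<Longrightarrow> is_submodule A J \<and> J \<subseteq> A" using Js(1) radical_in_modl by blast
  have "iprod_list A Js \<subseteq> M" using Js(2) cyclic_mod_sub[OF prime_inD(1)[OF S(2)] a(1)] by simp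
  then obtain J where J: "J \<in> set Js" "J \<subseteq> M" using iprod_list_prime[OF S Jm] by blast
  have "a \<in> J" using iprod_list_sub[OF S(1) Jm J(1)] Js(2) cyclic_mod_self[OF S(1)] by blast
  have "M \<subseteq> J"
  proof
    fix x assume x: "x \<in> M"
    then obtain n :: nat where "x ^ n \<in> cyclic_mod A a" using a(3) by blast
    then have "x ^ n \<in> J" using cyclic_mod_sub[of A J a] Jm[OF J(1)] \<open>a \<in> J\<close> by blast
    then show "x \<in> J" using Js(1)[OF J(1)] x prime_inD(2)[OF S(2)] unfolding radical_in_def by blast
  qed
  then have "J = M" using J(2) by blast
  obtain xs ys where sp: "Js = xs @ J # ys" using J(1) split_list by metis
  have "iprod M (iprod_list A (xs @ ys)) = cyclic_mod A a" using Js(2) sp iprod_list_split \<open>J = M\<close> by metis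
  then show ?thesis
    using inv_principal[OF A(1) prime_inD(1)[OF S(2)] _ _ a(2)] iprod_list_modl[OF S(1), of "xs @ ys"] Jm sp by auto
qed

lemma iprod_cyc: "is_subring A \<Longrightarrow> is_submodule A B \<Longrightarrow> iprod (cyclic_mod A c) B = (*) c ` B"
proof
  assume S: "is_subring A" "is_submodule A B"
  show "iprod (cyclic_mod A c) B \<subseteq> (*) c ` B"
  proof (rule iprod_least)
    show "add_closed ((*) c ` B)" using S(2) unfolding is_submodule_def add_closed_def
      by (auto simp: image_iff distrib_left[symmetric])
    show "x * y \<in> (*) c ` B" if "x \<in> cyclic_mod A c" "y \<in> B" for x y
      using that is_submoduleD(3)[OF S(2)] unfolding cyclic_mod_def by (auto simp: mult.assoc)
  qed
  show "(*) c ` B \<subseteq> iprod (cyclic_mod A c) B" using iprod_mem cyclic_mod_self[OF S(1)] by blast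
qed

text \<open>Induction on the radical factors of (q). Each factor is principal, and its generator is
  a unit or t times a unit, so the exponent of t is bounded by the number of factors; this takes the
  place of an argument on the intersection of the powers of M.\<close>

lemma local_principal_DVR:
  assumes A: "local_with A M" "SP_subring A" and M: "M = cyclic_mod A t" "t \<noteq> 0" and q: "q \<in> A" "q \<noteq> 0"
  shows "\<exists>(n::nat) u. q = t ^ n * u \<and> u \<in> A \<and> inverse u \<in> A"
proof -
  have S: "is_subring A" "prime_in A M" using A unfolding local_with_def by auto
  have step: "\<exists>(n::nat) u. q = t ^ n * u \<and> u \<in> A \<and> inverse u \<in> A"
    if "\<And>J. J \<in> set Js \<Longrightarrow> radical_in A J" "cyclic_mod A q = iprod_list A Js" "q \<noteq> 0" for Js q
    using that
  proof (induction Js arbitrary: q)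
    case Nil
    then have "q \<in> A" "1 \<in> cyclic_mod A q" using cyclic_mod_self[OF S(1), of q] is_subringD(2)[OF S(1)] by (auto simp: iprod_list_def)
    then obtain r where "r \<in> A" "1 = q * r" unfolding cyclic_mod_def by blast
    then have "inverse q \<in> A" using Nil(3) by (metis inverse_unique)
    then show ?case using \<open>q \<in> A\<close> by (intro exI[of _ 0] exI[of _ q]) auto
  next
    case (Cons J Js)
    let ?B = "iprod_list A Js"
    have J: "radical_in A J" "is_submodule A J" "J \<subseteq> A" using Cons.prems(1) radical_in_modl by auto
    have B: "is_submodule A ?B" "?B \<subseteq> A" using iprod_list_modl[OF S(1), of Js] Cons.prems(1) radical_in_modl by auto
    have prq: "iprod J ?B = cyclic_mod A q" using Cons.prems(2) by (simp add: iprod_list_Cons)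
    then obtain c where c: "c \<in> J" "J = cyclic_mod A c" using inv_principal[OF A(1) J(2) B(1) _ Cons.prems(3)] by blast
    have cB: "(*) c ` ?B = cyclic_mod A q" using prq c iprod_cyc[OF S(1) B(1)] by metis
    have "q \<in> (*) c ` ?B" unfolding cB by (rule cyclic_mod_self[OF S(1)])
    then have "c \<noteq> 0" using Cons.prems(3) by auto
    have "?B = cyclic_mod A (q / c)"
    proof -
      have "?B = (*) (1 / c) ` ((*) c ` ?B)" using \<open>c \<noteq> 0\<close> by (auto simp: image_image)
      also have "\<dots> = cyclic_mod A (q / c)" unfolding cB unfolding cyclic_mod_def by (auto simp: image_image)
      finally show ?thesis .
    qed
    then obtain n u where nu: "q / c = t ^ n * u" "u \<in> A" "inverse u \<in> A"
      using Cons.IH[of "q / c"] Cons.prems \<open>c \<noteq> 0\<close> by auto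
    have q: "q = c * t ^ n * u" using nu(1) \<open>c \<noteq> 0\<close> by (simp add: field_simps)
    show ?case
    proof (cases "c \<in> M")
      case False
      then have "inverse c \<in> A" using A(1) c J unfolding local_with_def by blast
      then have "c * u \<in> A" "inverse (c * u) \<in> A" using nu c J is_subringD(4)[OF S(1)] by auto
      then show ?thesis using q by (intro exI[of _ n] exI[of _ "c * u"]) (auto simp: algebra_simps)
    next
      case True
      then obtain e where e: "e \<in> A" "c = t * e" using M unfolding cyclic_mod_def by blast
      \<comment> \<open>Otherwise c = t * t * f and the square of t * f is c * f, an element of J.
        Radicality puts t * f into J = (c), and cancelling t * f makes t a unit.\<close>
      have "e \<notin> M"
      proof
        assume "e \<in> M"
        then obtain f where f: "f \<in> A" "e = t * f" using M unfolding cyclic_mod_def by blast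
        have "(t * f) ^ 2 = c * f" using e f by (simp add: power2_eq_square)
        then have "(t * f) ^ 2 \<in> J" using cyclic_modI(1)[OF f(1), of c] c(2) by simp
        moreover have "t * f \<in> A" using e f by simp
        ultimately have "t * f \<in> J" using J(1) unfolding radical_in_def by blast
        then obtain r where r: "r \<in> A" "t * f = c * r" using c(2) unfolding cyclic_mod_def by blast
        have ce: "c = t * (t * f)" using e(2) f(2) by simp
        have "t * f * 1 = c * r" using r(2) by simp
        also have "\<dots> = t * f * (t * r)" unfolding ce by (simp only: mult_ac)
        finally have "t * f * 1 = t * f * (t * r)" .
        moreover have "t * f \<noteq> 0" using \<open>c \<noteq> 0\<close> unfolding e(2) f(2) by auto
        ultimately have "1 = t * r" using mult_left_cancel by blast
        then have "1 \<in> M" using M cyclic_modI(1)[OF r(1), of t] by simp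
        then show False using prime_inD(3)[OF S(2)] by blast
      qed
      then have "inverse e \<in> A" using A(1) e unfolding local_with_def by blast
      then have "e * u \<in> A" "inverse (e * u) \<in> A" using nu e is_subringD(4)[OF S(1)] by auto
      then show ?thesis using q e by (intro exI[of _ "Suc n"] exI[of _ "e * u"]) (auto simp: algebra_simps)
    qed
  qed
  show ?thesis
  proof (cases "inverse q \<in> A")
    case True then show ?thesis using q by (intro exI[of _ 0] exI[of _ q]) auto
  next
    case False
    then obtain Js where "\<And>J. J \<in> set Js \<Longrightarrow> radical_in A J" "cyclic_mod A q = iprod_list A Js"
      using SP_subring_cyc[OF A(2) S(1) q(2) _ q(1)] by metis
    then show ?thesis using step q by blast
  qed
qed

section \<open>Proper inclusions between nonzero primes are excluded\<close>

definition plus_cyc :: "'k::field set \<Rightarrow> 'k set \<Rightarrow> 'k \<Rightarrow> 'k set" where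
  "plus_cyc A P b = {p + b * r |p r. p \<in> P \<and> r \<in> A}"

lemma plus_cycI: "p \<in> P \<Longrightarrow> r \<in> A \<Longrightarrow> p + b * r \<in> plus_cyc A P b"
  unfolding plus_cyc_def by blast

lemma plus_cyc_modl:
  assumes "is_subring A" "is_submodule A P" shows "is_submodule A (plus_cyc A P b)"
  unfolding is_submodule_def add_closed_def
proof (intro conjI ballI)
  show "0 \<in> plus_cyc A P b" using plus_cycI[OF is_submoduleD(1)[OF assms(2)] is_subringD(1)[OF assms(1)], of b] by simp
  fix x assume "x \<in> plus_cyc A P b"
  then obtain p r where x: "p \<in> P" "r \<in> A" "x = p + b * r" unfolding plus_cyc_def by blast
  show "x + y \<in> plus_cyc A P b" if y: "y \<in> plus_cyc A P b" for y
  proof -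
    obtain q s where y: "q \<in> P" "s \<in> A" "y = q + b * s" using y unfolding plus_cyc_def by blast
    have "x + y = (p + q) + b * (r + s)" using x y by (simp add: algebra_simps)
    then show ?thesis
      using plus_cycI[OF is_submoduleD(2)[OF assms(2) x(1) y(1)] is_subringD(3)[OF assms(1) x(2) y(2)]] by metis
  qed
  show "t * x \<in> plus_cyc A P b" if t: "t \<in> A" for t
  proof -
    have "t * x = t * p + b * (t * r)" using x by (simp add: algebra_simps)
    then show ?thesis
      using plus_cycI[OF is_submoduleD(3)[OF assms(2) t x(1)] is_subringD(4)[OF assms(1) t x(2)]] by metis
  qed
qed

lemma plus_cyc_sub: "is_submodule A I \<Longrightarrow> P \<subseteq> I \<Longrightarrow> b \<in> I \<Longrightarrow> plus_cyc A P b \<subseteq> I"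
  unfolding plus_cyc_def by (auto intro!: is_submoduleD(2) is_submoduleD(4))

lemma plus_cyc_base: "is_subring A \<Longrightarrow> P \<subseteq> plus_cyc A P b"
  using plus_cycI[of _ P 0 A b] is_subringD(1)[of A] by auto

lemma plus_cyc_gen: "is_subring A \<Longrightarrow> is_submodule A P \<Longrightarrow> b \<in> plus_cyc A P b"
  using plus_cycI[of 0 P 1 A b] is_subringD(2)[of A] is_submoduleD(1)[of A P] by auto

lemma local_with_unit_diff:
  assumes "local_with A M" "r \<in> M" shows "1 - r \<in> A" "inverse (1 - r) \<in> A" "1 - r \<noteq> 0"
proof -
  have S: "is_subring A" "prime_in A M" using assms unfolding local_with_def by auto
  show 1: "1 - r \<in> A" using is_subring_diff[OF S(1) is_subringD(2)[OF S(1)]] assms(2) prime_inD(2)[OF S(2)] by blast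
  have "1 - r \<notin> M"
  proof
    assume "1 - r \<in> M"
    then have "1 - r + r \<in> M" using is_submoduleD(2)[OF prime_inD(1)[OF S(2)]] assms(2) by blast
    then show False using prime_inD(3)[OF S(2)] by simp
  qed
  then show "inverse (1 - r) \<in> A" "1 - r \<noteq> 0" using assms(1) 1 prime_inD(5)[OF S(2)] unfolding local_with_def by auto
qed

text \<open>Nakayama's lemma for a single element: 1 - r is a unit.\<close>

lemma local_with_absorb:
  assumes "local_with A M" "is_submodule A I" "r \<in> M" "x - x * r \<in> I" shows "x \<in> I"
proof -
  have "(x - x * r) * inverse (1 - r) \<in> I"
    using is_submoduleD(4)[OF assms(2) local_with_unit_diff(2)[OF assms(1,3)] assms(4)] .
  moreover have "(x - x * r) * inverse (1 - r) = x"
    using local_with_unit_diff(3)[OF assms(1,3)] by (simp add: field_simps)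
  ultimately show ?thesis by simp
qed

text \<open>The three outcomes correspond to no factor, one factor, and at least two factors equal
  to N.\<close>

lemma iprod_list_unit_or_max:
  assumes "is_subring A" "is_submodule A N" "N \<subseteq> A" "\<And>J. J \<in> set Js \<Longrightarrow> J = A \<or> J = N"
  shows "iprod_list A Js = A \<or> iprod_list A Js = N \<or> iprod_list A Js \<subseteq> iprod N N"
  using assms(4)
proof (induction Js)
  case Nil then show ?case by (simp add: iprod_list_def)
next
  case (Cons J Js)
  have sub: "iprod_list A Js \<subseteq> A" "is_submodule A (iprod_list A Js)"
    using iprod_list_modl[OF assms(1), of Js] Cons.prems assms(2,3) is_subring_modl[OF assms(1)]
    by (metis dual_order.refl list.set_intros(2))+
  have IH: "iprod_list A Js = A \<or> iprod_list A Js = N \<or> iprod_list A Js \<subseteq> iprod N N" using Cons by auto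
  show ?case
  proof (cases "J = A")
    case True
    then have "iprod_list A (J # Js) = iprod_list A Js"
      using iprod_unit[OF assms(1) sub(2)] by (simp add: iprod_list_Cons iprod_comm)
    then show ?thesis using IH by simp
  next
    case False
    then have J: "J = N" using Cons.prems by auto
    have NN: "iprod N N \<subseteq> N" using iprod_mono[of N N N A] iprod_sub[OF assms(2)] assms(3) by blast
    then have "iprod N (iprod N N) \<subseteq> iprod N N" using iprod_mono by blast
    then show ?thesis using IH J iprod_unit[OF assms(1,2)] iprod_mono[of N N "iprod_list A Js" "iprod N N"]
      unfolding iprod_list_Cons by auto
  qed
qed

text \<open>Every radical factor of \<open>P + (b)\<close> and of \<open>P + (x\<^sup>2)\<close> is \<open>A\<close> or \<open>N\<close>; the first factorization
  produces \<open>x\<close>, and the second puts \<open>P\<close> inside \<open>N\<^sup>2\<close>.\<close>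

lemma local_prime_idempotent:
  assumes A: "local_with A N" "SP_subring A" and P: "prime_in A P" "P \<subseteq> N" and b: "b \<in> N" "b \<notin> P"
    and min: "\<And>J. radical_in A J \<Longrightarrow> P \<subseteq> J \<Longrightarrow> b \<in> J \<Longrightarrow> J = A \<or> J = N"
  shows "\<exists>x. N = plus_cyc A P x \<and> P \<subseteq> iprod P N"
proof -
  have S: "is_subring A" "prime_in A N" using A unfolding local_with_def by auto
  note mP = prime_inD(1)[OF P(1)] and mN = prime_inD(1)[OF S(2)] and NA = prime_inD(2)[OF S(2)]
  have proper: "\<exists>Js. (\<forall>J\<in>set Js. radical_in A J) \<and> I = iprod_list A Js" if "is_submodule A I" "I \<subseteq> N" for I
    using A(2) that NA prime_inD(3)[OF S(2)] unfolding SP_subring_def by blast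
  obtain Js where Js: "\<forall>J\<in>set Js. radical_in A J" "plus_cyc A P b = iprod_list A Js"
    using proper[OF plus_cyc_modl[OF S(1) mP] plus_cyc_sub[OF mN P(2) b(1)]] by blast
  have Jm: "\<And>J. J \<in> set Js \<Longrightarrow> is_submodule A J \<and> J \<subseteq> A" using Js(1) radical_in_modl by blast
  have "iprod_list A Js \<subseteq> N" using Js(2) plus_cyc_sub[OF mN P(2) b(1)] by simp
  then obtain J where J: "J \<in> set Js" "J \<subseteq> N" using iprod_list_prime[OF S Jm] by blast
  have "plus_cyc A P b \<subseteq> J" using iprod_list_sub[OF S(1) Jm J(1)] Js(2) by simp
  then have "P \<subseteq> J" "b \<in> J" using plus_cyc_base[OF S(1)] plus_cyc_gen[OF S(1) mP] by blast+
  then have "J = N" using min[of J] Js(1) J prime_inD(3)[OF S(2)] is_subringD(2)[OF S(1)] by blast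
  obtain xs ys where sp: "Js = xs @ J # ys" using J(1) split_list by metis
  define B where "B = iprod_list A (xs @ ys)"
  have NB: "iprod N B = plus_cyc A P b" using Js(2) sp iprod_list_split \<open>J = N\<close> B_def by metis
  have B: "is_submodule A B" "B \<subseteq> A" using iprod_list_modl[OF S(1), of "xs @ ys"] Jm sp B_def by auto
  \<comment> \<open>Modulo P this is the argument of \<open>inv_principal\<close>: if all products
    lay in P + b N, then so would b, and \<open>local_with_absorb\<close> would give b in P.\<close>
  have "\<exists>x\<in>N. \<exists>y\<in>B. x * y \<notin> {p + b * r |p r. p \<in> P \<and> r \<in> N}"
  proof (rule ccontr)
    assume neg: "\<not> ?thesis"
    have "add_closed {p + b * r |p r. p \<in> P \<and> r \<in> N}" unfolding add_closed_def
    proof (safe)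
      show "\<exists>p r. 0 = p + b * r \<and> p \<in> P \<and> r \<in> N"
        using is_submoduleD(1)[OF mP] is_submoduleD(1)[OF mN] by (intro exI[of _ 0]) simp
      fix p r p' r' assume "p \<in> P" "r \<in> N" "p' \<in> P" "r' \<in> N"
      then show "\<exists>q s. p + b * r + (p' + b * r') = q + b * s \<and> q \<in> P \<and> s \<in> N"
        using is_submoduleD(2)[OF mP] is_submoduleD(2)[OF mN]
        by (intro exI[of _ "p + p'"] exI[of _ "r + r'"]) (auto simp: algebra_simps)
    qed
    then have "iprod N B \<subseteq> {p + b * r |p r. p \<in> P \<and> r \<in> N}"
      by (rule iprod_least) (use neg in blast)
    then obtain p r where iprod: "b = p + b * r" "p \<in> P" "r \<in> N"
      using NB plus_cyc_gen[OF S(1) mP] by blast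
    then have "b - b * r \<in> P" by (metis add_diff_cancel_right')
    then show False using local_with_absorb[OF A(1) mP iprod(3)] b(2) by blast
  qed
  then obtain x y where xy: "x \<in> N" "y \<in> B" "x * y \<notin> {p + b * r |p r. p \<in> P \<and> r \<in> N}" by blast
  then obtain p r where iprod: "x * y = p + b * r" "p \<in> P" "r \<in> A"
    using iprod_mem[OF xy(1,2)] NB unfolding plus_cyc_def by blast
  have "r \<notin> N" using xy iprod by blast
  then have ir: "inverse r \<in> A" "r \<noteq> 0" using A(1) iprod prime_inD(5)[OF S(2)] unfolding local_with_def by auto
  have xA: "x \<in> A" "y \<in> A" using xy NA B by auto
  have xyP: "x * y \<notin> P"
  proof
    assume "x * y \<in> P"
    then have "b * r \<in> P" using is_submodule_diff[OF S(1) mP _ iprod(2), of "x * y"] iprod(1) by simp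
    then have "b * r * inverse r \<in> P" using is_submoduleD(4)[OF mP ir(1)] by blast
    then show False using ir b by (simp add: mult.assoc)
  qed
  then have xP: "x \<notin> P" and yP: "y \<notin> P" using is_submoduleD(3,4)[OF mP] xA by blast+
  \<comment> \<open>For m in N both m * y and x * y lie in P + (b), the latter with a unit
    coefficient at b. Eliminating b leaves (m - x * c) * y in P, and y is outside the prime
    P.\<close>
  have Nx: "N = plus_cyc A P x"
  proof
    show "plus_cyc A P x \<subseteq> N" by (rule plus_cyc_sub[OF mN P(2) xy(1)])
    show "N \<subseteq> plus_cyc A P x"
    proof
      fix m assume m: "m \<in> N"
      then obtain p' r' where iprod': "m * y = p' + b * r'" "p' \<in> P" "r' \<in> A"
        using iprod_mem[OF m xy(2)] NB unfolding plus_cyc_def by blast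
      define c where "c = inverse r * r'"
      have c: "c \<in> A" using ir iprod' is_subringD(4)[OF S(1)] unfolding c_def by blast
      have "(m - x * c) * y = m * y - (x * y) * c" by (simp add: algebra_simps)
      also have "\<dots> = p' + b * r' - (p * c + b * (r * inverse r) * r')"
        unfolding iprod(1) iprod'(1) c_def by (simp add: algebra_simps)
      also have "\<dots> = p' - p * c" using ir by simp
      finally have "(m - x * c) * y = p' - p * c" .
      then have "(m - x * c) * y \<in> P" using is_submodule_diff[OF S(1) mP] iprod iprod' is_submoduleD(4)[OF mP c] by simp
      moreover have "m - x * c \<in> A" using m NA c xA is_subringD(4)[OF S(1)] is_subring_diff[OF S(1)] by blast
      ultimately have "m - x * c \<in> P" using prime_inD(4)[OF P(1)] yP xA by blast
      then show "m \<in> plus_cyc A P x" using plus_cycI[OF _ c, of "m - x * c" P x] by simp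
    qed
  qed
  have x2: "x * x \<in> N" using is_submoduleD(4)[OF mN xA(1) xy(1)] .
  obtain Ls where Ls: "\<forall>J\<in>set Ls. radical_in A J" "plus_cyc A P (x * x) = iprod_list A Ls"
    using proper[OF plus_cyc_modl[OF S(1) mP] plus_cyc_sub[OF mN P(2) x2]] by blast
  have LAN: "J = A \<or> J = N" if J: "J \<in> set Ls" for J
  proof -
    have rJ: "radical_in A J" using Ls J by blast
    have "plus_cyc A P (x * x) \<subseteq> J" using iprod_list_sub[OF S(1) _ J] Ls radical_in_modl by metis
    then have "P \<subseteq> J" "x * x \<in> J" using plus_cyc_base[OF S(1)] plus_cyc_gen[OF S(1) mP] by blast+
    moreover from this(2) have "x \<in> J" using rJ xA(1) unfolding radical_in_def by (metis power2_eq_square)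
    ultimately have "N \<subseteq> J" unfolding Nx using plus_cyc_sub radical_in_modl[OF rJ] by blast
    then show ?thesis using min[OF rJ] P(2) b(1) by blast
  qed
  have "plus_cyc A P (x * x) \<noteq> A" using plus_cyc_sub[OF mN P(2) x2] prime_inD(3)[OF S(2)] is_subringD(2)[OF S(1)] by blast
  \<comment> \<open>With A and N excluded, at least two factors are equal to N, whence P lies in N
    N.\<close>
  moreover have "plus_cyc A P (x * x) \<noteq> N"
  proof
    assume "plus_cyc A P (x * x) = N"
    then obtain p s where ps: "x = p + x * x * s" "p \<in> P" "s \<in> A" using xy(1) unfolding plus_cyc_def by blast
    then have "x - x * (x * s) \<in> P" by (metis add_diff_cancel_right' mult.assoc)
    then have "x \<in> P" using local_with_absorb[OF A(1) mP] is_submoduleD(4)[OF mN ps(3) xy(1)] by blast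
    then show False using xP by blast
  qed
  ultimately have PNN: "P \<subseteq> iprod N N"
    using iprod_list_unit_or_max[OF S(1) mN NA LAN] Ls(2) plus_cyc_base[OF S(1), of P "x * x"] by auto
  have "P \<subseteq> iprod P N"
  proof
    fix q assume q: "q \<in> P"
    have mPN: "is_submodule A (iprod P N)" by (rule iprod_modl[OF mP])
    \<comment> \<open>This follows from N = P + (x). For an element of P the coefficient s at x * x
      lies in P, since x does not, and then s * (x * x) is in P N.\<close>
    have "iprod N N \<subseteq> plus_cyc A (iprod P N) (x * x)"
    proof (rule iprod_least[OF is_submodule_addc[OF plus_cyc_modl[OF S(1) mPN]]])
      fix u v assume u: "u \<in> N" and v: "v \<in> N"
      obtain p s where ps: "u = p + x * s" "p \<in> P" "s \<in> A" using u unfolding Nx plus_cyc_def by blast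
      obtain p' s' where ps': "v = p' + x * s'" "p' \<in> P" "s' \<in> A" using v unfolding Nx plus_cyc_def by blast
      have "p * v + p' * (x * s) \<in> iprod P N"
        using is_submoduleD(2)[OF mPN iprod_mem[OF ps(2) v] iprod_mem[OF ps'(2) is_submoduleD(4)[OF mN ps(3) xy(1)]]] .
      moreover have "u * v = (p * v + p' * (x * s)) + x * x * (s * s')" using ps ps' by (simp add: algebra_simps)
      ultimately show "u * v \<in> plus_cyc A (iprod P N) (x * x)"
        using plus_cycI[of _ "iprod P N" "s * s'" A "x * x"] is_subringD(4)[OF S(1) ps(3) ps'(3)] by metis
    qed
    then obtain w s where ws: "q = w + x * x * s" "w \<in> iprod P N" "s \<in> A" using q PNN unfolding plus_cyc_def by blast
    have "iprod P N \<subseteq> P" using iprod_mono[of P P N A] iprod_sub[OF mP] NA by blast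
    then have "x * x * s \<in> P" using is_submodule_diff[OF S(1) mP q, of w] ws by auto
    then have "s \<in> P" using prime_inD(4)[OF P(1)] xA xP ws(3) is_subringD(4)[OF S(1)] by meson
    then have "s * (x * x) \<in> iprod P N" using iprod_mem x2 by blast
    then show "q \<in> iprod P N" using is_submoduleD(2)[OF mPN ws(2)] ws(1) by (simp add: mult.commute)
  qed
  then show ?thesis using Nx by blast
qed

text \<open>Since \<open>a\<close> generates \<open>P\<close> locally at \<open>P\<close>, it is not in the localization of \<open>P\<^sup>2\<close>.  At a
  minimal prime over \<open>P + (b)\<close>, however, \<open>P = P N\<close> and \<open>P \<subseteq> (a) + P\<^sup>2\<close> force it there.\<close>

lemma SP_subring_no_chain:
  assumes A: "is_subring A" "SP_subring A" and P: "prime_in A P" and M: "prime_in A M" and PM: "P \<subseteq> M" "P \<noteq> M"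
    and a: "a \<in> P" "a \<noteq> 0" "iprod P (localize A P) = cyclic_mod (localize A P) a"
  shows False
proof -
  note mP = prime_inD(1)[OF P] and PA = prime_inD(2)[OF P]
  let ?K = "localize A P"
  have SK: "is_subring ?K" "prime_in ?K (iprod P ?K)" using localize_lcl[OF A(1) P] unfolding local_with_def by auto
  \<comment> \<open>Locally at P the square of P is (a * a), and a in (a * a) would make a a
    unit.\<close>
  have aPP: "a \<notin> iprod (iprod P ?K) (iprod P ?K)"
  proof
    assume *: "a \<in> iprod (iprod P ?K) (iprod P ?K)"
    have "add_closed ((*) a ` cyclic_mod ?K a)"
      using cyclic_mod_modl[OF SK(1), of a] unfolding is_submodule_def add_closed_def by (auto simp: image_iff distrib_left[symmetric])
    then have "iprod (iprod P ?K) (iprod P ?K) \<subseteq> (*) a ` cyclic_mod ?K a"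
    proof (rule iprod_least)
      fix x y assume "x \<in> iprod P ?K" "y \<in> iprod P ?K"
      then obtain r s where "r \<in> ?K" "s \<in> ?K" "x = a * r" "y = a * s" unfolding a(3) cyclic_mod_def by blast
      then have "x * y = a * (a * (r * s))" "r * s \<in> ?K" using is_subringD(4)[OF SK(1)] by auto
      then show "x * y \<in> (*) a ` cyclic_mod ?K a" unfolding cyclic_mod_def by blast
    qed
    then obtain r where "r \<in> cyclic_mod ?K a" "a * 1 = a * r" using * by auto
    then have "1 \<in> cyclic_mod ?K a" using a(2) by simp
    then show False using prime_inD(3)[OF SK(2)] a(3) by simp
  qed
  have PK: "P \<subseteq> iprod P ?K" using iprod_mem[of _ P 1 ?K] is_subringD(2)[OF SK(1)] by fastforce
  define I where "I = plus_cyc A (iprod P P) a"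
  have mPP: "is_submodule A (iprod P P)" by (rule iprod_modl[OF mP])
  have PPP: "iprod P P \<subseteq> P" using iprod_mono[of P P P A] iprod_sub[OF mP] PA by blast
  have IP: "I \<subseteq> P" unfolding I_def by (rule plus_cyc_sub[OF mP PPP a(1)])
  have "is_submodule A I" unfolding I_def by (rule plus_cyc_modl[OF A(1) mPP])
  moreover have "1 \<notin> I" "I \<subseteq> A" using IP PA prime_inD(3)[OF P] by auto
  ultimately obtain Js where Js: "\<forall>J\<in>set Js. radical_in A J" "I = iprod_list A Js"
    using A(2) unfolding SP_subring_def by blast
  have Jm: "\<And>J. J \<in> set Js \<Longrightarrow> is_submodule A J \<and> J \<subseteq> A" using Js(1) radical_in_modl by blast
  \<comment> \<open>Every factor contains I, hence the square of P, hence P by radicality.\<close>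
  have PJ: "P \<subseteq> J" if J: "J \<in> set Js" for J
  proof
    fix x assume x: "x \<in> P"
    have "x ^ 2 \<in> iprod P P" using iprod_mem[OF x x] by (simp add: power2_eq_square)
    then have "x ^ 2 \<in> J" using plus_cyc_base[OF A(1), of "iprod P P" a] iprod_list_sub[OF A(1) Jm J] Js(2) unfolding I_def by blast
    then show "x \<in> J" using Js(1) J x PA unfolding radical_in_def by blast
  qed
  obtain J where J: "J \<in> set Js" "J \<subseteq> P" using iprod_list_prime[OF A(1) P Jm IP[unfolded Js(2)]] by blast
  then have "J = P" using PJ by blast
  obtain xs ys where sp: "Js = xs @ J # ys" using J(1) split_list by metis
  define Ls where "Ls = xs @ ys"
  define L where "L = iprod_list A Ls"
  have IL: "I = iprod P L" using Js(2) sp iprod_list_split \<open>J = P\<close> L_def Ls_def by metis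
  have LJ: "radical_in A J" "P \<subseteq> J" if "J \<in> set Ls" for J using that Js(1) PJ sp unfolding Ls_def by auto
  have Lm: "\<And>J. J \<in> set Ls \<Longrightarrow> is_submodule A J \<and> J \<subseteq> A" using LJ radical_in_modl by blast
  have L: "is_submodule A L" "L \<subseteq> A" using iprod_list_modl[OF A(1), of Ls] Lm L_def by auto
  \<comment> \<open>Otherwise I = P L, and a with it, would lie in the local square of P.\<close>
  have "\<not> L \<subseteq> P"
  proof
    assume "L \<subseteq> P"
    then have "iprod P L \<subseteq> iprod (iprod P ?K) (iprod P ?K)" using iprod_mono PK by (meson order_trans)
    moreover have "a \<in> iprod P L" unfolding IL[symmetric] I_def by (rule plus_cyc_gen[OF A(1) mPP])
    ultimately show False using aPP by blast
  qed
  then obtain l m where lm: "l \<in> L" "l \<notin> P" "m \<in> M" "m \<notin> P" using PM by blast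
  have lmA: "l \<in> A" "m \<in> A" using lm L prime_inD(2)[OF M] by auto
  \<comment> \<open>\<open>b\<close> lies in all factors of \<open>(a) + P\<^sup>2\<close> other than \<open>P\<close>.\<close>
  define b where "b = l * m"
  have b: "b \<in> L" "b \<in> M" "b \<notin> P" "b \<in> A"
    using is_submoduleD(4)[OF L(1) lmA(2) lm(1)] is_submoduleD(3)[OF prime_inD(1)[OF M] lmA(1) lm(3)] prime_inD(4)[OF P lmA] lm
      is_subringD(4)[OF A(1) lmA] unfolding b_def by auto
  obtain Q where Q: "prime_in A Q" "plus_cyc A P b \<subseteq> Q" "Q \<subseteq> M"
    "\<And>x. x \<in> Q \<Longrightarrow> \<exists>s\<in>A - Q. \<exists>n::nat. s * x ^ n \<in> plus_cyc A P b"
    using minimal_prime[OF A(1) plus_cyc_modl[OF A(1) mP] M plus_cyc_sub[OF prime_inD(1)[OF M] PM(1) b(2)]] by blast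
  have PQ: "P \<subseteq> Q" "b \<in> Q" using Q(2) plus_cyc_base[OF A(1)] plus_cyc_gen[OF A(1) mP] by blast+
  define B where "B = localize A Q"
  define N where "N = iprod Q B"
  define P' where "P' = iprod P B"
  have lB: "local_with B N" unfolding B_def N_def by (rule localize_lcl[OF A(1) Q(1)])
  then have S: "is_subring B" "prime_in B N" unfolding local_with_def by auto
  have P': "prime_in B P'" unfolding B_def P'_def by (rule localize_primel[OF A(1) Q(1) P PQ(1)])
  have AB: "A \<subseteq> B" unfolding B_def using localize_mem[OF Q(1) A(1)] by blast
  have inB: "x \<in> I \<Longrightarrow> x \<in> iprod I B" for x I using iprod_mem[of x I 1 B] is_subringD(2)[OF S(1)] by auto
  have bB: "b \<in> N" "b \<notin> P'"
  proof -
    show "b \<in> N" unfolding N_def using inB PQ by blast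
    have "1 \<in> A - Q" using prime_inD(3)[OF Q(1)] is_subringD(2)[OF A(1)] by blast
    then show "b \<notin> P'" using iprod_lo_prime[OF A(1) Q(1) P PQ(1) b(4), of 1] b(3) unfolding P'_def B_def by auto
  qed
  have BB: "iprod B B = B" using iprod_unit[OF S(1) is_subring_modl[OF S(1)]] .
  \<comment> \<open>Locally at the minimal prime Q every element of N has a power in the extension
    of P + (b), so a radical ideal above this extension contains N.\<close>
  have min: "J = B \<or> J = N" if J: "radical_in B J" "P' \<subseteq> J" "b \<in> J" for J
  proof -
    have mJ: "is_submodule B J" "J \<subseteq> B" using radical_in_modl[OF J(1)] by auto
    have "N \<subseteq> J"
    proof
      fix x assume "x \<in> N"
      then obtain y t where y: "y \<in> Q" "t \<in> A - Q" "x = y / t"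
        using iprod_lo[OF A(1) Q(1) prime_inD(1)[OF Q(1)]] unfolding N_def B_def by blast
      obtain s and n :: nat where s: "s \<in> A - Q" "s * y ^ n \<in> plus_cyc A P b" using Q(4)[OF y(1)] by blast
      have iB: "inverse s \<in> B" "inverse t \<in> B" using localize_inverse[OF Q(1) A(1)] s y unfolding B_def by auto
      have s0: "s \<noteq> 0" using s prime_inD(5)[OF Q(1)] by auto
      have "P \<subseteq> J" using J(2) inB unfolding P'_def by blast
      have "plus_cyc A P b \<subseteq> J"
      proof (clarsimp simp: plus_cyc_def)
        fix p r assume "p \<in> P" "r \<in> A"
        then have "p \<in> J" "b * r \<in> J" using \<open>P \<subseteq> J\<close> is_submoduleD(4)[OF mJ(1) _ J(3)] AB by blast+
        then show "p + b * r \<in> J" by (rule is_submoduleD(2)[OF mJ(1)])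
      qed
      then have "s * y ^ n * inverse s \<in> J" using is_submoduleD(4)[OF mJ(1) iB(1)] s by blast
      moreover have "s * y ^ n * inverse s = y ^ n" using s0 by simp
      ultimately have "y ^ n \<in> J" by metis
      moreover have "y \<in> B" using y prime_inD(2)[OF Q(1)] AB by blast
      ultimately have "y \<in> J" using J(1) unfolding radical_in_def by blast
      then show "x \<in> J" using is_submoduleD(4)[OF mJ(1) iB(2)] y(3) by (simp add: divide_inverse)
    qed
    then show ?thesis using radical_in_unit_or_local[OF lB J(1)] by blast
  qed
  have "P' \<subseteq> N" unfolding P'_def N_def using iprod_mono PQ(1) by blast
  then obtain x where x: "N = plus_cyc B P' x" "P' \<subseteq> iprod P' N"
    using local_prime_idempotent[OF lB _ P' _ bB min] localize_SPr[OF A(1) Q(1) A(2)] B_def by blast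
  have mP': "is_submodule B P'" using prime_inD(1)[OF P'] .
  have xN: "x \<in> N" using x(1) plus_cyc_gen[OF S(1) mP'] by blast
  \<comment> \<open>Each extended factor of L contains N, because the factor is radical and contains
    P and b. The inclusion of \<open>P'\<close> in the product of \<open>P'\<close> and N therefore
    lets all factors be inserted one after the other, until \<open>P'\<close> lies in the extension
    of I.\<close>
  have step: "P' \<subseteq> iprod P' (iprod (iprod_list A Ks) B)" if "set Ks \<subseteq> set Ls" for Ks
    using that
  proof (induction Ks)
    case Nil
    have "iprod A B = B" using iprod_lo[OF A(1) Q(1) is_subring_modl[OF A(1)]] unfolding B_def localize_def by simp
    then show ?case using iprod_unit[OF S(1) mP'] by (simp add: iprod_list_def)
  next
    case (Cons J Ks)
    then have J: "J \<in> set Ls" by auto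
    have "L \<subseteq> J" using iprod_list_sub[OF A(1) Lm J] L_def by simp
    then have bJ: "b \<in> J" using b by blast
    have mJ: "is_submodule A J" "J \<subseteq> A" using Lm[OF J] by auto
    have NJ: "N \<subseteq> iprod J B"
    proof
      fix z assume "z \<in> N"
      then obtain y t where y: "y \<in> Q" "t \<in> A - Q" "z = y / t"
        using iprod_lo[OF A(1) Q(1) prime_inD(1)[OF Q(1)]] unfolding N_def B_def by blast
      obtain s and n :: nat where s: "s \<in> A - Q" "s * y ^ n \<in> plus_cyc A P b" using Q(4)[OF y(1)] by blast
      have s0: "s \<noteq> 0" using s prime_inD(5)[OF Q(1)] by auto
      have yA: "y \<in> A" using y prime_inD(2)[OF Q(1)] by blast
      have "s * y ^ n \<in> J" using plus_cyc_sub[OF mJ(1) LJ(2)[OF J] bJ] s by blast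
      then have syJ: "s ^ n * (s * y ^ n) \<in> J" using is_submoduleD(3)[OF mJ(1)] is_subring_power[OF A(1)] s by blast
      have "s ^ n * (s * y ^ n) = s * (s * y) ^ n" unfolding power_mult_distrib by (simp only: mult_ac)
      then have "s * (s * y) ^ n \<in> J" using syJ by metis
      then have "(s * y) ^ n * (s * y) \<in> J" using is_submoduleD(3)[OF mJ(1) yA] by (metis mult.commute mult.left_commute)
      then have "(s * y) ^ Suc n \<in> J" by (simp add: mult.commute)
      then have "s * y \<in> J" using LJ(1)[OF J] is_subringD(4)[OF A(1) _ yA] s unfolding radical_in_def by blast
      moreover have "z = (s * y) / (s * t)" using y s0 by simp
      moreover have "s * t \<in> A - Q" using prime_compl_mult[OF A(1) Q(1)] s y by blast
      ultimately show "z \<in> iprod J B" unfolding B_def iprod_lo[OF A(1) Q(1) mJ(1)] by blast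
    qed
    have "P' \<subseteq> iprod P' (iprod (iprod_list A Ks) B)" using Cons by auto
    also have "\<dots> \<subseteq> iprod (iprod P' N) (iprod (iprod_list A Ks) B)" using iprod_mono x(2) by blast
    also have "\<dots> = iprod P' (iprod N (iprod (iprod_list A Ks) B))" by (rule iprod_assoc)
    also have "\<dots> \<subseteq> iprod P' (iprod (iprod J B) (iprod (iprod_list A Ks) B))" using iprod_mono NJ by (metis order_refl)
    also have "\<dots> = iprod P' (iprod (iprod_list A (J # Ks)) B)" unfolding iprod_list_Cons using iprod_distrib[OF BB] by metis
    finally show ?case .
  qed
  have IB: "iprod I B \<subseteq> plus_cyc B (iprod P' P') a"
  proof (rule iprod_least)
    show "add_closed (plus_cyc B (iprod P' P') a)" using is_submodule_addc[OF plus_cyc_modl[OF S(1) iprod_modl[OF mP']]] .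
    fix u v assume u: "u \<in> I" and v: "v \<in> B"
    obtain p r where iprod: "u = p + a * r" "p \<in> iprod P P" "r \<in> A" using u unfolding I_def plus_cyc_def by blast
    have "P \<subseteq> P'" unfolding P'_def using inB by blast
    then have "p \<in> iprod P' P'" using iprod(2) iprod_mono by blast
    then have "p * v \<in> iprod P' P'" using is_submoduleD(4)[OF iprod_modl[OF mP'] v] by blast
    moreover have "r * v \<in> B" using iprod(3) v AB is_subringD(4)[OF S(1)] by blast
    moreover have "u * v = p * v + a * (r * v)" using iprod by (simp add: algebra_simps)
    ultimately show "u * v \<in> plus_cyc B (iprod P' P') a" using plus_cycI by metis
  qed
  have "P' \<subseteq> iprod P' (iprod L B)" using step[of Ls] unfolding L_def by simp
  also have "\<dots> = iprod I B" unfolding P'_def IL using iprod_distrib[OF BB] by metis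
  finally have P'a: "P' \<subseteq> plus_cyc B (iprod P' P') a" using IB by blast
  have mPP': "is_submodule B (iprod P' P')" by (rule iprod_modl[OF mP'])
  \<comment> \<open>Insert that \<open>P'\<close> lies in its square plus (a), and that N is
    \<open>P'\<close> plus (x). Then a has the form q + a * x * r with q in the square of
    \<open>P'\<close>, and \<open>local_with_absorb\<close> puts a itself there, contradicting the
    choice of a locally at P.\<close>
  have "iprod P' N \<subseteq> plus_cyc B (iprod P' P') (a * x)"
  proof (rule iprod_least[OF is_submodule_addc[OF plus_cyc_modl[OF S(1) mPP']]])
    fix u v assume u: "u \<in> P'" and v: "v \<in> N"
    obtain p s where ps: "v = p + x * s" "p \<in> P'" "s \<in> B" using v unfolding x(1) plus_cyc_def by blast
    obtain q t where qt: "u = q + a * t" "q \<in> iprod P' P'" "t \<in> B" using u P'a unfolding plus_cyc_def by blast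
    have xB: "x \<in> B" using xN prime_inD(2)[OF S(2)] by blast
    have "u * p + q * (x * s) \<in> iprod P' P'"
      using is_submoduleD(2)[OF mPP' iprod_mem[OF u ps(2)] is_submoduleD(4)[OF mPP' is_subringD(4)[OF S(1) xB ps(3)] qt(2)]] .
    moreover have "u * v = (u * p + q * (x * s)) + a * x * (t * s)" using ps(1) qt(1) by (simp add: algebra_simps)
    ultimately show "u * v \<in> plus_cyc B (iprod P' P') (a * x)"
      using plus_cycI[of _ "iprod P' P'" "t * s" B "a * x"] is_subringD(4)[OF S(1) qt(3) ps(3)] by metis
  qed
  moreover have "a \<in> P'" unfolding P'_def using inB a(1) by blast
  ultimately obtain q r where qr: "a = q + a * x * r" "q \<in> iprod P' P'" "r \<in> B" using x(2) unfolding plus_cyc_def by blast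
  then have "a - a * (x * r) \<in> iprod P' P'" by (metis add_diff_cancel_right' mult.assoc)
  then have aPP': "a \<in> iprod P' P'" using local_with_absorb[OF lB mPP'] is_submoduleD(4)[OF prime_inD(1)[OF S(2)] qr(3) xN] by blast
  have "B \<subseteq> ?K" unfolding B_def localize_def using PQ(1) by blast
  then have "P' \<subseteq> iprod P ?K" unfolding P'_def using iprod_mono by blast
  then have "iprod P' P' \<subseteq> iprod (iprod P ?K) (iprod P ?K)" using iprod_mono by blast
  then show False using aPP aPP' by blast
qed

text \<open>A prime P inside M that is minimal over a nonzero principal ideal becomes principal
  after localization at P; \<open>SP_subring_no_chain\<close> then gives P = M.\<close>

theorem SP_subring_localization_DVR:
  assumes A: "is_subring A" "SP_subring A" and M: "prime_in A M" "M \<noteq> {0}"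
  shows "\<exists>t\<in>M. t \<noteq> 0 \<and> iprod M (localize A M) = cyclic_mod (localize A M) t"
proof -
  note mM = prime_inD(1)[OF M(1)]
  obtain a where a: "a \<in> M" "a \<noteq> 0" using M(2) is_submoduleD(1)[OF mM] by blast
  obtain P where P: "prime_in A P" "cyclic_mod A a \<subseteq> P" "P \<subseteq> M" "\<forall>x\<in>P. \<exists>s\<in>A - P. \<exists>n::nat. s * x ^ n \<in> cyclic_mod A a"
    using minimal_prime[OF A(1) cyclic_mod_modl[OF A(1)] M(1) cyclic_mod_sub[OF mM a(1)]] by blast
  let ?K = "localize A P"
  have lK: "local_with ?K (iprod P ?K)" by (rule localize_lcl[OF A(1) P(1)])
  then have S: "is_subring ?K" unfolding local_with_def by blast
  have inK: "x \<in> iprod P ?K" if "x \<in> P" for x using iprod_mem[OF that, of 1 ?K] is_subringD(2)[OF S] by simp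
  have aP: "a \<in> P" using P(2) cyclic_mod_self[OF A(1)] by blast
  have pow: "\<exists>n::nat. x ^ n \<in> cyclic_mod ?K a" if x: "x \<in> iprod P ?K" for x
  proof -
    obtain y t where y: "y \<in> P" "t \<in> A - P" "x = y / t" using x iprod_lo[OF A(1) P(1) prime_inD(1)[OF P(1)]] by blast
    obtain s and n :: nat where s: "s \<in> A - P" "s * y ^ n \<in> cyclic_mod A a" using P(4) y(1) by blast
    then obtain r where r: "r \<in> A" "s * y ^ n = a * r" unfolding cyclic_mod_def by blast
    have nz: "s \<noteq> 0" "t \<noteq> 0" using s y prime_inD(5)[OF P(1)] by auto
    have K: "inverse s \<in> ?K" "inverse t ^ n \<in> ?K" "r \<in> ?K"
      using localize_inverse[OF P(1) A(1)] s y is_subring_power[OF S] localize_mem[OF P(1) A(1) r(1)] by auto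
    have "x ^ n = a * (r * inverse s * inverse t ^ n)"
    proof -
      have "y = t * x" using y nz by simp
      then have e: "a * r = s * (t ^ n * x ^ n)" using r(2) by (simp add: power_mult_distrib)
      have "a * (r * inverse s * inverse t ^ n) = (a * r) * (inverse s * inverse t ^ n)" by (simp only: mult.assoc)
      also have "\<dots> = x ^ n * (s * inverse s) * (t * inverse t) ^ n"
        unfolding e power_mult_distrib by (simp only: mult_ac)
      also have "\<dots> = x ^ n" using nz by simp
      finally show ?thesis by simp
    qed
    then have "x ^ n \<in> cyclic_mod ?K a" using cyclic_modI(1)[OF is_subringD(4)[OF S is_subringD(4)[OF S K(3,1)] K(2)], of a] by simp
    then show ?thesis by blast
  qed
  obtain t0 where t0: "t0 \<in> iprod P ?K" "iprod P ?K = cyclic_mod ?K t0"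
    using local_minimal_principal[OF lK localize_SPr[OF A(1) P(1) A(2)] inK[OF aP] a(2) pow] by blast
  \<comment> \<open>The generator is replaced by its numerator, since
    \<open>SP_subring_no_chain\<close> asks for a generator in P itself.\<close>
  obtain t s where ts: "t \<in> P" "s \<in> A - P" "t0 = t / s" using t0(1) iprod_lo[OF A(1) P(1) prime_inD(1)[OF P(1)]] by blast
  have s0: "s \<noteq> 0" using ts prime_inD(5)[OF P(1)] by auto
  have "t0 \<noteq> 0" using t0(2) inK[OF aP] a(2) unfolding cyclic_mod_def by auto
  then have t: "t \<noteq> 0" using ts by auto
  have "iprod P ?K = cyclic_mod ?K t"
  proof
    show "cyclic_mod ?K t \<subseteq> iprod P ?K"
      using cyclic_mod_sub[OF prime_inD(1) inK[OF ts(1)]] lK unfolding local_with_def by blast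
    have "t0 = t * inverse s" using ts by (simp add: divide_inverse)
    then have "t0 \<in> cyclic_mod ?K t" using cyclic_modI(1)[OF localize_inverse[OF P(1) A(1) ts(2)]] by simp
    then show "iprod P ?K \<subseteq> cyclic_mod ?K t" unfolding t0(2) by (rule cyclic_mod_sub[OF cyclic_mod_modl[OF S]])
  qed
  moreover have "P = M" using SP_subring_no_chain[OF A P(1) M(1) P(3) _ ts(1) t calculation] by blast
  ultimately show ?thesis using ts t by blast
qed

section \<open>Valuations of an SP-domain\<close>

lemma emb_simps [simp]: "emb 0 = 0" "emb 1 = 1" "emb (a + b) = emb a + emb b" "emb (a * b) = emb a * emb b"
  "emb (- a) = - emb a" "emb a = emb b \<longleftrightarrow> a = b" "emb a = 0 \<longleftrightarrow> a = 0"
  by (simp_all add: emb_def Zero_fract_def One_fract_def eq_fract)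

lemma emb_power [simp]: "emb (a ^ n) = emb a ^ n"
  by (induction n) auto

lemma Fract_emb: "Fract a s = emb a / emb s"
  by (simp add: emb_def)

lemma fract_emb_cases:
  obtains a b where "x = emb a / emb b" "b \<noteq> 0"
  by (cases x) (auto simp: Fract_emb)

lemma emb_mem_iff: "emb a \<in> emb ` M \<longleftrightarrow> a \<in> M"
  by auto

lemma emb_inj: "inj emb"
  by (auto simp: inj_def)

lemma is_idealD: "is_ideal I \<Longrightarrow> 0 \<in> I" "is_ideal I \<Longrightarrow> x \<in> I \<Longrightarrow> y \<in> I \<Longrightarrow> x + y \<in> I"
  "is_ideal I \<Longrightarrow> x \<in> I \<Longrightarrow> r * x \<in> I"
  unfolding is_ideal_def by blast+

lemma ideal_unit: "is_ideal I \<Longrightarrow> 1 \<in> I \<longleftrightarrow> I = UNIV"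
  using is_idealD(3)[of I 1] by auto

lemma Rfr_is_subring: "is_subring Rfr"
proof -
  have "emb a + emb b \<in> range emb" "emb a * emb b \<in> range emb" "- emb a \<in> range emb" "(0 :: 'a fract) \<in> range emb" "(1 :: 'a fract) \<in> range emb"
    for a b :: 'a
    using rangeI[of emb "a + b"] rangeI[of emb "a * b"] rangeI[of emb "- a"] rangeI[of emb "0::'a"] rangeI[of emb "1::'a"]
    by simp_all
  then show ?thesis unfolding is_subring_def add_closed_def Rfr_def by blast
qed

lemma is_submodule_emb: "is_ideal I \<Longrightarrow> is_submodule Rfr (emb ` I)"
proof -
  assume I: "is_ideal I"
  have "emb a + emb b \<in> emb ` I" if "a \<in> I" "b \<in> I" for a b
    using imageI[OF is_idealD(2)[OF I that], of emb] by simp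
  moreover have "emb r * emb a \<in> emb ` I" if "a \<in> I" for r a
    using imageI[OF is_idealD(3)[OF I that], of emb r] by simp
  moreover have "0 \<in> emb ` I" using imageI[OF is_idealD(1)[OF I], of emb] by simp
  ultimately show ?thesis unfolding is_submodule_def add_closed_def Rfr_def by blast
qed

lemma emb_sub_Rfr: "emb ` I \<subseteq> Rfr"
  unfolding Rfr_def by blast

lemma is_ideal_preimage: assumes "is_submodule Rfr I" shows "is_ideal {a. emb a \<in> I}"
proof -
  have "emb r \<in> Rfr" for r :: 'a unfolding Rfr_def by blast
  then show ?thesis using is_submoduleD[OF assms] unfolding is_ideal_def by auto
qed

lemma emb_preimage: "I \<subseteq> Rfr \<Longrightarrow> emb ` {a. emb a \<in> I} = I"
  unfolding Rfr_def by auto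

lemma ideal_gen_is_ideal: "is_ideal (ideal_gen S)"
  unfolding ideal_gen_def is_ideal_def by auto

lemma emb_ideal_mult:
  assumes "is_ideal I" shows "emb ` ideal_mult I J = iprod (emb ` I) (emb ` J)"
proof
  let ?S = "{a * b |a b. a \<in> I \<and> b \<in> J}"
  let ?N = "{a. emb a \<in> iprod (emb ` I) (emb ` J)}"
  have "is_ideal ?N" by (rule is_ideal_preimage[OF iprod_modl[OF is_submodule_emb[OF assms]]])
  moreover have "?S \<subseteq> ?N" by (auto intro!: iprod_mem)
  ultimately have "ideal_mult I J \<subseteq> ?N" unfolding ideal_mult_def ideal_gen_def by blast
  then show "emb ` ideal_mult I J \<subseteq> iprod (emb ` I) (emb ` J)" by blast
  have "?S \<subseteq> ideal_mult I J" unfolding ideal_mult_def ideal_gen_def by blast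
  moreover have "is_submodule Rfr (emb ` ideal_mult I J)"
    unfolding ideal_mult_def by (rule is_submodule_emb[OF ideal_gen_is_ideal])
  ultimately show "iprod (emb ` I) (emb ` J) \<subseteq> emb ` ideal_mult I J"
  proof (intro iprod_least)
    fix x y assume "x \<in> emb ` I" "y \<in> emb ` J"
    then obtain a b where ab: "a \<in> I" "b \<in> J" "x = emb a" "y = emb b" by blast
    then have "a * b \<in> ideal_mult I J" using \<open>?S \<subseteq> ideal_mult I J\<close> by blast
    then show "x * y \<in> emb ` ideal_mult I J" using imageI[of "a * b" _ emb] ab by simp
  qed (rule is_submodule_addc)
qed

lemma emb_ideal_prod_list:
  "(\<And>J. J \<in> set Is \<Longrightarrow> is_ideal J) \<Longrightarrow> emb ` ideal_prod_list Is = iprod_list Rfr (map ((`) emb) Is)"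
  by (induction Is) (auto simp: ideal_prod_list_def iprod_list_def Rfr_def emb_ideal_mult)

lemma radical_in_emb: "radical_ideal J \<Longrightarrow> radical_in Rfr (emb ` J)"
proof -
  assume J: "radical_ideal J"
  have "emb x \<in> emb ` J" if "emb x ^ n \<in> emb ` J" for x and n :: nat
  proof -
    have "emb (x ^ n) \<in> emb ` J" using that by simp
    then have "x ^ n \<in> J" by (simp only: emb_mem_iff)
    then show ?thesis using J unfolding radical_ideal_def by blast
  qed
  then show ?thesis using J is_submodule_emb emb_sub_Rfr unfolding radical_ideal_def radical_in_def
    by (auto simp: Rfr_def)
qed

lemma SP_domain_SP_subring:
  assumes "SP_domain TYPE('a::idom)" shows "SP_subring (Rfr :: 'a fract set)"
  unfolding SP_subring_def
proof (intro allI impI, elim conjE)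
  fix I :: "'a fract set" assume I: "is_submodule Rfr I" "I \<subseteq> Rfr" "1 \<notin> I"
  let ?J = "{a. emb a \<in> I}"
  have "is_ideal ?J" "?J \<noteq> UNIV"
    using is_ideal_preimage[OF I(1)] I(3) ideal_unit[of ?J] by auto
  then obtain Is where Is: "\<forall>J\<in>set Is. radical_ideal J" "?J = ideal_prod_list Is"
    using assms unfolding SP_domain_def by blast
  have "I = emb ` ideal_prod_list Is" using emb_preimage[OF I(2)] Is(2) by simp
  also have "\<dots> = iprod_list Rfr (map ((`) emb) Is)"
    using emb_ideal_prod_list Is(1) unfolding radical_ideal_def by blast
  finally show "\<exists>Js. (\<forall>J\<in>set Js. radical_in Rfr J) \<and> I = iprod_list Rfr Js"
    using Is(1) radical_in_emb by (intro exI[of _ "map ((`) emb) Is"]) auto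
qed

section \<open>Maximal ideals and their localizations\<close>

lemma exists_maximal:
  assumes "is_ideal I" "I \<noteq> (UNIV :: 'a::idom set)" shows "\<exists>M\<in>Max_spec. I \<subseteq> M"
proof -
  define \<S> where "\<S> = {J. is_ideal J \<and> J \<noteq> UNIV \<and> I \<subseteq> J}"
  have "I \<in> \<S>" using assms unfolding \<S>_def by auto
  moreover have "\<Union>\<C> \<in> \<S>" if \<C>: "\<C> \<noteq> {}" "subset.chain \<S> \<C>" for \<C>
  proof -
    have C: "\<And>S. S \<in> \<C> \<Longrightarrow> is_ideal S \<and> 1 \<notin> S \<and> I \<subseteq> S"
      "\<And>S T. S \<in> \<C> \<Longrightarrow> T \<in> \<C> \<Longrightarrow> S \<subseteq> T \<or> T \<subseteq> S"
      using \<C>(2) ideal_unit unfolding subset.chain_def \<S>_def by blast+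
    have "x + y \<in> \<Union>\<C>" if "x \<in> \<Union>\<C>" "y \<in> \<Union>\<C>" for x y
    proof -
      obtain S T where ST: "S \<in> \<C>" "T \<in> \<C>" "x \<in> S" "y \<in> T" using \<open>x \<in> \<Union>\<C>\<close> \<open>y \<in> \<Union>\<C>\<close> by blast
      then obtain W where "W \<in> \<C>" "x \<in> W" "y \<in> W" using C(2)[OF ST(1,2)] by blast
      then show ?thesis using C(1) is_idealD(2) by blast
    qed
    moreover have "r * x \<in> \<Union>\<C>" if "x \<in> \<Union>\<C>" for r x using that C(1) is_idealD(3) by blast
    moreover have "0 \<in> \<Union>\<C>" using \<C>(1) C(1) is_idealD(1) by blast
    ultimately have "is_ideal (\<Union>\<C>)" unfolding is_ideal_def by blast
    moreover have "\<Union>\<C> \<noteq> UNIV" using C(1) by (metis UNIV_I UnionE)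
    moreover have "I \<subseteq> \<Union>\<C>" using \<C>(1) C(1) by blast
    ultimately show ?thesis unfolding \<S>_def by simp
  qed
  ultimately obtain M where M: "M \<in> \<S>" "\<And>X. X \<in> \<S> \<Longrightarrow> M \<subseteq> X \<Longrightarrow> X = M"
    using subset_Zorn_nonempty[of \<S>] by blast
  then have "maximal_ideal M" unfolding maximal_ideal_def \<S>_def by blast
  then show ?thesis using M(1) unfolding Max_spec_def \<S>_def by blast
qed

lemma ideal_adjoin: assumes "is_ideal P" shows "is_ideal {p + r * x |p r. p \<in> P}"
  unfolding is_ideal_def
proof (intro conjI ballI allI impI)
  show "0 \<in> {p + r * x |p r. p \<in> P}" using is_idealD(1)[OF assms] by (auto intro!: exI[of _ 0])
  fix u assume "u \<in> {p + r * x |p r. p \<in> P}"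
  then obtain p r where u: "u = p + r * x" "p \<in> P" by blast
  show "s * u \<in> {p + r * x |p r. p \<in> P}" for s
  proof -
    have "s * u = s * p + (s * r) * x" using u by (simp add: algebra_simps)
    then show ?thesis using is_idealD(3)[OF assms u(2)] by blast
  qed
  fix v assume "v \<in> {p + r * x |p r. p \<in> P}"
  then obtain q s where v: "v = q + s * x" "q \<in> P" by blast
  have "u + v = (p + q) + (r + s) * x" using u v by (simp add: algebra_simps)
  then show "u + v \<in> {p + r * x |p r. p \<in> P}" using is_idealD(2)[OF assms u(2) v(2)] by blast
qed

lemma maximal_adjoin:
  assumes "M \<in> Max_spec" "x \<notin> M" obtains m r where "m \<in> M" "1 = m + r * x"
proof -
  have M: "is_ideal M" using assms unfolding Max_spec_def maximal_ideal_def by auto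
  let ?J = "{p + r * x |p r. p \<in> M}"
  have "M \<subseteq> ?J"
  proof
    fix m assume "m \<in> M"
    moreover have "m = m + 0 * x" by simp
    ultimately show "m \<in> ?J" by blast
  qed
  moreover have "x \<in> ?J"
  proof -
    have "x = 0 + 1 * x" by simp
    then show ?thesis using is_idealD(1)[OF M] by blast
  qed
  ultimately have "?J = UNIV" using ideal_adjoin[OF M, of x] assms unfolding Max_spec_def maximal_ideal_def by blast
  then have "1 \<in> ?J" by simp
  then show thesis using that by blast
qed

lemma Max_spec_ideal: "M \<in> Max_spec \<Longrightarrow> is_ideal M" "M \<in> Max_spec \<Longrightarrow> 1 \<notin> M"
  using ideal_unit unfolding Max_spec_def maximal_ideal_def by auto

lemma Max_spec_prime: assumes "M \<in> Max_spec" "x * y \<in> M" shows "x \<in> M \<or> y \<in> M"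
proof (rule ccontr)
  assume *: "\<not> (x \<in> M \<or> y \<in> M)"
  then obtain m r where mr: "m \<in> M" "1 = m + r * x" using maximal_adjoin[OF assms(1)] by blast
  have "y = y * (m + r * x)" using mr by simp
  then have "y = y * m + r * (x * y)" by (simp add: algebra_simps)
  moreover have "y * m + r * (x * y) \<in> M"
    using is_idealD[OF Max_spec_ideal(1)[OF assms(1)]] mr assms(2) by blast
  ultimately show False using * by simp
qed

lemma Max_spec_incomparable: "M \<in> Max_spec \<Longrightarrow> N \<in> Max_spec \<Longrightarrow> M \<subseteq> N \<Longrightarrow> M = N"
  unfolding Max_spec_def maximal_ideal_def by blast

lemma prime_in_emb:
  assumes "is_ideal M" "1 \<notin> M" "\<And>x y. x * y \<in> M \<Longrightarrow> x \<in> M \<or> y \<in> M"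
  shows "prime_in Rfr (emb ` M)"
proof -
  have "1 \<notin> emb ` M" using assms(2) emb_mem_iff[of 1 M] by simp
  moreover have "emb x * emb y \<in> emb ` M \<Longrightarrow> emb x \<in> emb ` M \<or> emb y \<in> emb ` M" for x y
    using assms(3)[of x y] emb_mem_iff[of "x * y" M] by auto
  ultimately show ?thesis unfolding prime_in_def using is_submodule_emb[OF assms(1)] unfolding Rfr_def by blast
qed

lemma prime_in_Max: "M \<in> Max_spec \<Longrightarrow> prime_in Rfr (emb ` M)"
  using prime_in_emb[of M] Max_spec_ideal Max_spec_prime by blast

lemma loc_quot: "{Fract a s |a s. a \<in> I \<and> s \<notin> M} = {x / s |x s. x \<in> emb ` I \<and> s \<in> Rfr - emb ` M}"
proof (intro equalityI subsetI)
  fix z assume "z \<in> {Fract a s |a s. a \<in> I \<and> s \<notin> M}"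
  then obtain a s where "a \<in> I" "s \<notin> M" "z = emb a / emb s" by (auto simp: Fract_emb)
  then have "emb a \<in> emb ` I" "emb s \<in> Rfr - emb ` M" "z = emb a / emb s" by (auto simp: Rfr_def)
  then show "z \<in> {x / s |x s. x \<in> emb ` I \<and> s \<in> Rfr - emb ` M}" by blast
next
  fix z assume "z \<in> {x / s |x s. x \<in> emb ` I \<and> s \<in> Rfr - emb ` M}"
  then obtain a s where "a \<in> I" "s \<notin> M" "z = Fract a s" by (auto simp: Fract_emb Rfr_def)
  then show "z \<in> {Fract a s |a s. a \<in> I \<and> s \<notin> M}" by blast
qed

lemma loc_eq_localize: "loc M = localize Rfr (emb ` M)"
  using loc_quot[of UNIV M] unfolding loc_def localize_def by (simp add: Rfr_def)

lemma loc_max_eq_iprod: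
  assumes "M \<in> Max_spec" shows "loc_max M = iprod (emb ` M) (loc M)"
  unfolding loc_eq_localize iprod_lo[OF Rfr_is_subring prime_in_Max[OF assms] is_submodule_emb[OF Max_spec_ideal(1)[OF assms]]]
  unfolding loc_max_def by (rule loc_quot)

lemma loc_is_subring: "M \<in> Max_spec \<Longrightarrow> is_subring (loc M)"
  unfolding loc_eq_localize by (rule localize_sring[OF Rfr_is_subring prime_in_Max])

lemma loc_emb: "M \<in> Max_spec \<Longrightarrow> emb a \<in> loc M"
  unfolding loc_eq_localize by (rule localize_mem[OF prime_in_Max Rfr_is_subring]) (simp_all add: Rfr_def)

text \<open>R is not a field: if M were zero, adjoining the given nonzero nonunit x to M would make
  x a unit.\<close>

lemma Max_spec_nonzero:
  assumes "SP_domain TYPE('a::idom)" "M \<in> (Max_spec :: 'a set set)" shows "\<exists>f\<in>M. f \<noteq> 0"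
proof (rule ccontr)
  assume "\<not> ?thesis"
  then have M0: "M = {0}" using is_idealD(1)[OF Max_spec_ideal(1)[OF assms(2)]] by auto
  obtain x :: 'a where x: "x \<noteq> 0" "\<not> x dvd 1" using assms(1) unfolding SP_domain_def by blast
  obtain m r where "m \<in> M" "1 = m + r * x" using maximal_adjoin[OF assms(2), of x] x M0 by auto
  then show False using x M0 by (auto simp: dvd_def mult.commute)
qed

section \<open>The discrete valuations at the maximal ideals\<close>

context
  assumes sp: "SP_domain TYPE('a::idom)"
begin

lemma loc_DVR:
  fixes M :: "'a set" assumes M: "M \<in> Max_spec"
  shows "\<exists>t. t \<noteq> 0 \<and> t \<in> loc_max M \<and> loc_max M = {t * y |y. y \<in> loc M} \<and> t \<in> emb ` M \<and>
    (\<forall>q\<in>loc M. q \<noteq> 0 \<longrightarrow> (\<exists>(n::nat) u. q = t ^ n * u \<and> u \<in> loc_units M))"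
proof -
  obtain f where "f \<in> M" "f \<noteq> 0" using Max_spec_nonzero[OF sp M] by blast
  then have "emb f \<in> emb ` M" "emb f \<noteq> 0" by simp_all
  then have "emb ` M \<noteq> {0}" by blast
  then obtain t where t: "t \<in> emb ` M" "t \<noteq> 0" "iprod (emb ` M) (loc M) = cyclic_mod (loc M) t"
    using SP_subring_localization_DVR[OF Rfr_is_subring SP_domain_SP_subring[OF sp] prime_in_Max[OF M]] unfolding loc_eq_localize by blast
  have 1: "loc_max M = {t * y |y. y \<in> loc M}"
    unfolding loc_max_eq_iprod[OF M] t(3) cyclic_mod_def by auto
  have lc: "local_with (loc M) (loc_max M)" "SP_subring (loc M)"
    using localize_lcl[OF Rfr_is_subring prime_in_Max[OF M]] localize_SPr[OF Rfr_is_subring prime_in_Max[OF M] SP_domain_SP_subring[OF sp]]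
    unfolding loc_max_eq_iprod[OF M] unfolding loc_eq_localize by auto
  have cyclic_mod: "loc_max M = cyclic_mod (loc M) t" using t(3) loc_max_eq_iprod[OF M] by simp
  show ?thesis
  proof (intro exI[of _ t] conjI t(2) 1 t(1) ballI impI)
    show "t \<in> loc_max M" unfolding cyclic_mod by (rule cyclic_mod_self[OF loc_is_subring[OF M]])
    fix q assume q: "q \<in> loc M" "q \<noteq> 0"
    obtain n :: nat and u where "q = t ^ n * u" "u \<in> loc M" "inverse u \<in> loc M"
      using local_principal_DVR[OF lc cyclic_mod t(2) q] by blast
    then show "\<exists>(n::nat) u. q = t ^ n * u \<and> u \<in> loc_units M" using q(2) unfolding loc_units_def by auto
  qed
qed

text \<open>In the localization at a maximal M above P the element f is a power of the generator t
  times a unit. So t lies in the extension of P, which is then the whole maximal ideal.\<close>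

lemma nonzero_prime_maximal:
  fixes P :: "'a set"
  assumes "is_ideal P" "1 \<notin> P" "\<And>x y. x * y \<in> P \<Longrightarrow> x \<in> P \<or> y \<in> P" "f \<in> P" "f \<noteq> 0"
  shows "P \<in> Max_spec"
proof -
  obtain M where M: "M \<in> Max_spec" "P \<subseteq> M" using exists_maximal[OF assms(1)] assms(2) by blast
  obtain t where t: "t \<in> emb ` M" "t \<in> loc_max M" "loc_max M = {t * y |y. y \<in> loc M}"
    "\<forall>q\<in>loc M. q \<noteq> 0 \<longrightarrow> (\<exists>(n::nat) u. q = t ^ n * u \<and> u \<in> loc_units M)"
    using loc_DVR[OF M(1)] by blast
  obtain n :: nat and u where u: "emb f = t ^ n * u" "u \<in> loc_units M"
    using bspec[OF t(4) loc_emb[OF M(1)], of f] assms(5) by auto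
  note pP = prime_in_emb[OF assms(1-3)] and pM = prime_in_Max[OF M(1)]
  have pPl: "prime_in (loc M) (iprod (emb ` P) (loc M))"
    unfolding loc_eq_localize using localize_primel[OF Rfr_is_subring pM pP] M(2) by blast
  have S: "is_subring (loc M)" by (rule loc_is_subring[OF M(1)])
  have inP: "x \<in> iprod (emb ` P) (loc M)" if "x \<in> emb ` P" for x
    using iprod_mem[OF that is_subringD(2)[OF S]] by simp
  have "emb f * inverse u \<in> iprod (emb ` P) (loc M)"
    using is_submoduleD(4)[OF prime_inD(1)[OF pPl] _ inP[OF imageI[OF assms(4)]]] u(2) unfolding loc_units_def by blast
  moreover have "emb f * inverse u = t ^ n" using u unfolding loc_units_def by simp
  moreover have tl: "t \<in> loc M" using t(1) loc_emb[OF M(1)] by blast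
  ultimately have tP: "t \<in> iprod (emb ` P) (loc M)" using prime_power[OF S pPl] by metis
  have "M \<subseteq> P"
  proof
    fix x assume "x \<in> M"
    then have "emb x \<in> iprod (emb ` M) (loc M)" using iprod_mem[OF imageI is_subringD(2)[OF S], of x M] by simp
    then have "emb x \<in> loc_max M" using loc_max_eq_iprod[OF M(1)] by simp
    then obtain y where "y \<in> loc M" "emb x = t * y" using t(3) by auto
    then have "emb x / 1 \<in> iprod (emb ` P) (loc M)" using is_submoduleD(4)[OF prime_inD(1)[OF pPl] _ tP] by simp
    moreover have "emb x \<in> Rfr" "1 \<in> Rfr - emb ` M"
      using prime_inD(3)[OF pM] is_subringD(2)[OF Rfr_is_subring] by (auto simp: Rfr_def)
    ultimately have "emb x \<in> emb ` P"
      using iprod_lo_prime[OF Rfr_is_subring pM pP] M(2) unfolding loc_eq_localize by blast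
    then show "x \<in> P" by auto
  qed
  then show ?thesis using M by (simp add: subset_antisym)
qed

lemma units_mult: "M \<in> Max_spec \<Longrightarrow> u \<in> loc_units M \<Longrightarrow> v \<in> loc_units M \<Longrightarrow> u * v \<in> loc_units (M :: 'a set)"
  unfolding loc_units_def using is_subringD(4)[OF loc_is_subring] by auto

lemma units_inverse: "M \<in> Max_spec \<Longrightarrow> u \<in> loc_units M \<Longrightarrow> inverse u \<in> loc_units (M :: 'a set)"
  unfolding loc_units_def by auto

lemma units_one: "M \<in> Max_spec \<Longrightarrow> 1 \<in> loc_units (M :: 'a set)"
  unfolding loc_units_def using is_subringD(2)[OF loc_is_subring] by auto

lemma units_powi: assumes "M \<in> Max_spec" "u \<in> loc_units M" shows "u powi n \<in> loc_units (M :: 'a set)"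
proof -
  have "v ^ k \<in> loc_units M" if "v \<in> loc_units M" for v and k :: nat
    by (induction k) (use units_one units_mult assms that in auto)
  then show ?thesis using assms units_inverse unfolding power_int_def by auto
qed

lemma units_not_max: assumes "M \<in> Max_spec" "u \<in> loc_units M" shows "u \<notin> loc_max (M :: 'a set)"
proof
  assume "u \<in> loc_max M"
  have pl: "prime_in (loc M) (loc_max M)"
    using localize_lcl[OF Rfr_is_subring prime_in_Max[OF assms(1)]]
    unfolding loc_max_eq_iprod[OF assms(1)] unfolding loc_eq_localize local_with_def by auto
  have "u * inverse u \<in> loc_max M"
    using is_submoduleD(4)[OF prime_inD(1)[OF pl] _ \<open>u \<in> loc_max M\<close>] assms(2) unfolding loc_units_def by blast
  then show False using prime_inD(3)[OF pl] assms(2) unfolding loc_units_def by simp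
qed

text \<open>\<open>val\<close> is a definite description over all generators of the maximal ideal,
  so the exponent must be shown independent of the generator. Afterwards one fixed t with its unit
  decomposition is enough for the computations.\<close>

lemma val_decomp:
  fixes M :: "'a set" assumes M: "M \<in> Max_spec"
  shows "\<exists>t. t \<noteq> 0 \<and> t \<in> loc_max M \<and> loc_max M = {t * y |y. y \<in> loc M} \<and>
    (\<forall>x. x \<noteq> 0 \<longrightarrow> (\<exists>u\<in>loc_units M. x = t powi (val M x) * u)) \<and>
    (\<forall>u\<in>loc_units M. \<forall>n. val M (t powi n * u) = n)"
proof -
  obtain t where t: "t \<noteq> 0" "t \<in> loc_max M" "loc_max M = {t * y |y. y \<in> loc M}" "t \<in> emb ` M"
    "\<forall>q\<in>loc M. q \<noteq> 0 \<longrightarrow> (\<exists>(n::nat) u. q = t ^ n * u \<and> u \<in> loc_units M)"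
    using loc_DVR[OF M] by blast
  have tl: "t \<in> loc M" using t(4) loc_emb[OF M] by blast
  have S: "is_subring (loc M)" by (rule loc_is_subring[OF M])
  have ex: "\<exists>n. \<exists>u\<in>loc_units M. x = t powi n * u" if "x \<noteq> 0" for x
  proof -
    obtain a b where ab: "x = emb a / emb b" "b \<noteq> 0" by (rule fract_emb_cases)
    have "a \<noteq> 0" using ab that by auto
    obtain n :: nat and u where u: "emb a = t ^ n * u" "u \<in> loc_units M" using bspec[OF t(5) loc_emb[OF M], of a] \<open>a \<noteq> 0\<close> by auto
    obtain m :: nat and v where v: "emb b = t ^ m * v" "v \<in> loc_units M" using bspec[OF t(5) loc_emb[OF M], of b] ab(2) by auto
    have "x = t powi (int n - int m) * (u * inverse v)"
      using t(1) u v ab by (simp add: power_int_diff field_simps)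
    then show ?thesis using units_mult[OF M u(2) units_inverse[OF M v(2)]] by blast
  qed
  have uniq: "n = m" if "u \<in> loc_units M" "v \<in> loc_units M" "t powi n * u = t powi m * v" for u v n m
  proof -
    have no: "\<not> n < m" if uv: "u \<in> loc_units M" "v \<in> loc_units M" "t powi n * u = t powi m * v" for u v n m
    proof
      assume "n < m"
      define k where "k = nat (m - n - 1)"
      then have k: "m = n + int (Suc k)" using \<open>n < m\<close> by simp
      have "t powi n * u = t powi n * (t * (t ^ k * v))"
        using uv(3) t(1) unfolding k power_int_add[OF disjI1[OF t(1)]] power_int_of_nat by (simp add: mult.assoc)
      then have "u = t * (t ^ k * v)" using t(1) by simp
      moreover have "t ^ k * v \<in> loc M"
        using is_subringD(4)[OF S is_subring_power[OF S tl]] uv(2) unfolding loc_units_def by blast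
      ultimately have "u \<in> loc_max M" using t(3) by blast
      then show False using units_not_max[OF M uv(1)] by blast
    qed
    show ?thesis using no[OF that] no[OF that(2,1) that(3)[symmetric]] by linarith
  qed
  have val: "val M (t powi n * u) = n" if u: "u \<in> loc_units M" for n u
    unfolding val_def
  proof (rule the_equality)
    have e: "t powi n * u * t powi - n = u" using t(1) by (simp add: power_int_minus)
    have "t powi n * u * t powi - n \<in> loc_units M" unfolding e by (rule u)
    with tl t(3) show "\<exists>s. s \<in> loc M \<and> loc_max M = {s * y |y. y \<in> loc M} \<and> t powi n * u * s powi - n \<in> loc_units M"
      by blast
    fix m assume "\<exists>s. s \<in> loc M \<and> loc_max M = {s * y |y. y \<in> loc M} \<and> t powi n * u * s powi - m \<in> loc_units M"
    then obtain s where s: "s \<in> loc M" "loc_max M = {s * y |y. y \<in> loc M}" "t powi n * u * s powi - m \<in> loc_units M" by blast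
    have "s * 1 \<in> loc_max M" using s(2) is_subringD(2)[OF S] by blast
    then obtain y where y: "y \<in> loc M" "s = t * y" using t(3) by auto
    obtain z where z: "z \<in> loc M" "t = s * z" using t(2) s(2) by auto
    \<comment> \<open>Two generators divide each other, so they differ by the unit y.\<close>
    have "t * 1 = t * (y * z)" by (metis mult.assoc mult_1_right y(2) z(2))
    then have yz: "y * z = 1" using t(1) by (metis mult_left_cancel)
    then have "y \<noteq> 0" "inverse y = z" by (auto intro: inverse_unique)
    then have yu: "y \<in> loc_units M" using y z unfolding loc_units_def by simp
    define w where "w = t powi n * u * s powi - m"
    have s0: "s \<noteq> 0" using y t(1) \<open>y \<noteq> 0\<close> by simp
    have "t powi n * u = w * s powi m" unfolding w_def using s0 by (simp add: power_int_minus)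
    also have "\<dots> = t powi m * (w * y powi m)" unfolding y(2) power_int_mult_distrib by (simp only: mult_ac)
    finally have "t powi n * u = t powi m * (w * y powi m)" .
    moreover have "w * y powi m \<in> loc_units M" using units_mult[OF M _ units_powi[OF M yu]] s(3) w_def by blast
    ultimately show "m = n" using uniq[OF u] by metis
  qed
  show ?thesis
    by (intro exI[of _ t] conjI t(1-3)) (use ex val in metis)+
qed

lemma val_mult:
  assumes M: "M \<in> (Max_spec :: 'a set set)" and "x \<noteq> 0" "y \<noteq> 0"
  shows "val M (x * y) = val M x + val M y"
proof -
  obtain t where t: "t \<noteq> 0" "\<forall>x. x \<noteq> 0 \<longrightarrow> (\<exists>u\<in>loc_units M. x = t powi (val M x) * u)"
    "\<forall>u\<in>loc_units M. \<forall>n. val M (t powi n * u) = n" using val_decomp[OF M] by blast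
  obtain u v where u: "u \<in> loc_units M" "x = t powi (val M x) * u" and v: "v \<in> loc_units M" "y = t powi (val M y) * v"
    using t(2) assms by blast
  have "x * y = t powi (val M x) * u * (t powi (val M y) * v)" using u(2) v(2) by metis
  also have "\<dots> = t powi (val M x + val M y) * (u * v)"
    using t(1) by (simp add: power_int_add mult_ac)
  finally show ?thesis using t(3) units_mult[OF M u(1) v(1)] by metis
qed

lemma val_one: assumes M: "M \<in> (Max_spec :: 'a set set)" shows "val M 1 = 0"
  using val_mult[OF M, of 1 1] by simp

lemma val_inverse: assumes M: "M \<in> (Max_spec :: 'a set set)" and "x \<noteq> 0" shows "val M (inverse x) = - val M x"
  using val_mult[OF M assms(2), of "inverse x"] val_one[OF M] assms(2) by simp

lemma val_nonneg_iff:
  assumes M: "M \<in> (Max_spec :: 'a set set)" and x: "x \<noteq> 0" shows "x \<in> loc M \<longleftrightarrow> val M x \<ge> 0"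
    and "x \<in> loc_max M \<longleftrightarrow> val M x > 0"
proof -
  obtain t where t: "t \<noteq> 0" "t \<in> loc_max M" "loc_max M = {t * y |y. y \<in> loc M}"
    "\<forall>x. x \<noteq> 0 \<longrightarrow> (\<exists>u\<in>loc_units M. x = t powi (val M x) * u)"
    "\<forall>u\<in>loc_units M. \<forall>n. val M (t powi n * u) = n" using val_decomp[OF M] by blast
  have S: "is_subring (loc M)" by (rule loc_is_subring[OF M])
  have sub: "loc_max M \<subseteq> loc M"
    using localize_lcl[OF Rfr_is_subring prime_in_Max[OF M]] prime_inD(2)
    unfolding loc_max_eq_iprod[OF M] unfolding loc_eq_localize local_with_def by blast
  have v1: "val M t = 1" using bspec[OF t(5) units_one[OF M], THEN spec, of 1] by simp
  have pos: "x \<in> loc M" if x: "x \<noteq> 0" "val M x \<ge> 0" for x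
  proof -
    obtain u where u: "u \<in> loc_units M" "x = t powi (val M x) * u" using t(4) x(1) by blast
    have "t powi (val M x) \<in> loc M" using is_subring_power[OF S, of t] sub t(2) x(2) by (auto simp: power_int_def)
    then show ?thesis using is_subringD(4)[OF S, of "t powi (val M x)" u] u unfolding loc_units_def by auto
  qed
  have posm: "x \<in> loc_max M" if x: "x \<noteq> 0" "val M x > 0" for x
  proof -
    have "val M (x * inverse t) \<ge> 0" using val_mult[OF M x(1), of "inverse t"] val_inverse[OF M t(1)] v1 t(1) x(2) by simp
    then have "x * inverse t \<in> loc M" using pos[of "x * inverse t"] x t(1) by simp
    moreover have "x = t * (x * inverse t)" using t(1) by simp
    ultimately show ?thesis using t(3) by blast
  qed
  have zero: "x \<in> loc_units M" if x: "x \<noteq> 0" "val M x = 0" for x using t(4) x by fastforce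
  have neg: "x \<notin> loc M" if x': "x \<noteq> 0" "val M x < 0" for x
  proof
    assume xl: "x \<in> loc M"
    have "inverse x \<in> loc_max M" using posm[of "inverse x"] val_inverse[OF M x'(1)] x' by simp
    moreover have "x * inverse x = 1" using x' by simp
    moreover have "prime_in (loc M) (loc_max M)"
      using localize_lcl[OF Rfr_is_subring prime_in_Max[OF M]] unfolding loc_max_eq_iprod[OF M] unfolding loc_eq_localize local_with_def by auto
    ultimately show False using is_submoduleD(3)[OF prime_inD(1) xl] prime_inD(3) by metis
  qed
  show "x \<in> loc M \<longleftrightarrow> val M x \<ge> 0" using pos[OF x] neg[OF x] by linarith
  show "x \<in> loc_max M \<longleftrightarrow> val M x > 0"
    using posm[OF x] neg[OF x] zero[OF x] units_not_max[OF M] sub by (metis linorder_cases subsetD)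
qed

text \<open>Scaling by an element of value -k reduces the claim to closure of the valuation ring
  under addition.\<close>

lemma val_add:
  assumes M: "M \<in> (Max_spec :: 'a set set)" and "x \<noteq> 0" "y \<noteq> 0" "x + y \<noteq> 0" "k \<le> val M x" "k \<le> val M y"
  shows "k \<le> val M (x + y)"
proof -
  obtain t where t: "t \<noteq> 0" "\<forall>u\<in>loc_units M. \<forall>n. val M (t powi n * u) = n" using val_decomp[OF M] by blast
  define s where "s = t powi (- k)"
  have s: "s \<noteq> 0" "val M s = - k" unfolding s_def using t(1) bspec[OF t(2) units_one[OF M], THEN spec, of "- k"] by auto
  have "s * x \<in> loc M" "s * y \<in> loc M" using assms s val_nonneg_iff[OF M] val_mult[OF M] by auto
  then have "s * x + s * y \<in> loc M" using is_subringD(3)[OF loc_is_subring[OF M]] by blast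
  then have "s * (x + y) \<in> loc M" by (simp only: distrib_left)
  then have "val M (s * (x + y)) \<ge> 0" using val_nonneg_iff(1)[OF M, of "s * (x + y)"] s assms by simp
  then show ?thesis using val_mult[OF M s(1) assms(4)] s by simp
qed

lemma val_surj:
  assumes M: "M \<in> (Max_spec :: 'a set set)" obtains x where "x \<noteq> 0" "val M x = k"
proof -
  obtain t where t: "t \<noteq> 0" "\<forall>u\<in>loc_units M. \<forall>n. val M (t powi n * u) = n" using val_decomp[OF M] by blast
  show thesis using that[of "t powi k"] t(1) bspec[OF t(2) units_one[OF M], THEN spec, of k] by simp
qed

lemma emb_loc_max_iff: assumes M: "M \<in> (Max_spec :: 'a set set)" shows "emb a \<in> loc_max M \<longleftrightarrow> a \<in> M"
proof
  assume "a \<in> M"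
  then show "emb a \<in> loc_max M" using iprod_mem[OF imageI is_subringD(2)[OF loc_is_subring[OF M]], of a M] loc_max_eq_iprod[OF M] by simp
next
  assume "emb a \<in> loc_max M"
  then have "emb a / 1 \<in> iprod (emb ` M) (localize Rfr (emb ` M))" using loc_max_eq_iprod[OF M] unfolding loc_eq_localize by simp
  moreover have "1 \<in> Rfr - emb ` M" using prime_inD(3)[OF prime_in_Max[OF M]] is_subringD(2)[OF Rfr_is_subring] by blast
  moreover have "emb a \<in> Rfr" by (simp add: Rfr_def)
  ultimately have "emb a \<in> emb ` M" using iprod_lo_prime[OF Rfr_is_subring prime_in_Max[OF M] prime_in_Max[OF M]] by blast
  then show "a \<in> M" by auto
qed

lemma val_emb:
  assumes M: "M \<in> (Max_spec :: 'a set set)" and "a \<noteq> 0"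
  shows "val M (emb a) \<ge> 0" "val M (emb a) > 0 \<longleftrightarrow> a \<in> M"
  using val_nonneg_iff[OF M, of "emb a"] loc_emb[OF M, of a] emb_loc_max_iff[OF M, of a] assms(2) by auto

end

section \<open>Compactly supported functions and the inverse topology\<close>

lemma continuous_map_int_iff:
  "continuous_map X euclidean (f :: 'x \<Rightarrow> int) \<longleftrightarrow> (\<forall>c. openin X {x \<in> topspace X. f x = c})"
proof
  assume f: "continuous_map X euclidean f"
  show "\<forall>c. openin X {x \<in> topspace X. f x = c}"
  proof
    fix c
    have "openin X {x \<in> topspace X. f x \<in> {c}}"
      by (rule openin_continuous_map_preimage[OF f]) (simp add: open_openin[symmetric] open_discrete)
    then show "openin X {x \<in> topspace X. f x = c}" by simp
  qed
next
  assume f: "\<forall>c. openin X {x \<in> topspace X. f x = c}"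
  show "continuous_map X euclidean f" unfolding continuous_map_def
  proof (intro conjI allI impI)
    fix U :: "int set"
    have "{x \<in> topspace X. f x \<in> U} = \<Union>((\<lambda>c. {x \<in> topspace X. f x = c}) ` U)" by auto
    then show "openin X {x \<in> topspace X. f x \<in> U}" using f by (metis (no_types, lifting) imageE openin_Union)
  qed auto
qed

text \<open>In a Hausdorff space compact sets are closed, so the support has compact closure as soon
  as some compact set contains it; continuity into the discrete integers means open fibres.\<close>

lemma Cc_iff:
  assumes X: "Hausdorff_space X"
  shows "f \<in> Cc X \<longleftrightarrow> (\<forall>c. openin X {x \<in> topspace X. f x = c}) \<and>
    (\<exists>K. compactin X K \<and> {x \<in> topspace X. f x \<noteq> 0} \<subseteq> K) \<and> (\<forall>x. x \<notin> topspace X \<longrightarrow> f x = 0)"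
proof -
  let ?S = "{x \<in> topspace X. f x \<noteq> 0}"
  have "compactin X (X closure_of ?S)" if K: "compactin X K" "?S \<subseteq> K" for K
    by (rule closed_compactin[OF K(1)])
      (use closure_of_minimal[OF K(2) compactin_imp_closedin[OF X K(1)]] in auto)
  moreover have "?S \<subseteq> X closure_of ?S" by (rule closure_of_subset) auto
  ultimately have "compactin X (X closure_of ?S) \<longleftrightarrow> (\<exists>K. compactin X K \<and> ?S \<subseteq> K)" by blast
  then show ?thesis unfolding Cc_def by (simp add: continuous_map_int_iff)
qed

lemma fiber_open:
  assumes "\<And>c::int. openin X {x \<in> topspace X. f x = c}" shows "openin X {x \<in> topspace X. f x \<in> S}"
proof -
  have "{x \<in> topspace X. f x \<in> S} = \<Union>((\<lambda>c. {x \<in> topspace X. f x = c}) ` S)" by auto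
  moreover have "openin X (\<Union>((\<lambda>c. {x \<in> topspace X. f x = c}) ` S))" using assms by (intro openin_Union) auto
  ultimately show ?thesis by simp
qed

lemma fiber_closed:
  assumes "\<And>c::int. openin X {x \<in> topspace X. f x = c}" shows "closedin X {x \<in> topspace X. f x \<in> S}"
proof -
  have "topspace X - {x \<in> topspace X. f x \<in> - S} = {x \<in> topspace X. f x \<in> S}" by auto
  then show ?thesis using fiber_open[OF assms, of "- S"] by (metis closedin_diff closedin_topspace openin_closedin_eq)
qed

lemma Cc_fibers: assumes X: "Hausdorff_space X" and f: "f \<in> Cc X"
  shows "openin X {x \<in> topspace X. f x \<in> S}" "closedin X {x \<in> topspace X. f x \<in> S}"
    "0 \<notin> S \<Longrightarrow> compactin X {x \<in> topspace X. f x \<in> S}"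
proof -
  obtain K where K: "compactin X K" "{x \<in> topspace X. f x \<noteq> 0} \<subseteq> K" and o: "\<And>c. openin X {x \<in> topspace X. f x = c}"
    using f unfolding Cc_iff[OF X] by blast
  show "openin X {x \<in> topspace X. f x \<in> S}" by (rule fiber_open[OF o])
  show cl: "closedin X {x \<in> topspace X. f x \<in> S}" by (rule fiber_closed[OF o])
  show "0 \<notin> S \<Longrightarrow> compactin X {x \<in> topspace X. f x \<in> S}"
    by (rule closed_compactin[OF K(1) _ cl]) (use K(2) in auto)
qed

lemma Cc_outside: "f \<in> Cc X \<Longrightarrow> x \<notin> topspace X \<Longrightarrow> f x = 0"
  unfolding Cc_def by blast

text \<open>Every operation on the discrete integers is continuous; its value at (0, 0) decides
  whether compact support is kept.\<close>

lemma Cc_comb: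
  assumes X: "Hausdorff_space X" and f: "f \<in> Cc X" and g: "g \<in> Cc X" and h: "h 0 0 = 0"
  shows "(\<lambda>x. h (f x) (g x)) \<in> Cc X"
  unfolding Cc_iff[OF X]
proof (intro conjI allI impI)
  fix c
  have "{x \<in> topspace X. h (f x) (g x) = c} =
    \<Union>((\<lambda>(a,b). {x \<in> topspace X. f x \<in> {a}} \<inter> {x \<in> topspace X. g x \<in> {b}}) ` {(a,b). h a b = c})" by auto
  moreover have "openin X \<dots>"
  proof (rule openin_Union, clarify)
    fix a b show "openin X ({x \<in> topspace X. f x \<in> {a}} \<inter> {x \<in> topspace X. g x \<in> {b}})"
      by (intro openin_Int Cc_fibers(1)[OF X f] Cc_fibers(1)[OF X g])
  qed
  ultimately show "openin X {x \<in> topspace X. h (f x) (g x) = c}" by simp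
next
  have "compactin X ({x \<in> topspace X. f x \<in> - {0}} \<union> {x \<in> topspace X. g x \<in> - {0}})"
    using Cc_fibers(3)[OF X f, of "- {0}"] Cc_fibers(3)[OF X g, of "- {0}"] by (intro compactin_Un) auto
  moreover have "{x \<in> topspace X. h (f x) (g x) \<noteq> 0} \<subseteq> ({x \<in> topspace X. f x \<in> - {0}} \<union> {x \<in> topspace X. g x \<in> - {0}})"
    using h by auto
  ultimately show "\<exists>K. compactin X K \<and> {x \<in> topspace X. h (f x) (g x) \<noteq> 0} \<subseteq> K" by blast
next
  fix x assume "x \<notin> topspace X"
  then show "h (f x) (g x) = 0" using Cc_outside f g h by metis
qed

lemma Cc_add: "Hausdorff_space X \<Longrightarrow> f \<in> Cc X \<Longrightarrow> g \<in> Cc X \<Longrightarrow> (\<lambda>x. f x + g x) \<in> Cc X"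
  using Cc_comb[of X f g "(+)"] by simp

lemma Cc_diff: "Hausdorff_space X \<Longrightarrow> f \<in> Cc X \<Longrightarrow> g \<in> Cc X \<Longrightarrow> (\<lambda>x. f x - g x) \<in> Cc X"
  using Cc_comb[of X f g "(-)"] by simp

lemma Cc_cmul: "Hausdorff_space X \<Longrightarrow> f \<in> Cc X \<Longrightarrow> (\<lambda>x. c * f x) \<in> Cc X"
  using Cc_comb[of X f f "\<lambda>a b. c * a"] by simp

lemma Cc_zero: "(\<lambda>x. 0) \<in> Cc X"
  unfolding Cc_def by (auto simp: closure_of_empty)

lemma Cc_uminus: "Hausdorff_space X \<Longrightarrow> f \<in> Cc X \<Longrightarrow> (\<lambda>x. - f x) \<in> Cc X"
  using Cc_cmul[of X f "- 1"] by simp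

lemma Cc_char_fn:
  assumes X: "Hausdorff_space X" and U: "openin X U" "compactin X U" shows "char_fn U \<in> Cc X"
  unfolding Cc_iff[OF X]
proof (intro conjI allI impI)
  have sub: "U \<subseteq> topspace X" using openin_subset[OF U(1)] .
  have "openin X (topspace X - U)" using compactin_imp_closedin[OF X U(2)] by (simp add: closedin_def)
  moreover have "{x \<in> topspace X. char_fn U x = c} = (if c = 1 then U else if c = 0 then topspace X - U else {})" for c
    using sub by (auto simp: char_fn_def)
  ultimately show "openin X {x \<in> topspace X. char_fn U x = c}" for c using U(1) by auto
  show "\<exists>K. compactin X K \<and> {x \<in> topspace X. char_fn U x \<noteq> 0} \<subseteq> K"
    using U(2) by (intro exI[of _ U]) (auto simp: char_fn_def)
  show "x \<notin> topspace X \<Longrightarrow> char_fn U x = 0" for x using sub by (auto simp: char_fn_def)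
qed

lemma Cc_finite_range:
  assumes X: "Hausdorff_space X" and f: "f \<in> Cc X" shows "finite (range f)"
proof -
  let ?K = "{x \<in> topspace X. f x \<in> - {0}}"
  have K: "compactin X ?K" by (rule Cc_fibers(3)[OF X f]) simp
  let ?U = "(\<lambda>c. {x \<in> topspace X. f x \<in> {c}}) ` UNIV"
  have "\<forall>U\<in>?U. openin X U" using Cc_fibers(1)[OF X f] by blast
  moreover have "?K \<subseteq> \<Union>?U" by auto
  ultimately obtain \<F> where \<F>: "finite \<F>" "\<F> \<subseteq> ?U" "?K \<subseteq> \<Union>\<F>"
    using K unfolding compactin_def by meson
  then obtain C where C: "finite C" "\<F> = (\<lambda>c. {x \<in> topspace X. f x \<in> {c}}) ` C"
    by (meson finite_subset_image)
  have "range f \<subseteq> insert 0 C"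
  proof (intro subsetI, elim rangeE)
    fix y x assume y: "y = f x"
    show "y \<in> insert 0 C"
    proof (cases "f x = 0")
      case False
      then have "x \<in> ?K" using Cc_outside[OF f, of x] by auto
      then show ?thesis using \<F>(3) C y by auto
    qed (simp add: y)
  qed
  then show ?thesis using C(1) finite_subset by auto
qed

lemma Cc_bounded:
  assumes X: "Hausdorff_space X" and f: "f \<in> Cc X" shows "\<exists>b\<ge>0. \<forall>x. \<bar>f x\<bar> \<le> b"
proof (intro exI conjI allI)
  have fin: "finite (abs ` range f)" using Cc_finite_range[OF X f] by simp
  show "\<bar>f x\<bar> \<le> Max (abs ` range f)" for x using fin by (intro Max_ge) auto
  then show "0 \<le> Max (abs ` range f)" by (meson abs_ge_zero order_trans)
qed

section \<open>The inverse topology on the maximal ideals\<close>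

abbreviation "max_top \<equiv> inverse_topology_Max"

lemma topspace_max_top: "topspace max_top = Max_spec"
proof -
  have "UNIV \<in> {{P. F \<subseteq> P} |F. finite (F :: 'a set)}" by (auto intro!: exI[of _ "{}"])
  then have "\<Union> {{P. F \<subseteq> P} |F. finite (F :: 'a set)} = UNIV" by blast
  then show ?thesis unfolding inverse_topology_Max_def by simp
qed

lemma openin_max_top_V: "finite F \<Longrightarrow> openin max_top {P \<in> Max_spec. F \<subseteq> P}"
  unfolding inverse_topology_Max_def openin_subtopology
  by (rule exI[of _ "{P. F \<subseteq> P}"]) (auto intro!: topology_generated_by_Basis)

text \<open>Finite intersections of the generating sets V(F) are again of this form, so these sets
  are a base.\<close>

lemma openin_max_top_basis:
  assumes "openin max_top W" "M \<in> W" shows "\<exists>F. finite F \<and> F \<subseteq> M \<and> {P \<in> Max_spec. F \<subseteq> P} \<subseteq> W"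
proof -
  obtain U where U: "generate_topology_on {{P. F \<subseteq> P} |F. finite F} U" "W = U \<inter> Max_spec"
    using assms(1) unfolding inverse_topology_Max_def openin_subtopology openin_topology_generated_by_iff by blast
  have "M \<in> U \<longrightarrow> (\<exists>F. finite F \<and> F \<subseteq> M \<and> {P. F \<subseteq> P} \<subseteq> U)"
    using U(1)
  proof induction
    case (Int a b)
    show ?case
    proof
      assume "M \<in> a \<inter> b"
      then obtain F G where "finite F" "F \<subseteq> M" "{P. F \<subseteq> P} \<subseteq> a" "finite G" "G \<subseteq> M" "{P. G \<subseteq> P} \<subseteq> b"
        using Int.IH by (elim IntE) metis
      then have "finite (F \<union> G)" "F \<union> G \<subseteq> M" "{P. F \<union> G \<subseteq> P} \<subseteq> a \<inter> b" by auto
      then show "\<exists>F. finite F \<and> F \<subseteq> M \<and> {P. F \<subseteq> P} \<subseteq> a \<inter> b" by (intro exI[of _ "F \<union> G"] conjI)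
    qed
  next
    case (UN K)
    show ?case
    proof
      assume "M \<in> \<Union>K"
      then obtain k where k: "k \<in> K" "M \<in> k" by (rule UnionE)
      then obtain F where "finite F" "F \<subseteq> M" "{P. F \<subseteq> P} \<subseteq> k" using UN.IH[OF k(1)] by metis
      moreover from this have "{P. F \<subseteq> P} \<subseteq> \<Union>K" using k(1) by (meson Union_upper order_trans)
      ultimately show "\<exists>F. finite F \<and> F \<subseteq> M \<and> {P. F \<subseteq> P} \<subseteq> \<Union>K" by (intro exI[of _ F] conjI)
    qed
  next
    case (Basis s)
    then obtain F where "finite F" "s = {P. F \<subseteq> P}" by (elim CollectE exE conjE)
    then show ?case by (intro impI exI[of _ F]) simp
  qed simp
  then show ?thesis using U(2) assms(2) by blast
qed

text \<open>Since 1 = m + r * x with m in P, the open set V(m) around P avoids V(x). So on maximal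
  ideals the sets V(x) are clopen, and they separate points.\<close>

lemma openin_max_top_D: "openin max_top {P \<in> Max_spec. x \<notin> P}"
proof (subst openin_subopen, intro ballI)
  fix P assume P: "P \<in> {P \<in> Max_spec. x \<notin> P}"
  then obtain m r where mr: "m \<in> P" "1 = m + r * x" using maximal_adjoin by blast
  have "x \<notin> Q" if "Q \<in> Max_spec" "m \<in> Q" for Q
    using is_idealD(2)[OF Max_spec_ideal(1)[OF that(1)] that(2), of "r * x"]
      is_idealD(3)[OF Max_spec_ideal(1)[OF that(1)], of x r] Max_spec_ideal(2)[OF that(1)] mr(2) by metis
  then show "\<exists>T. openin max_top T \<and> P \<in> T \<and> T \<subseteq> {P \<in> Max_spec. x \<notin> P}"
    using openin_max_top_V[of "{m}"] P mr by (intro exI[of _ "{P \<in> Max_spec. {m} \<subseteq> P}"]) auto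
qed

lemma closedin_max_top_V: "closedin max_top {P \<in> Max_spec. F \<subseteq> P}"
proof -
  have "Max_spec - {P \<in> Max_spec. F \<subseteq> P} = \<Union>((\<lambda>x. {P \<in> Max_spec. x \<notin> P}) ` F)" by auto
  moreover have "openin max_top (\<Union>((\<lambda>x. {P \<in> Max_spec. x \<notin> P}) ` F))" using openin_max_top_D by (intro openin_Union) auto
  ultimately show ?thesis unfolding closedin_def topspace_max_top by auto
qed

lemma Hausdorff_max_top: "Hausdorff_space max_top"
  unfolding Hausdorff_space_def topspace_max_top
proof (intro allI impI)
  fix M N :: "'a set" assume MN: "M \<in> Max_spec \<and> N \<in> Max_spec \<and> M \<noteq> N"
  then obtain x where "x \<in> M" "x \<notin> N" using Max_spec_incomparable by blast
  then show "\<exists>U V. openin max_top U \<and> openin max_top V \<and> M \<in> U \<and> N \<in> V \<and> disjnt U V"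
    using MN openin_max_top_V[of "{x}"] openin_max_top_D[of x]
    by (intro exI[of _ "{P \<in> Max_spec. {x} \<subseteq> P}"] exI[of _ "{P \<in> Max_spec. x \<notin> P}"]) (auto simp: disjnt_def)
qed

text \<open>Tychonoff for sets of ring elements viewed as points of a power of the two-point space: since
  nonzero primes are maximal, being a maximal ideal that contains \<open>f\<close> is a closed condition.\<close>

lemma compactin_max_top_V:
  assumes sp: "SP_domain TYPE('a::idom)" and f: "f \<noteq> (0 :: 'a)"
  shows "compactin max_top {P \<in> Max_spec. f \<in> P}"
proof -
  define X where "X = product_topology (\<lambda>_::'a. discrete_topology (UNIV::bool set)) UNIV"
  have tX: "topspace X = UNIV" unfolding X_def by auto
  have cX: "compact_space X" unfolding X_def compact_space_product_topology
    by (simp add: compact_space_discrete_topology)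
  define cy where "cy x b = {p :: 'a \<Rightarrow> bool. p x = b}" for x b
  have cy: "openin X (cy x b)" for x b
  proof -
    have "continuous_map X (discrete_topology (UNIV::bool set)) (\<lambda>p. p x)"
      unfolding X_def by (rule continuous_map_product_projection) simp
    then have "openin X {p \<in> topspace X. p x \<in> {b}}" by (rule openin_continuous_map_preimage) simp
    then show ?thesis unfolding cy_def tX by simp
  qed
  \<comment> \<open>Each member records, through finitely many coordinates, one way of failing to be
    a prime ideal that contains f; what is left over is closed.\<close>
  define \<U> where "\<U> = {cy 0 False, cy f False, cy 1 True}
     \<union> {cy x True \<inter> cy y True \<inter> cy (x + y) False |x y. True}
     \<union> {cy x True \<inter> cy (r * x) False |r x. True}
     \<union> {cy (x * y) True \<inter> cy x False \<inter> cy y False |x y. True}"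
  have opU: "openin X (\<Union>\<U>)"
    by (rule openin_Union) (auto simp: \<U>_def intro!: openin_Int cy)
  define C where "C = {p. Collect p \<in> Max_spec \<and> p f}"
  have "C = topspace X - \<Union>\<U>"
  proof (intro equalityI subsetI)
    fix p assume p: "p \<in> C"
    then have M: "Collect p \<in> Max_spec" "p f" unfolding C_def by auto
    note I = is_idealD[OF Max_spec_ideal(1)[OF M(1)]]
    have "p 0" "\<not> p 1" using I(1) Max_spec_ideal(2)[OF M(1)] by auto
    moreover have "p x \<Longrightarrow> p y \<Longrightarrow> p (x + y)" for x y using I(2)[of x y] by auto
    moreover have "p x \<Longrightarrow> p (r * x)" for r x using I(3)[of x r] by auto
    moreover have "p (x * y) \<Longrightarrow> p x \<or> p y" for x y using Max_spec_prime[OF M(1), of x y] by auto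
    ultimately have "p \<notin> S" if "S \<in> \<U>" for S using that M(2) unfolding \<U>_def cy_def by blast
    then show "p \<in> topspace X - \<Union>\<U>" unfolding tX by blast
  next
    fix p assume "p \<in> topspace X - \<Union>\<U>"
    then have nU: "\<And>S. S \<in> \<U> \<Longrightarrow> p \<notin> S" by blast
    have "p 0" using nU[of "cy 0 False"] unfolding \<U>_def cy_def by blast
    moreover have pf: "p f" using nU[of "cy f False"] unfolding \<U>_def cy_def by blast
    moreover have "\<not> p 1" using nU[of "cy 1 True"] unfolding \<U>_def cy_def by blast
    moreover have "p (x + y)" if "p x" "p y" for x y
      using nU[of "cy x True \<inter> cy y True \<inter> cy (x + y) False"] that unfolding \<U>_def cy_def by blast
    moreover have "p (r * x)" if "p x" for r x
      using nU[of "cy x True \<inter> cy (r * x) False"] that unfolding \<U>_def cy_def by blast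
    moreover have "p x \<or> p y" if "p (x * y)" for x y
      using nU[of "cy (x * y) True \<inter> cy x False \<inter> cy y False"] that unfolding \<U>_def cy_def by blast
    ultimately have "Collect p \<in> Max_spec"
      using f by (intro nonzero_prime_maximal[OF sp _ _ _ _ f]) (simp_all add: is_ideal_def)
    then show "p \<in> C" using pf unfolding C_def by blast
  qed
  then have "closedin X C" using opU by (simp add: openin_closedin_eq closedin_diff)
  then have cC: "compactin X C" by (rule closedin_compact_space[OF cX])
  have cont: "continuous_map (subtopology X C) max_top Collect"
    unfolding inverse_topology_Max_def
  proof (rule continuous_map_into_subtopology)
    show "Collect \<in> topspace (subtopology X C) \<rightarrow> Max_spec" unfolding C_def by auto
    show "continuous_map (subtopology X C) (topology_generated_by {{P. F \<subseteq> P} |F. finite F}) Collect"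
    proof (rule continuous_on_generated_topo)
      fix U assume "U \<in> {{P. F \<subseteq> P} |F. finite (F :: 'a set)}"
      then obtain F :: "'a set" where F: "finite F" "U = {P. F \<subseteq> P}" by blast
      have "openin X {p. \<forall>x\<in>F. p x}" using F(1)
      proof (induction F)
        case empty then show ?case using openin_topspace[of X] tX by simp
      next
        case (insert x F)
        have "{p. \<forall>x\<in>insert x F. p x} = cy x True \<inter> {p. \<forall>x\<in>F. p x}" unfolding cy_def by auto
        then show ?case using insert cy by auto
      qed
      moreover have "Collect -` U \<inter> topspace (subtopology X C) = {p. \<forall>x\<in>F. p x} \<inter> C"
        unfolding F(2) by (auto simp: tX)
      ultimately show "openin (subtopology X C) (Collect -` U \<inter> topspace (subtopology X C))"
        unfolding openin_subtopology by blast
    next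
      have "UNIV \<in> {{P. F \<subseteq> P} |F. finite (F :: 'a set)}" by (auto intro!: exI[of _ "{}"])
      then show "Collect ` topspace (subtopology X C) \<subseteq> \<Union> {{P. F \<subseteq> P} |F. finite F}" by blast
    qed
  qed
  have "compactin (subtopology X C) C" using cC by (simp add: compactin_subtopology)
  then have "compactin max_top (Collect ` C)" using image_compactin cont by blast
  moreover have "Collect ` C = {P \<in> Max_spec. f \<in> P}"
  proof (intro equalityI subsetI)
    fix P assume P: "P \<in> {P \<in> Max_spec. f \<in> P}"
    have "P = Collect (\<lambda>x. x \<in> P)" by simp
    moreover have "(\<lambda>x. x \<in> P) \<in> C" using P unfolding C_def by simp
    ultimately show "P \<in> Collect ` C" by (rule image_eqI)
  qed (auto simp: C_def)
  ultimately show ?thesis by simp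
qed

text \<open>Adding a nonzero element of M to F makes the basic neighbourhood compact.\<close>

lemma compact_open_max_top_basis:
  assumes sp: "SP_domain TYPE('a::idom)" and W: "openin max_top W" "M \<in> (W :: 'a set set)"
  shows "\<exists>V. openin max_top V \<and> compactin max_top V \<and> M \<in> V \<and> V \<subseteq> W"
proof -
  have M: "M \<in> Max_spec" using openin_subset[OF W(1)] W(2) topspace_max_top by blast
  obtain F where F: "finite F" "F \<subseteq> M" "{P \<in> Max_spec. F \<subseteq> P} \<subseteq> W" using openin_max_top_basis[OF W] by blast
  obtain f where f: "f \<in> M" "f \<noteq> 0" using Max_spec_nonzero[OF sp M] by blast
  let ?V = "{P \<in> Max_spec. insert f F \<subseteq> P}"
  have "compactin max_top ?V"
    by (rule closed_compactin[OF compactin_max_top_V[OF sp f(2)] _ closedin_max_top_V]) auto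
  moreover have "openin max_top ?V" by (rule openin_max_top_V) (use F in auto)
  ultimately show ?thesis using F f M by (intro exI[of _ ?V]) auto
qed

section \<open>Invertible ideals\<close>

lemma R_submodule_iff: "R_submodule I \<longleftrightarrow> is_submodule Rfr I"
  unfolding R_submodule_def is_submodule_def add_closed_def by blast

lemma frac_mult_eq_iprod: assumes "is_submodule Rfr I" shows "frac_mult I J = iprod I J"
proof
  have "R_submodule (iprod I J)" unfolding R_submodule_iff by (rule iprod_modl[OF assms])
  then show "frac_mult I J \<subseteq> iprod I J" unfolding frac_mult_def by (auto intro: iprod_mem)
  show "iprod I J \<subseteq> frac_mult I J" unfolding frac_mult_def
    by (intro Inter_greatest iprod_least) (auto simp: R_submodule_iff is_submodule_addc)
qed

lemma frac_idealD: "frac_ideal I \<Longrightarrow> is_submodule Rfr I" "frac_ideal I \<Longrightarrow> \<exists>x\<in>I. x \<noteq> 0"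
  "frac_ideal I \<Longrightarrow> \<exists>d. d \<noteq> 0 \<and> (\<forall>x\<in>I. emb d * x \<in> Rfr)"
proof -
  assume I: "frac_ideal I"
  show m: "is_submodule Rfr I" using I unfolding frac_ideal_def R_submodule_iff by blast
  show "\<exists>x\<in>I. x \<noteq> 0" using I is_submoduleD(1)[OF m] unfolding frac_ideal_def by blast
  show "\<exists>d. d \<noteq> 0 \<and> (\<forall>x\<in>I. emb d * x \<in> Rfr)" using I unfolding frac_ideal_def by blast
qed

lemma frac_idealI: "is_submodule Rfr I \<Longrightarrow> x \<in> I \<Longrightarrow> x \<noteq> 0 \<Longrightarrow> d \<noteq> 0 \<Longrightarrow> (\<And>x. x \<in> I \<Longrightarrow> emb d * x \<in> Rfr) \<Longrightarrow> frac_ideal I"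
  unfolding frac_ideal_def R_submodule_iff by blast

lemma frac_ideal_Rfr: "frac_ideal Rfr"
proof (rule frac_idealI)
  show "1 \<in> Rfr" by (rule is_subringD(2)[OF Rfr_is_subring])
  show "emb 1 * x \<in> Rfr" if "x \<in> Rfr" for x :: "'a fract" using that by simp
qed (use is_subring_modl[OF Rfr_is_subring] in simp_all)

lemma add_closed_vimage: "add_closed N \<Longrightarrow> add_closed {z. m * z \<in> N}"
  unfolding add_closed_def by (auto simp: distrib_left)

lemma add_closed_scale: "add_closed N \<Longrightarrow> add_closed ((*) m ` N)"
  unfolding add_closed_def by (auto simp: image_iff distrib_left[symmetric])

lemma emb_Rfr: "emb a \<in> Rfr"
  unfolding Rfr_def by blast

lemma frac_ideal_iprod: assumes "frac_ideal I" "frac_ideal J" shows "frac_ideal (iprod I J)"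
proof -
  obtain x y where xy: "x \<in> I" "x \<noteq> 0" "y \<in> J" "y \<noteq> 0" using assms frac_idealD(2) by metis
  obtain c where c: "c \<noteq> 0" "\<forall>x\<in>I. emb c * x \<in> Rfr" using frac_idealD(3)[OF assms(1)] by blast
  obtain d where d: "d \<noteq> 0" "\<forall>x\<in>J. emb d * x \<in> Rfr" using frac_idealD(3)[OF assms(2)] by blast
  have "add_closed {z. emb (c * d) * z \<in> Rfr}"
    by (rule add_closed_vimage[OF is_submodule_addc[OF is_subring_modl[OF Rfr_is_subring]]])
  then have sub: "iprod I J \<subseteq> {z. emb (c * d) * z \<in> Rfr}"
  proof (rule iprod_least)
    fix x y assume "x \<in> I" "y \<in> J"
    then have "(emb c * x) * (emb d * y) \<in> Rfr" using c d is_subringD(4)[OF Rfr_is_subring] by blast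
    then show "x * y \<in> {z. emb (c * d) * z \<in> Rfr}" by (simp add: mult_ac)
  qed
  show ?thesis
    by (rule frac_idealI[OF iprod_modl[OF frac_idealD(1)[OF assms(1)]] iprod_mem[OF xy(1,3)], of "c * d"])
      (use xy c d sub in auto)
qed

lemma iprod_finite: "z \<in> iprod I J \<Longrightarrow> \<exists>F. finite F \<and> F \<subseteq> I \<and> z \<in> iprod F J"
proof (induction rule: iprod.induct)
  case iprod_0 then show ?case by (intro exI[of _ "{}"]) (auto intro: iprod.iprod_0)
next
  case (iprod_step x y z)
  then obtain F where F: "finite F" "F \<subseteq> I" "z \<in> iprod F J" by blast
  have "z \<in> iprod (insert x F) J" using F(3) iprod_mono[of F "insert x F" J J] by blast
  then show ?case using F iprod_step by (intro exI[of _ "insert x F"]) (auto intro: iprod.iprod_step)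
qed

text \<open>The threshold lies just below the first failure above a. Both the attained minimum of
  the valuations on an ideal and the regularized function on the cover are found in this
  way.\<close>

lemma antimono_int_threshold:
  fixes P :: "int \<Rightarrow> bool"
  assumes "P a" "\<not> P b" "\<And>m n. P n \<Longrightarrow> m \<le> n \<Longrightarrow> P m"
  shows "\<exists>m. \<forall>n. P n \<longleftrightarrow> n \<le> m"
proof -
  define k where "k = (LEAST k. \<not> P (a + int k))"
  have ab: "a < b" using assms by (meson not_le)
  then have "\<not> P (a + int (nat (b - a)))" using assms(2) by simp
  then have k: "\<not> P (a + int k)" "\<And>i. i < k \<Longrightarrow> P (a + int i)"
    unfolding k_def by (rule LeastI) (use not_less_Least in blast)
  have "k \<noteq> 0" using k(1) assms(1) by (metis add.right_neutral of_nat_0)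
  then have "P (a + int k - 1)" using k(2)[of "k - 1"] by (simp add: of_nat_diff algebra_simps)
  then have "P n \<longleftrightarrow> n \<le> a + int k - 1" for n
    using assms(3)[of "a + int k - 1" n] assms(3)[of n "a + int k"] k(1) by linarith
  then show ?thesis by blast
qed

definition val_fun :: "'a::idom fract \<Rightarrow> 'a set \<Rightarrow> int" where
  "val_fun x M = (if M \<in> Max_spec then val M x else 0)"

text \<open>The candidate for the preimage of g under \<open>Psi\<close>; 0 is listed separately
  since \<open>val M 0\<close> is unspecified.\<close>

definition ideal_above :: "('a::idom set \<Rightarrow> int) \<Rightarrow> 'a fract set" where
  "ideal_above g = {x. x = 0 \<or> (\<forall>M\<in>Max_spec. g M \<le> val M x)}"

context
  assumes sp: "SP_domain TYPE('a::idom)"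
begin

lemma val_Rfr: "M \<in> (Max_spec :: 'a set set) \<Longrightarrow> x \<in> Rfr \<Longrightarrow> x \<noteq> 0 \<Longrightarrow> val M x \<ge> 0"
  using val_emb(1)[OF sp] unfolding Rfr_def by auto

lemma frac_bound:
  fixes I :: "'a fract set" assumes I: "frac_ideal I"
  shows "\<exists>d. d \<noteq> 0 \<and> (\<forall>M\<in>Max_spec. \<forall>i\<in>I. i \<noteq> 0 \<longrightarrow> - val M (emb d) \<le> val M i)"
proof -
  obtain d where d: "d \<noteq> 0" "\<forall>x\<in>I. emb d * x \<in> Rfr" using frac_idealD(3)[OF I] by blast
  have "- val M (emb d) \<le> val M i" if "M \<in> Max_spec" "i \<in> I" "i \<noteq> 0" for M i
    using val_Rfr[OF that(1), of "emb d * i"] val_mult[OF sp that(1), of "emb d" i] d that by auto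
  then show ?thesis using d(1) by blast
qed

lemma nu_eqI:
  fixes I :: "'a fract set"
  assumes "i \<in> I" "i \<noteq> 0" "val M i = k" "\<And>i. i \<in> I \<Longrightarrow> i \<noteq> 0 \<Longrightarrow> k \<le> val M i"
  shows "nu I M = k"
  unfolding nu_def by (rule cInf_eq_minimum) (use assms in auto)

text \<open>The infimum in \<open>nu\<close> ranges over integers and is meaningful only for
  nonempty sets bounded below; a common denominator of I provides the bound, so a minimum is
  attained.\<close>

lemma nu_props:
  fixes I :: "'a fract set" assumes I: "frac_ideal I" and M: "M \<in> Max_spec"
  shows "\<exists>i\<in>I. i \<noteq> 0 \<and> val M i = nu I M" "\<And>i. i \<in> I \<Longrightarrow> i \<noteq> 0 \<Longrightarrow> nu I M \<le> val M i"
proof -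
  obtain d where "\<forall>M\<in>Max_spec. \<forall>i\<in>I. i \<noteq> 0 \<longrightarrow> - val M (emb d) \<le> val M i"
    using frac_bound[OF I] by (elim exE conjE)
  from bspec[OF this M] have d: "\<forall>i\<in>I. i \<noteq> 0 \<longrightarrow> - val M (emb d) \<le> val M i" .
  obtain i0 where i0: "i0 \<in> I" "i0 \<noteq> 0" using frac_idealD(2)[OF I] by blast
  let ?P = "\<lambda>k. \<forall>i\<in>I. i \<noteq> 0 \<longrightarrow> k \<le> val M i"
  have "\<exists>m. \<forall>n. ?P n \<longleftrightarrow> n \<le> m"
  proof (rule antimono_int_threshold)
    show "?P (- val M (emb d))" by (rule d)
    show "\<not> ?P (val M i0 + 1)" using i0 by force
    show "?P m" if "?P n" "m \<le> n" for m n using that by force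
  qed
  then obtain m where m: "\<forall>n. ?P n \<longleftrightarrow> n \<le> m" by (elim exE)
  have "\<not> ?P (m + 1)" "?P m" using m[rule_format, of "m + 1"] m[rule_format, of m] by (simp_all only: order_refl)
  then obtain i where i: "i \<in> I" "i \<noteq> 0" "val M i = m" by force
  have "nu I M = m" by (rule nu_eqI[OF i]) (use \<open>?P m\<close> in blast)
  then show "\<exists>i\<in>I. i \<noteq> 0 \<and> val M i = nu I M" "\<And>i. i \<in> I \<Longrightarrow> i \<noteq> 0 \<Longrightarrow> nu I M \<le> val M i"
    using i \<open>?P m\<close> by blast+
qed

text \<open>Local-global principle: the ideal of all r with r * x in I lies in no maximal ideal,
  because at each M division by an element of I of minimal value leaves a denominator outside
  M.\<close>

lemma mem_frac_iff:
  fixes I :: "'a fract set" assumes I: "frac_ideal I"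
  shows "x \<in> I \<longleftrightarrow> x = 0 \<or> (\<forall>M\<in>Max_spec. nu I M \<le> val M x)"
proof
  assume "x \<in> I" then show "x = 0 \<or> (\<forall>M\<in>Max_spec. nu I M \<le> val M x)" using nu_props(2)[OF I] by blast
next
  note m = frac_idealD(1)[OF I]
  assume *: "x = 0 \<or> (\<forall>M\<in>Max_spec. nu I M \<le> val M x)"
  show "x \<in> I"
  proof (cases "x = 0")
    case True then show ?thesis using is_submoduleD(1)[OF m] by simp
  next
    case x0: False
    let ?J = "{r. emb r * x \<in> I}"
    have "emb r * (emb b * x) \<in> I" if "emb b * x \<in> I" for r b
      by (rule is_submoduleD(3)[OF m emb_Rfr that])
    then have "is_ideal ?J" unfolding is_ideal_def
      using is_submoduleD(1,2)[OF m] by (auto simp: distrib_right mult.assoc)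
    moreover have "\<not> ?J \<subseteq> M" if M: "M \<in> Max_spec" for M
    proof -
      obtain i where i: "i \<in> I" "i \<noteq> 0" "val M i = nu I M" using nu_props(1)[OF I M] by blast
      have "val M (x * inverse i) = val M x - nu I M"
        using val_mult[OF sp M x0, of "inverse i"] val_inverse[OF sp M i(2)] i by simp
      moreover have "nu I M \<le> val M x" using * x0 M by blast
      ultimately have "x * inverse i \<in> loc M" using val_nonneg_iff(1)[OF sp M, of "x * inverse i"] x0 i by simp
      then obtain a s where as: "s \<notin> M" "x * inverse i = emb a / emb s" unfolding loc_def Fract_emb by blast
      have "s \<noteq> 0" using as(1) is_idealD(1)[OF Max_spec_ideal(1)[OF M]] by auto
      then have "emb s * x = emb a * i" using as(2) i(2) by (simp add: field_simps)
      then have "s \<in> ?J" using is_submoduleD(3)[OF m emb_Rfr i(1)] by simp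
      then show ?thesis using as(1) by blast
    qed
    ultimately have "?J = UNIV" using exists_maximal[of ?J] by blast
    then have "emb 1 * x \<in> I" by blast
    then show ?thesis by simp
  qed
qed

lemma nu_Rfr: assumes M: "M \<in> (Max_spec :: 'a set set)" shows "nu Rfr M = 0"
  by (rule nu_eqI[of 1]) (use is_subringD(2)[OF Rfr_is_subring] val_one[OF sp M] val_Rfr[OF M] in auto)

lemma Rfr_iff: "x \<in> Rfr \<longleftrightarrow> x = 0 \<or> (\<forall>M\<in>(Max_spec :: 'a set set). 0 \<le> val M x)"
  using mem_frac_iff[OF frac_ideal_Rfr, of x] nu_Rfr by auto

lemma frac_ideal_eqI:
  fixes I J :: "'a fract set"
  assumes "frac_ideal I" "frac_ideal J" "\<And>M. M \<in> Max_spec \<Longrightarrow> nu I M = nu J M" shows "I = J"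
  using mem_frac_iff[OF assms(1)] mem_frac_iff[OF assms(2)] assms(3) by (metis (no_types, lifting) subsetI subset_antisym)

lemma val_ge_addc:
  assumes M: "M \<in> (Max_spec :: 'a set set)" shows "add_closed {z. z = 0 \<or> k \<le> val M z}"
  unfolding add_closed_def
proof (intro conjI ballI)
  fix x y assume *: "x \<in> {z. z = 0 \<or> k \<le> val M z}" "y \<in> {z. z = 0 \<or> k \<le> val M z}"
  show "x + y \<in> {z. z = 0 \<or> k \<le> val M z}"
  proof (cases "x = 0 \<or> y = 0 \<or> x + y = 0")
    case False then show ?thesis using val_add[OF sp M, of x y k] * by auto
  qed (use * in auto)
qed simp

lemma nu_iprod:
  fixes I J :: "'a fract set" assumes I: "frac_ideal I" and J: "frac_ideal J" and M: "M \<in> Max_spec"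
  shows "nu (iprod I J) M = nu I M + nu J M"
proof -
  obtain i where i: "i \<in> I" "i \<noteq> 0" "val M i = nu I M" using nu_props(1)[OF I M] by blast
  obtain j where j: "j \<in> J" "j \<noteq> 0" "val M j = nu J M" using nu_props(1)[OF J M] by blast
  have "iprod I J \<subseteq> {z. z = 0 \<or> nu I M + nu J M \<le> val M z}"
  proof (rule iprod_least[OF val_ge_addc[OF M]])
    fix x y assume xy: "x \<in> I" "y \<in> J"
    show "x * y \<in> {z. z = 0 \<or> nu I M + nu J M \<le> val M z}"
    proof (cases "x = 0 \<or> y = 0")
      case False
      then show ?thesis using nu_props(2)[OF I M xy(1)] nu_props(2)[OF J M xy(2)] val_mult[OF sp M, of x y] by auto
    qed auto
  qed
  then show ?thesis
    by (intro nu_eqI[of "i * j"]) (use iprod_mem[OF i(1) j(1)] i j val_mult[OF sp M i(2) j(2)] in auto)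
qed

lemma nu_cyclic_mod: assumes M: "M \<in> Max_spec" and a: "a \<noteq> (0 :: 'a fract)" shows "nu (cyclic_mod Rfr a) M = val M a"
proof (rule nu_eqI[OF cyclic_mod_self[OF Rfr_is_subring] a refl])
  fix i assume "i \<in> cyclic_mod Rfr a" "i \<noteq> 0"
  then obtain r where r: "r \<in> Rfr" "i = a * r" "r \<noteq> 0" unfolding cyclic_mod_def by auto
  then show "val M a \<le> val M i" using val_mult[OF sp M a r(3)] val_Rfr[OF M r(1,3)] by simp
qed

text \<open>At an M containing J, take a of value 1. A power of a has the value of f, so up to a
  factor t outside M it is a multiple of f and lies in J; radicality then puts t * a, still of value
  1, into J.\<close>

lemma nu_radical:
  fixes J :: "'a set" assumes J: "radical_ideal J" "f \<in> J" "f \<noteq> 0" and M: "M \<in> Max_spec"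
  shows "nu (emb ` J) M = (if J \<subseteq> M then 1 else 0)"
proof (cases "J \<subseteq> M")
  case False
  then obtain x where x: "x \<in> J" "x \<notin> M" by blast
  have x0: "x \<noteq> 0" using x is_idealD(1)[OF Max_spec_ideal(1)[OF M]] by auto
  then have "val M (emb x) = 0" using val_emb[OF sp M x0] x(2) by simp
  then have "nu (emb ` J) M = 0"
    by (intro nu_eqI[of "emb x"]) (use x x0 val_emb(1)[OF sp M] in auto)
  then show ?thesis using False by simp
next
  case True
  have I: "is_ideal J" using J unfolding radical_ideal_def by blast
  obtain x :: "'a fract" where x: "x \<noteq> 0" "val M x = 1" using val_surj[OF sp M] by metis
  then have "x \<in> loc M" using val_nonneg_iff(1)[OF sp M x(1)] by simp
  then obtain a s where as: "s \<notin> M" "x = emb a / emb s" unfolding loc_def Fract_emb by blast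
  have s0: "s \<noteq> 0" and sv: "val M (emb s) = 0"
  proof -
    show "s \<noteq> 0" using as(1) is_idealD(1)[OF Max_spec_ideal(1)[OF M]] by auto
    then show "val M (emb s) = 0" using val_emb[OF sp M, of s] as(1) by simp
  qed
  have a0: "a \<noteq> 0" using x(1) as(2) by auto
  have xs: "x * emb s = emb a" using as(2) s0 by simp
  have va: "val M (emb a) = 1" using val_mult[OF sp M x(1), of "emb s"] s0 sv x(2) unfolding xs by simp
  have powv: "val M (emb a ^ n) = int n" for n :: nat
    by (induction n) (use a0 va val_mult[OF sp M] val_one[OF sp M] in auto)
  define n where "n = nat (val M (emb f))"
  have n: "val M (emb f) = int n" using val_emb(1)[OF sp M J(3)] n_def by simp
  have "val M (emb a ^ n * inverse (emb f)) = 0"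
    using val_mult[OF sp M, of "emb a ^ n" "inverse (emb f)"] val_inverse[OF sp M, of "emb f"] powv n a0 J(3) by simp
  then have "emb a ^ n * inverse (emb f) \<in> loc M"
    using val_nonneg_iff(1)[OF sp M, of "emb a ^ n * inverse (emb f)"] a0 J(3) by simp
  then obtain b t where bt: "t \<notin> M" "emb a ^ n * inverse (emb f) = emb b / emb t" unfolding loc_def Fract_emb by blast
  have t0: "t \<noteq> 0" using bt(1) is_idealD(1)[OF Max_spec_ideal(1)[OF M]] by auto
  then have "emb t * emb a ^ n = emb b * emb f" using bt(2) J(3) by (simp add: field_simps)
  then have "emb (t * a ^ n) = emb (b * f)" by simp
  then have eq: "t * a ^ n = b * f" by (rule injD[OF emb_inj])
  have "(t * a) ^ n * t = t ^ n * (b * f)" unfolding eq[symmetric] power_mult_distrib by (simp only: mult_ac)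
  then have "(t * a) ^ n * t \<in> J" using is_idealD(3)[OF I J(2)] by (metis mult.assoc)
  \<comment> \<open>One more factor a completes the power with exponent n + 1, without a case
    distinction on n.\<close>
  then have "a * ((t * a) ^ n * t) \<in> J" by (rule is_idealD(3)[OF I])
  then have "(t * a) ^ Suc n \<in> J" by (simp add: mult_ac)
  then have ta: "t * a \<in> J" using J(1) unfolding radical_ideal_def by blast
  have "val M (emb t) = 0" using val_emb[OF sp M t0] bt(1) by simp
  then have "val M (emb (t * a)) = 1" using val_mult[OF sp M, of "emb t" "emb a"] va t0 a0 by simp
  moreover have "1 \<le> val M (emb y)" if "y \<in> J" "y \<noteq> 0" for y
    using val_emb(2)[OF sp M that(2)] True that(1) by auto
  ultimately have "nu (emb ` J) M = 1"
    by (intro nu_eqI[OF imageI[OF ta]]) (use t0 a0 in auto)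
  then show ?thesis using True by simp
qed

text \<open>Write a as a finite sum of products x * y with x from a finite subset F of J. For m in J
  each m * y lies in (a), so m * a lies in a M whenever M contains F, and m is in M. Hence V(J) =
  V(F), which is open.\<close>

lemma radical_factor_Cc:
  fixes J :: "'a set"
  assumes J: "radical_ideal J" "iprod (emb ` J) B = cyclic_mod Rfr (emb a)" "a \<noteq> 0" "a \<in> J"
  shows "(\<lambda>M. if M \<in> Max_spec then nu (emb ` J) M else 0) \<in> Cc max_top"
proof -
  let ?V = "{M \<in> Max_spec. J \<subseteq> M}"
  have "emb a \<in> iprod (emb ` J) B" using cyclic_mod_self[OF Rfr_is_subring] J(2) by blast
  from iprod_finite[OF this] obtain F' where F': "finite F'" "F' \<subseteq> emb ` J" "emb a \<in> iprod F' B" by (elim exE conjE)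
  then obtain F where F: "finite F" "F \<subseteq> J" "F' = emb ` F" by (meson finite_subset_image)
  have sub: "J \<subseteq> M" if M: "M \<in> Max_spec" "F \<subseteq> M" for M
  proof
    fix m assume m: "m \<in> J"
    have mM: "is_submodule Rfr (emb ` M)" by (rule is_submodule_emb[OF Max_spec_ideal(1)[OF M(1)]])
    have "add_closed {z. emb m * z \<in> (*) (emb a) ` (emb ` M)}"
      by (intro add_closed_vimage add_closed_scale is_submodule_addc[OF mM])
    then have "iprod F' B \<subseteq> {z. emb m * z \<in> (*) (emb a) ` (emb ` M)}"
    proof (rule iprod_least)
      fix x y assume xy: "x \<in> F'" "y \<in> B"
      have "emb m * y \<in> cyclic_mod Rfr (emb a)" using iprod_mem[OF imageI[OF m] xy(2)] J(2) by blast
      then obtain r where r: "r \<in> Rfr" "emb m * y = emb a * r" unfolding cyclic_mod_def by blast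
      have "emb m * (x * y) = x * (emb m * y)" by (simp only: mult_ac)
      also have "\<dots> = emb a * (x * r)" unfolding r(2) by (simp only: mult_ac)
      finally have e: "emb m * (x * y) = emb a * (x * r)" .
      have "x \<in> emb ` M" using subsetD[OF image_mono[OF M(2), of emb], of x] xy(1) F(3) by simp
      then have "x * r \<in> emb ` M" by (rule is_submoduleD(4)[OF mM r(1)])
      then show "x * y \<in> {z. emb m * z \<in> (*) (emb a) ` (emb ` M)}"
        unfolding mem_Collect_eq e by (rule imageI)
    qed
    then have "emb m * emb a \<in> (*) (emb a) ` (emb ` M)" using F'(3) by blast
    then obtain p where p: "p \<in> M" "emb m * emb a = emb a * emb p" by (elim imageE) simp
    then have "emb a * emb m = emb a * emb p" by (simp only: mult.commute)
    then have "m = p" using J(3) by simp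
    then show "m \<in> M" using p(1) by simp
  qed
  have "?V = {M \<in> Max_spec. F \<subseteq> M}" using sub order_trans[OF F(2)] by (intro Collect_cong) metis
  then have "openin max_top ?V" using openin_max_top_V[OF F(1)] by simp
  moreover have "compactin max_top ?V"
    by (rule closed_compactin[OF compactin_max_top_V[OF sp J(3)] _ closedin_max_top_V]) (use J(4) in auto)
  ultimately have "char_fn ?V \<in> Cc max_top" by (rule Cc_char_fn[OF Hausdorff_max_top])
  moreover have "(\<lambda>M. if M \<in> Max_spec then nu (emb ` J) M else 0) = char_fn ?V"
    using nu_radical[OF J(1,4,3)] by (auto simp: char_fn_def fun_eq_iff)
  ultimately show ?thesis by simp
qed

text \<open>\<open>nu\<close> is additive on products, and each radical factor of (a) contributes a
  characteristic function of a compact open set.\<close>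

lemma val_fun_emb_Cc: assumes a: "a \<noteq> (0 :: 'a)" shows "val_fun (emb a) \<in> Cc max_top"
proof (cases "inverse (emb a) \<in> Rfr")
  case True
  have "val M (emb a) = 0" if M: "M \<in> Max_spec" for M
    using val_Rfr[OF M True] val_inverse[OF sp M, of "emb a"] val_emb(1)[OF sp M a] a by simp
  then have "val_fun (emb a) = (\<lambda>M. 0)" by (auto simp: val_fun_def)
  then show ?thesis using Cc_zero by simp
next
  case False
  obtain Js where Js: "\<And>J. J \<in> set Js \<Longrightarrow> radical_in Rfr J" "cyclic_mod Rfr (emb a) = iprod_list Rfr Js"
    using SP_subring_cyc[OF SP_domain_SP_subring[OF sp] Rfr_is_subring _ False emb_Rfr] a by auto
  have Jm: "is_submodule Rfr J \<and> J \<subseteq> Rfr" if "J \<in> set Js" for J using Js(1)[OF that] radical_in_modl by blast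
  have J1: "frac_ideal J \<and> (\<lambda>M. if M \<in> Max_spec then nu J M else 0) \<in> Cc max_top" if J: "J \<in> set Js" for J
  proof -
    let ?J = "{x. emb x \<in> J}"
    have eJ: "emb ` ?J = J" by (rule emb_preimage) (use Jm[OF J] in blast)
    have "is_ideal ?J" by (rule is_ideal_preimage) (use Jm[OF J] in blast)
    then have rad: "radical_ideal ?J" unfolding radical_ideal_def
      using Js(1)[OF J] emb_Rfr unfolding radical_in_def by auto
    have aJ: "emb a \<in> J" using iprod_list_sub[OF Rfr_is_subring Jm J] Js(2) cyclic_mod_self[OF Rfr_is_subring] by blast
    obtain xs ys where "Js = xs @ J # ys" using J split_list by metis
    then have "iprod (emb ` ?J) (iprod_list Rfr (xs @ ys)) = cyclic_mod Rfr (emb a)" unfolding eJ using Js(2) iprod_list_split by metis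
    then have "(\<lambda>M. if M \<in> Max_spec then nu (emb ` ?J) M else 0) \<in> Cc max_top"
      by (rule radical_factor_Cc[OF rad _ a]) (use aJ in simp)
    moreover have "frac_ideal J"
      by (rule frac_idealI[of J "emb a" 1]) (use Jm[OF J] aJ a in auto)
    ultimately show ?thesis unfolding eJ by blast
  qed
  have "frac_ideal (iprod_list Rfr Ls) \<and> (\<lambda>M. if M \<in> Max_spec then nu (iprod_list Rfr Ls) M else 0) \<in> Cc max_top"
    if "set Ls \<subseteq> set Js" for Ls
    using that
  proof (induction Ls)
    case Nil
    have "(\<lambda>M. if M \<in> Max_spec then nu (Rfr :: 'a fract set) M else 0) = (\<lambda>M. 0)" using nu_Rfr by auto
    moreover have "iprod_list Rfr [] = (Rfr :: 'a fract set)" by (simp add: iprod_list_def)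
    ultimately show ?case using frac_ideal_Rfr Cc_zero[of max_top] by metis
  next
    case (Cons J Ls)
    then have IH: "frac_ideal (iprod_list Rfr Ls)" "(\<lambda>M. if M \<in> Max_spec then nu (iprod_list Rfr Ls) M else 0) \<in> Cc max_top"
      and J: "J \<in> set Js" by auto
    have "(\<lambda>M. if M \<in> Max_spec then nu (iprod_list Rfr (J # Ls)) M else 0) =
      (\<lambda>M. (if M \<in> Max_spec then nu J M else 0) + (if M \<in> Max_spec then nu (iprod_list Rfr Ls) M else 0))"
      using nu_iprod[OF conjunct1[OF J1[OF J]] IH(1)] by (auto simp: iprod_list_Cons)
    then show ?case
      using Cc_add[OF Hausdorff_max_top conjunct2[OF J1[OF J]] IH(2)] frac_ideal_iprod[OF conjunct1[OF J1[OF J]] IH(1)]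
      by (simp add: iprod_list_Cons)
  qed
  from this[of Js] have "(\<lambda>M. if M \<in> Max_spec then nu (cyclic_mod Rfr (emb a)) M else 0) \<in> Cc max_top"
    unfolding Js(2) by blast
  moreover have "(\<lambda>M. if M \<in> Max_spec then nu (cyclic_mod Rfr (emb a)) M else 0) = val_fun (emb a)"
    using nu_cyclic_mod a by (auto simp: val_fun_def)
  ultimately show ?thesis by simp
qed

lemma val_fun_Cc: assumes x: "x \<noteq> (0 :: 'a fract)" shows "val_fun x \<in> Cc max_top"
proof -
  obtain a b where ab: "x = emb a / emb b" "b \<noteq> 0" by (rule fract_emb_cases)
  have a: "a \<noteq> 0" using x ab by auto
  have "val M x = val M (emb a) - val M (emb b)" if M: "M \<in> Max_spec" for M
    using val_mult[OF sp M, of "emb a" "inverse (emb b)"] val_inverse[OF sp M, of "emb b"] a ab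
    by (simp add: divide_inverse)
  then have "val_fun x = (\<lambda>M. val_fun (emb a) M - val_fun (emb b) M)" by (auto simp: val_fun_def)
  then show ?thesis using Cc_diff[OF Hausdorff_max_top val_fun_emb_Cc[OF a] val_fun_emb_Cc[OF ab(2)]] by simp
qed

text \<open>Where f is positive, N differs from M, so some x in N outside M has a power of value at
  least f near N. Compactness leaves finitely many such powers; their product works and stays
  outside the prime M.\<close>

lemma Cc_approx:
  assumes f: "f \<in> Cc max_top" and M: "M \<in> (Max_spec :: 'a set set)" "f M \<le> 0"
  shows "\<exists>r. r \<notin> M \<and> (\<forall>N\<in>Max_spec. f N \<le> val N (emb r))"
proof -
  have nz: "r \<noteq> 0" if "r \<notin> M" for r using that is_idealD(1)[OF Max_spec_ideal(1)[OF M(1)]] by auto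
  define G where "G = {U. openin max_top U \<and> (\<exists>r. r \<notin> M \<and> (\<forall>P\<in>U. P \<in> Max_spec \<and> f P \<le> val P (emb r)))}"
  let ?K = "{N \<in> topspace max_top. f N \<in> {0<..}}"
  have K: "compactin max_top ?K" by (rule Cc_fibers(3)[OF Hausdorff_max_top f]) simp
  have "?K \<subseteq> \<Union>G"
  proof
    fix N assume N: "N \<in> ?K"
    then have NM: "N \<in> Max_spec" "f N > 0" by (auto simp: topspace_max_top)
    then have "\<not> N \<subseteq> M" using Max_spec_incomparable[OF NM(1) M(1)] M(2) by auto
    then obtain x where x: "x \<in> N" "x \<notin> M" by blast
    let ?U = "{P \<in> Max_spec. {x} \<subseteq> P} \<inter> {P \<in> topspace max_top. f P \<in> {f N}}"
    let ?r = "x ^ nat (f N)"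
    have pM: "x ^ n \<notin> M" for n :: nat
      by (induction n) (use Max_spec_ideal(2)[OF M(1)] Max_spec_prime[OF M(1)] x in auto)
    have "f P \<le> val P (emb ?r)" if P: "P \<in> ?U" for P
    proof -
      have P': "P \<in> Max_spec" "x \<in> P" "f P = f N" using P by auto
      have v1: "1 \<le> val P (emb x)" using val_emb(2)[OF sp P'(1) nz[OF x(2)]] P'(2) by simp
      have "int n \<le> val P (emb (x ^ n))" for n :: nat
      proof (induction n)
        case (Suc n)
        have "val P (emb (x ^ Suc n)) = val P (emb x) + val P (emb (x ^ n))"
          using val_mult[OF sp P'(1), of "emb x" "emb (x ^ n)"] nz[OF x(2)] by simp
        then show ?case using Suc v1 by simp
      qed (use val_one[OF sp P'(1)] in simp)
      from this[of "nat (f N)"] show ?thesis using P'(3) NM(2) by simp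
    qed
    moreover have "openin max_top ?U" by (intro openin_Int openin_max_top_V Cc_fibers(1)[OF Hausdorff_max_top f]) simp
    moreover have "N \<in> ?U" using NM x by (simp add: topspace_max_top)
    ultimately show "N \<in> \<Union>G" using pM unfolding G_def by blast
  qed
  moreover have "\<forall>U\<in>G. openin max_top U" unfolding G_def by blast
  ultimately obtain \<F> where \<F>: "finite \<F>" "\<F> \<subseteq> G" "?K \<subseteq> \<Union>\<F>" using K unfolding compactin_def by meson
  have "\<exists>r. r \<notin> M \<and> (\<forall>P\<in>\<Union>\<F>. P \<in> Max_spec \<and> f P \<le> val P (emb r))"
    using \<F>(1,2)
  proof (induction \<F>)
    case empty then show ?case using Max_spec_ideal(2)[OF M(1)] by blast
  next
    case (insert U \<F>)
    then obtain r where r: "r \<notin> M" "\<forall>P\<in>\<Union>\<F>. P \<in> Max_spec \<and> f P \<le> val P (emb r)" by auto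
    obtain s where s: "s \<notin> M" "\<forall>P\<in>U. P \<in> Max_spec \<and> f P \<le> val P (emb s)" using insert.prems unfolding G_def by auto
    have "r * s \<notin> M" using Max_spec_prime[OF M(1)] r(1) s(1) by blast
    moreover have "f P \<le> val P (emb (r * s))" if P: "P \<in> Max_spec" "f P \<le> val P (emb r) \<or> f P \<le> val P (emb s)" for P
      using val_mult[OF sp P(1), of "emb r" "emb s"] val_emb(1)[OF sp P(1) nz[OF r(1)]]
        val_emb(1)[OF sp P(1) nz[OF s(1)]] nz[OF r(1)] nz[OF s(1)] P(2) by auto
    ultimately show ?case using r(2) s(2) by (intro exI[of _ "r * s"]) auto
  qed
  then obtain r where r: "r \<notin> M" "\<forall>P\<in>\<Union>\<F>. P \<in> Max_spec \<and> f P \<le> val P (emb r)" by blast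
  have "f N \<le> val N (emb r)" if N: "N \<in> Max_spec" for N
  proof (cases "f N > 0")
    case True
    then have "N \<in> ?K" using N by (simp add: topspace_max_top)
    then show ?thesis using \<F>(3) r(2) by blast
  next
    case False then show ?thesis using val_emb(1)[OF sp N nz[OF r(1)]] by simp
  qed
  then show ?thesis using r(1) by blast
qed

text \<open>Dividing by an element t with the prescribed value at M reduces the claim to a function
  vanishing at M; the element outside M supplied by \<open>Cc_approx\<close> does not change the
  value there.\<close>

lemma Cc_realize:
  assumes g: "g \<in> Cc max_top" and M: "M \<in> (Max_spec :: 'a set set)"
  shows "\<exists>x. x \<noteq> 0 \<and> val M x = g M \<and> (\<forall>N\<in>Max_spec. g N \<le> val N x)"
proof -
  obtain t :: "'a fract" where t: "t \<noteq> 0" "val M t = g M" using val_surj[OF sp M] by metis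
  have "(\<lambda>N. g N - val_fun t N) \<in> Cc max_top" by (rule Cc_diff[OF Hausdorff_max_top g val_fun_Cc[OF t(1)]])
  then obtain r where r: "r \<notin> M" "\<forall>N\<in>Max_spec. g N - val_fun t N \<le> val N (emb r)"
    using Cc_approx[of "\<lambda>N. g N - val_fun t N" M] M t(2) by (auto simp: val_fun_def)
  have r0: "r \<noteq> 0" using r(1) is_idealD(1)[OF Max_spec_ideal(1)[OF M]] by auto
  have "val M (emb r) = 0" using val_emb[OF sp M r0] r(1) by simp
  then have "val M (t * emb r) = g M" using val_mult[OF sp M t(1), of "emb r"] t(2) r0 by simp
  moreover have "g N \<le> val N (t * emb r)" if N: "N \<in> Max_spec" for N
    using val_mult[OF sp N t(1), of "emb r"] r(2) r0 N by (auto simp: val_fun_def)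
  ultimately show ?thesis using t(1) r0 by (intro exI[of _ "t * emb r"]) auto
qed

lemma Max_spec_ex: "\<exists>M. M \<in> (Max_spec :: 'a set set)"
proof -
  have "is_ideal {0 :: 'a}" unfolding is_ideal_def by auto
  moreover have "{0 :: 'a} \<noteq> UNIV" by (metis UNIV_I singletonD zero_neq_one)
  ultimately show ?thesis using exists_maximal by blast
qed

text \<open>Set-valued bounds S cover both \<open>ideal_above\<close>, with one bound for each M,
  and \<open>cover_ideal\<close>, where all values of \<phi> on the fibre over M are bounds.\<close>

lemma val_ge_modl:
  fixes S :: "'a set \<Rightarrow> int set"
  shows "is_submodule Rfr {x. x = 0 \<or> (\<forall>M\<in>Max_spec. \<forall>k\<in>S M. k \<le> val M x)}"
  unfolding is_submodule_def
proof (intro conjI ballI)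
  let ?D = "{x. x = 0 \<or> (\<forall>M\<in>Max_spec. \<forall>k\<in>S M. k \<le> val M x)}"
  show "add_closed ?D" unfolding add_closed_def
  proof (intro conjI ballI)
    fix x y assume xy: "x \<in> ?D" "y \<in> ?D"
    have "k \<le> val M (x + y)" if "M \<in> Max_spec" "k \<in> S M" "x \<noteq> 0" "y \<noteq> 0" "x + y \<noteq> 0" for M k
      by (rule val_add[OF sp that(1,3-5)]) (use that xy in auto)
    then show "x + y \<in> ?D" using xy by (cases "x = 0"; cases "y = 0") auto
  qed simp
  fix r x :: "'a fract" assume r: "r \<in> Rfr" and x: "x \<in> ?D"
  show "r * x \<in> ?D"
  proof (cases "r = 0 \<or> x = 0")
    case False
    have "k \<le> val M (r * x)" if "M \<in> Max_spec" "k \<in> S M" for M k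
      using val_mult[OF sp that(1), of r x] val_Rfr[OF that(1) r] False x that by fastforce
    then show ?thesis by blast
  qed auto
qed

text \<open>Realizing g gives a nonzero member, and realizing -g gives a y that multiplies the ideal
  into R; the numerator of y is a common denominator.\<close>

lemma frac_ideal_ideal_above:
  assumes g: "g \<in> Cc max_top" shows "frac_ideal (ideal_above g :: 'a fract set)"
proof -
  obtain M :: "'a set" where M: "M \<in> Max_spec" using Max_spec_ex by blast
  obtain x where x: "x \<noteq> 0" "\<forall>N\<in>Max_spec. g N \<le> val N x" using Cc_realize[OF g M] by blast
  obtain y where y: "y \<noteq> 0" "\<forall>N\<in>Max_spec. - g N \<le> val N y"
    using Cc_realize[OF Cc_uminus[OF Hausdorff_max_top g] M] by blast
  obtain a b where ab: "y = emb a / emb b" "b \<noteq> 0" by (rule fract_emb_cases)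
  have a0: "a \<noteq> 0" using y ab by auto
  have "emb a * z \<in> Rfr" if z: "z \<in> ideal_above g" for z
  proof -
    have "y * z \<in> Rfr"
    proof (cases "z = 0")
      case False
      then have "\<forall>N\<in>Max_spec. 0 \<le> val N (y * z)" using val_mult[OF sp _ y(1), of _ z] y(2) z unfolding ideal_above_def by fastforce
      then show ?thesis using Rfr_iff by blast
    qed (simp add: is_subringD(1)[OF Rfr_is_subring])
    then have "emb b * (y * z) \<in> Rfr" using is_subringD(4)[OF Rfr_is_subring emb_Rfr] by blast
    then show ?thesis using ab by simp
  qed
  moreover have "is_submodule Rfr (ideal_above g :: 'a fract set)" using val_ge_modl[of "\<lambda>M. {g M}"] unfolding ideal_above_def by simp
  moreover have "x \<in> ideal_above g" using x unfolding ideal_above_def by blast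
  ultimately show ?thesis using frac_idealI[of "ideal_above g" x a] x(1) a0 by blast
qed

lemma nu_ideal_above:
  assumes g: "g \<in> Cc max_top" and M: "M \<in> Max_spec" shows "nu (ideal_above g :: 'a fract set) M = g M"
proof -
  obtain x where x: "x \<noteq> 0" "val M x = g M" "\<forall>N\<in>Max_spec. g N \<le> val N x" using Cc_realize[OF g M] by blast
  show ?thesis by (rule nu_eqI[of x]) (use x M in \<open>auto simp: ideal_above_def\<close>)
qed

text \<open>An infimum of locally constant functions is upper semicontinuous. Applied to an ideal
  and its inverse this becomes continuity.\<close>

lemma nu_usc:
  fixes I :: "'a fract set" assumes I: "frac_ideal I" shows "openin max_top {M \<in> Max_spec. nu I M < c}"
proof -
  have "{M \<in> Max_spec. nu I M < c} = \<Union>((\<lambda>i. {M \<in> topspace max_top. val_fun i M \<in> {..<c}}) ` (I - {0}))"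
  proof (intro equalityI subsetI)
    fix M assume M: "M \<in> {M \<in> Max_spec. nu I M < c}"
    then obtain i where "i \<in> I" "i \<noteq> 0" "val M i = nu I M" using nu_props(1)[OF I] by blast
    then have "i \<in> I - {0}" "M \<in> {M \<in> topspace max_top. val_fun i M \<in> {..<c}}" using M
      by (auto simp: val_fun_def topspace_max_top)
    then show "M \<in> \<Union>((\<lambda>i. {M \<in> topspace max_top. val_fun i M \<in> {..<c}}) ` (I - {0}))" by blast
  next
    fix M assume "M \<in> \<Union>((\<lambda>i. {M \<in> topspace max_top. val_fun i M \<in> {..<c}}) ` (I - {0}))"
    then obtain i where "i \<in> I - {0}" "M \<in> {M \<in> topspace max_top. val_fun i M \<in> {..<c}}" by blast
    then have "i \<in> I" "i \<noteq> 0" "M \<in> Max_spec" "val M i < c" by (auto simp: val_fun_def topspace_max_top)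
    then show "M \<in> {M \<in> Max_spec. nu I M < c}" using nu_props(2)[OF I] by fastforce
  qed
  moreover have "openin max_top (\<Union>((\<lambda>i. {M \<in> topspace max_top. val_fun i M \<in> {..<c}}) ` (I - {0})))"
  proof (rule openin_Union, elim imageE DiffE)
    fix S i assume "i \<notin> {0 :: 'a fract}" and S: "S = {M \<in> topspace max_top. val_fun i M \<in> {..<c}}"
    then have "i \<noteq> 0" by simp
    then show "openin max_top S" unfolding S by (rule Cc_fibers(1)[OF Hausdorff_max_top val_fun_Cc])
  qed
  ultimately show ?thesis by simp
qed

lemma InvD:
  assumes "I \<in> (Inv :: 'a fract set set)"
  obtains J where "frac_ideal I" "frac_ideal J" "\<And>M. M \<in> Max_spec \<Longrightarrow> nu J M = - nu I M"
proof -
  obtain J where IJ: "frac_ideal I" "frac_ideal J" "iprod I J = Rfr"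
    using assms frac_mult_eq_iprod frac_idealD(1) unfolding Inv_def by blast
  have "nu J M = - nu I M" if M: "M \<in> Max_spec" for M
    using nu_iprod[OF IJ(1,2) M] nu_Rfr[OF M] IJ(3) by simp
  then show thesis using that IJ by blast
qed

text \<open>The inverse J has the negated value function, so semicontinuity holds on both sides.
  Elements i of I and k of J confine \<open>nu I\<close> between two functions of compact
  support.\<close>

lemma Psi_Cc: assumes I: "I \<in> (Inv :: 'a fract set set)" shows "Psi I \<in> Cc max_top"
proof -
  obtain J where J: "frac_ideal I" "frac_ideal J" "\<And>M. M \<in> Max_spec \<Longrightarrow> nu J M = - nu I M" using InvD[OF I] by metis
  obtain i where i: "i \<in> I" "i \<noteq> 0" using frac_idealD(2)[OF J(1)] by blast
  obtain k where k: "k \<in> J" "k \<noteq> 0" using frac_idealD(2)[OF J(2)] by blast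
  show ?thesis unfolding Cc_iff[OF Hausdorff_max_top]
  proof (intro conjI allI impI)
    fix c
    \<comment> \<open>Over the integers nu I < c + 1 and -nu I < -c + 1 together mean nu I =
      c.\<close>
    have "{M \<in> topspace max_top. Psi I M = c} = {M \<in> Max_spec. nu I M < c + 1} \<inter> {M \<in> Max_spec. nu J M < - c + 1}"
      using J(3) by (auto simp: topspace_max_top Psi_def)
    then show "openin max_top {M \<in> topspace max_top. Psi I M = c}"
      using openin_Int[OF nu_usc[OF J(1), of "c + 1"] nu_usc[OF J(2), of "- c + 1"]] by metis
  next
    let ?K = "{M \<in> topspace max_top. val_fun i M \<in> - {0}} \<union> {M \<in> topspace max_top. val_fun k M \<in> - {0}}"
    have "compactin max_top ?K"
      by (intro compactin_Un Cc_fibers(3)[OF Hausdorff_max_top] val_fun_Cc i k) auto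
    moreover have "{M \<in> topspace max_top. Psi I M \<noteq> 0} \<subseteq> ?K"
    proof
      fix M assume "M \<in> {M \<in> topspace max_top. Psi I M \<noteq> 0}"
      then have M: "M \<in> Max_spec" "nu I M \<noteq> 0" by (auto simp: topspace_max_top Psi_def)
      have "nu I M \<le> val M i" "- nu I M \<le> val M k"
        using nu_props(2)[OF J(1) M(1) i] nu_props(2)[OF J(2) M(1) k] J(3)[OF M(1)] by auto
      then show "M \<in> ?K" using M by (auto simp: topspace_max_top val_fun_def)
    qed
    ultimately show "\<exists>K. compactin max_top K \<and> {M \<in> topspace max_top. Psi I M \<noteq> 0} \<subseteq> K" by blast
  qed (auto simp: Psi_def topspace_max_top)
qed

lemma Inv_eq_ideal_above: assumes "I \<in> (Inv :: 'a fract set set)" shows "ideal_above (Psi I) = I"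
proof -
  have I: "frac_ideal I" using assms unfolding Inv_def by blast
  show ?thesis using mem_frac_iff[OF I] unfolding ideal_above_def Psi_def by auto
qed

lemma ideal_above_Inv: assumes g: "g \<in> Cc max_top" shows "ideal_above g \<in> (Inv :: 'a fract set set)" "Psi (ideal_above g :: 'a fract set) = g"
proof -
  have g': "(\<lambda>x. - g x) \<in> Cc max_top" by (rule Cc_uminus[OF Hausdorff_max_top g])
  let ?I = "ideal_above g :: 'a fract set" and ?J = "ideal_above (\<lambda>x. - g x) :: 'a fract set"
  have fI: "frac_ideal ?I" "frac_ideal ?J" using frac_ideal_ideal_above g g' by auto
  have "iprod ?I ?J = Rfr"
    by (rule frac_ideal_eqI[OF frac_ideal_iprod[OF fI] frac_ideal_Rfr])
      (use nu_iprod[OF fI] nu_ideal_above[OF g] nu_ideal_above[OF g'] nu_Rfr in simp)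
  then show "?I \<in> Inv" using fI frac_mult_eq_iprod[OF frac_idealD(1)[OF fI(1)]] unfolding Inv_def by auto
  show "Psi ?I = g" using nu_ideal_above[OF g] Cc_outside[OF g] by (auto simp: Psi_def fun_eq_iff topspace_max_top)
qed

lemma Psi_iso: "Psi \<in> iso (InvG :: 'a fract set monoid) (CcG inverse_topology_Max)"
proof -
  have "Psi (frac_mult I J) = (\<lambda>x. Psi I x + Psi J x)" if "I \<in> Inv" "J \<in> Inv" for I J :: "'a fract set"
  proof -
    have f: "frac_ideal I" "frac_ideal J" using that unfolding Inv_def by auto
    show ?thesis unfolding frac_mult_eq_iprod[OF frac_idealD(1)[OF f(1)]]
      using nu_iprod[OF f] by (auto simp: Psi_def)
  qed
  moreover have "bij_betw Psi (Inv :: 'a fract set set) (Cc max_top)"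
    by (rule bij_betw_byWitness[of _ ideal_above]) (use Inv_eq_ideal_above ideal_above_Inv Psi_Cc in auto)
  ultimately show ?thesis unfolding iso_def hom_def InvG_def CcG_def using Psi_Cc by auto
qed

end

section \<open>Divisorial ideals and the Gleason cover\<close>

definition cover_ideal :: "'e topology \<Rightarrow> ('e \<Rightarrow> 'a::idom set) \<Rightarrow> ('e \<Rightarrow> int) \<Rightarrow> 'a fract set" where
  "cover_ideal E j \<phi> = {x. x = 0 \<or> (\<forall>e\<in>topspace E. \<phi> e \<le> val (j e) x)}"

text \<open>The identity (R : IJ) = ((R : J) : I), which gives access to the dual of a product
  without a description of the product.\<close>

lemma colon_iprod:
  fixes I J :: "'a::idom fract set"
  shows "y \<in> colon (iprod I J) \<longleftrightarrow> (\<forall>x\<in>I. x * y \<in> colon J)"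
proof
  assume "y \<in> colon (iprod I J)"
  then show "\<forall>x\<in>I. x * y \<in> colon J" unfolding colon_def using iprod_mem by (fastforce simp: mult_ac)
next
  assume *: "\<forall>x\<in>I. x * y \<in> colon J"
  have "iprod I J \<subseteq> {z. y * z \<in> Rfr}"
    by (rule iprod_least[OF add_closed_vimage[OF is_submodule_addc[OF is_subring_modl[OF Rfr_is_subring]]]])
      (use * in \<open>auto simp: colon_def mult_ac\<close>)
  then show "y \<in> colon (iprod I J)" unfolding colon_def by blast
qed

context
  fixes E :: "'e topology" and j :: "'e \<Rightarrow> 'a::idom set"
  assumes sp: "SP_domain TYPE('a)"
    and gl: "gleason_cover (inverse_topology_Max :: 'a set topology) E j"
begin

lemma cover_Hausdorff: "Hausdorff_space E" and cover_extremally_disconnected: "openin E U \<Longrightarrow> openin E (E closure_of U)"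
  and jcont: "continuous_map E max_top j" and jclosed: "closed_map E max_top j"
  and jproper: "proper_map E max_top j" and jsurj: "j ` topspace E = Max_spec"
  and jirr: "closedin E C \<Longrightarrow> C \<noteq> topspace E \<Longrightarrow> j ` C \<noteq> Max_spec"
  using gl unfolding gleason_cover_def extremally_disconnected_def perfect_map_def proper_map_def topspace_max_top
  by auto

lemma jMax: "e \<in> topspace E \<Longrightarrow> j e \<in> Max_spec"
  using jsurj by blast

lemma j_lift: "M \<in> Max_spec \<Longrightarrow> \<exists>e\<in>topspace E. j e = M"
  unfolding jsurj[symmetric] by auto

lemma psi_Cc: assumes w: "w \<in> Cc max_top" shows "psi E j w \<in> Cc E"
  unfolding Cc_iff[OF cover_Hausdorff]
proof (intro conjI allI impI)
  fix c
  have "{e \<in> topspace E. psi E j w e = c} = {e \<in> topspace E. j e \<in> {M \<in> topspace max_top. w M \<in> {c}}}"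
    using jMax by (auto simp: psi_def topspace_max_top)
  then show "openin E {e \<in> topspace E. psi E j w e = c}"
    using openin_continuous_map_preimage[OF jcont Cc_fibers(1)[OF Hausdorff_max_top w, of "{c}"]] by (simp only:)
next
  have "compactin E {e. e \<in> topspace E \<and> j e \<in> {M \<in> topspace max_top. w M \<in> - {0}}}"
    by (rule compactin_proper_map_preimage[OF jproper Cc_fibers(3)[OF Hausdorff_max_top w]]) simp
  then show "\<exists>K. compactin E K \<and> {e \<in> topspace E. psi E j w e \<noteq> 0} \<subseteq> K"
    by (rule exI[of _ "{e. e \<in> topspace E \<and> j e \<in> {M \<in> topspace max_top. w M \<in> - {0}}}", OF conjI])
      (use jMax in \<open>auto simp: psi_def topspace_max_top\<close>)
qed (simp add: psi_def)

text \<open>The image of the support of \<phi> is compact, hence inside a compact open set; a bound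
  of \<phi> times the characteristic function of that set dominates.\<close>

lemma Cc_dominate:
  assumes \<phi>: "\<phi> \<in> Cc E"
  shows "\<exists>w\<in>Cc max_top. \<forall>e\<in>topspace E. \<phi> e \<le> w (j e)"
proof -
  let ?S = "{e \<in> topspace E. \<phi> e \<in> - {0}}"
  have "compactin E ?S" by (rule Cc_fibers(3)[OF cover_Hausdorff \<phi>]) simp
  then have K: "compactin max_top (j ` ?S)" by (rule image_compactin[OF _ jcont])
  define G where "G = {V. openin max_top V \<and> compactin max_top (V :: 'a set set)}"
  have "j ` ?S \<subseteq> \<Union>G"
  proof
    fix M assume "M \<in> j ` ?S"
    then have "M \<in> topspace max_top" using jMax by (auto simp: topspace_max_top)
    then show "M \<in> \<Union>G" using compact_open_max_top_basis[OF sp openin_topspace, of M] unfolding G_def by blast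
  qed
  moreover have "\<forall>V\<in>G. openin max_top V" unfolding G_def by blast
  ultimately obtain \<F> where \<F>: "finite \<F>" "\<F> \<subseteq> G" "j ` ?S \<subseteq> \<Union>\<F>" using K unfolding compactin_def by meson
  have "openin max_top (\<Union>\<F>)" using \<F>(2) unfolding G_def by (intro openin_Union) auto
  moreover have "compactin max_top (\<Union>\<F>)" using \<F>(1,2) unfolding G_def by (intro compactin_Union) auto
  ultimately have 1: "char_fn (\<Union>\<F>) \<in> Cc max_top" by (rule Cc_char_fn[OF Hausdorff_max_top])
  obtain b where b: "b \<ge> 0" "\<forall>e. \<bar>\<phi> e\<bar> \<le> b" using Cc_bounded[OF cover_Hausdorff \<phi>] by blast
  have "\<phi> e \<le> b * char_fn (\<Union>\<F>) (j e)" if e: "e \<in> topspace E" for e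
  proof (cases "\<phi> e = 0")
    case True then show ?thesis using b(1) by (simp add: char_fn_def)
  next
    case False
    then have "j e \<in> \<Union>\<F>" using \<F>(3) e by blast
    then show ?thesis using b(2)[rule_format, of e] by (simp add: char_fn_def)
  qed
  then show ?thesis using Cc_cmul[OF Hausdorff_max_top 1, of b] by (intro bexI[of _ "\<lambda>M. b * char_fn (\<Union>\<F>) M"]) auto
qed

text \<open>Irreducibility of the cover: a nonempty open set of the cover contains the full preimage of a
  nonempty open set.\<close>

lemma Cc_separate:
  assumes \<phi>: "\<phi> \<in> Cc E" and O': "openin E O'" "O' \<noteq> {}" "\<And>e. e \<in> O' \<Longrightarrow> \<phi> e = c"
  shows "\<exists>w\<in>Cc max_top. (\<forall>e\<in>topspace E. \<phi> e \<le> w (j e)) \<and> (\<exists>e\<in>O'. w (j e) = c)"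
proof -
  have sub: "O' \<subseteq> topspace E" by (rule openin_subset[OF O'(1)])
  have "closedin E (topspace E - O')" using O'(1) by blast
  moreover have "topspace E - O' \<noteq> topspace E" using sub O'(2) by blast
  ultimately have ne: "j ` (topspace E - O') \<noteq> Max_spec" and cl: "closedin max_top (j ` (topspace E - O'))"
    using jirr jclosed unfolding closed_map_def by blast+
  define W where "W = Max_spec - j ` (topspace E - O')"
  have W: "openin max_top W" using cl unfolding W_def closedin_def topspace_max_top by blast
  obtain M where "M \<in> W" using ne jMax unfolding W_def by blast
  then obtain V where V: "openin max_top V" "compactin max_top V" "M \<in> V" "V \<subseteq> W"
    using compact_open_max_top_basis[OF sp W] by blast
  obtain w0 where w0: "w0 \<in> Cc max_top" "\<forall>e\<in>topspace E. \<phi> e \<le> w0 (j e)" using Cc_dominate[OF \<phi>] by blast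
  \<comment> \<open>w is w0 changed to c on V. This preserves the bound, since the preimage of V
    lies in \<open>O'\<close>, where \<phi> equals c.\<close>
  define w where "w = (\<lambda>P. (\<lambda>a b. if b = 0 then a else c) (w0 P) (char_fn V P :: int))"
  have wC: "w \<in> Cc max_top" unfolding w_def
    by (rule Cc_comb[OF Hausdorff_max_top w0(1) Cc_char_fn[OF Hausdorff_max_top V(1,2)]]) simp
  have inO: "e \<in> O'" if "e \<in> topspace E" "j e \<in> V" for e using that V(4) unfolding W_def by blast
  have "\<phi> e \<le> w (j e)" if e: "e \<in> topspace E" for e
    using w0(2) e inO[OF e] O'(3)[of e] by (auto simp: w_def char_fn_def)
  moreover have "\<exists>e\<in>O'. w (j e) = c"
  proof -
    have "M \<in> Max_spec" using subsetD[OF V(4,3)] by (simp add: W_def)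
    then obtain e where e: "e \<in> topspace E" "j e = M" using jsurj by (metis imageE)
    have "w (j e) = c" using e V(3) by (simp add: w_def char_fn_def)
    then show ?thesis using inO[OF e(1)] e(2) V(3) by (intro bexI[of _ e]) simp_all
  qed
  ultimately show ?thesis using wC by (intro bexI[of _ w] conjI ballI)
qed

text \<open>If the inequality failed at e0, it would fail on an open set where \<phi> and g are
  constant; a function w as in \<open>Cc_separate\<close>, realized by some x in D(\<phi>), then
  contradicts \<open>pos\<close>. Suitable choices of g give the dual of D(\<phi>), the injectivity
  of D and the product rule.\<close>

lemma cover_ideal_dual_bound:
  assumes \<phi>: "\<phi> \<in> Cc E" and g: "\<And>c. openin E {e \<in> topspace E. g e = (c::int)}"
    and pos: "\<And>x e. x \<in> cover_ideal E j \<phi> \<Longrightarrow> x \<noteq> 0 \<Longrightarrow> e \<in> topspace E \<Longrightarrow> 0 \<le> g e + val (j e) x"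
    and e0: "e0 \<in> topspace E"
  shows "0 \<le> g e0 + \<phi> e0"
proof (rule ccontr)
  assume neg: "\<not> ?thesis"
  let ?O = "{e \<in> topspace E. \<phi> e \<in> {\<phi> e0}} \<inter> {e \<in> topspace E. g e = g e0}"
  have "openin E ?O" using Cc_fibers(1)[OF cover_Hausdorff \<phi>] g by (rule openin_Int)
  moreover have "?O \<noteq> {}" using e0 by blast
  moreover have "\<phi> e = \<phi> e0" if "e \<in> ?O" for e using that by simp
  ultimately have "\<exists>w\<in>Cc max_top. (\<forall>e\<in>topspace E. \<phi> e \<le> w (j e)) \<and> (\<exists>e\<in>?O. w (j e) = \<phi> e0)"
    by (rule Cc_separate[OF \<phi>])
  then obtain w e where w: "w \<in> Cc max_top" "\<forall>e\<in>topspace E. \<phi> e \<le> w (j e)" "e \<in> ?O" "w (j e) = \<phi> e0"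
    by (elim bexE conjE)
  have e: "e \<in> topspace E" "g e = g e0" using w(3) by auto
  obtain x where x: "x \<noteq> 0" "val (j e) x = w (j e)" "\<forall>N\<in>Max_spec. w N \<le> val N x"
    using Cc_realize[OF sp w(1) jMax[OF e(1)]] by blast
  have "x \<in> cover_ideal E j \<phi>" unfolding cover_ideal_def using w(2) x(3) jMax by fastforce
  then show False using pos[of x e] x w(4) e neg by simp
qed

lemma val_j_fiber: assumes "x \<noteq> 0" shows "openin E {e \<in> topspace E. val (j e) x \<in> S}"
proof -
  have "{e \<in> topspace E. val (j e) x \<in> S} = {e \<in> topspace E. psi E j (val_fun x) e \<in> S}"
    using jMax by (auto simp: psi_def val_fun_def)
  then show ?thesis using Cc_fibers(1)[OF cover_Hausdorff psi_Cc[OF val_fun_Cc[OF sp assms]]] by metis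
qed

lemma cover_ideal_modl: "is_submodule Rfr (cover_ideal E j \<phi>)"
proof -
  have "cover_ideal E j \<phi> = {x. x = 0 \<or> (\<forall>M\<in>Max_spec. \<forall>k\<in>\<phi> ` {e\<in>topspace E. j e = M}. k \<le> val M x)}"
    unfolding cover_ideal_def using jMax by blast
  then show ?thesis using val_ge_modl[OF sp, of "\<lambda>M. \<phi> ` {e\<in>topspace E. j e = M}"] by simp
qed

lemma frac_ideal_cover_ideal: assumes \<phi>: "\<phi> \<in> Cc E" shows "frac_ideal (cover_ideal E j \<phi>)"
proof -
  obtain M :: "'a set" where M: "M \<in> Max_spec" using Max_spec_ex[OF sp] by blast
  obtain w where w: "w \<in> Cc max_top" "\<forall>e\<in>topspace E. \<phi> e \<le> w (j e)" using Cc_dominate[OF \<phi>] by blast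
  obtain v where v: "v \<in> Cc max_top" "\<forall>e\<in>topspace E. - \<phi> e \<le> v (j e)" using Cc_dominate[OF Cc_uminus[OF cover_Hausdorff \<phi>]] by blast
  obtain x where x: "x \<noteq> 0" "\<forall>N\<in>Max_spec. w N \<le> val N x" using Cc_realize[OF sp w(1) M] by blast
  have xD: "x \<in> cover_ideal E j \<phi>" unfolding cover_ideal_def using w(2) x(2) jMax by fastforce
  have v': "(\<lambda>N. - v N) \<in> Cc max_top" by (rule Cc_uminus[OF Hausdorff_max_top v(1)])
  have "cover_ideal E j \<phi> \<subseteq> ideal_above (\<lambda>N. - v N)"
  proof
    fix z assume z: "z \<in> cover_ideal E j \<phi>"
    have "- v N \<le> val N z" if N: "N \<in> Max_spec" "z \<noteq> 0" for N
    proof -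
      obtain e where e: "e \<in> topspace E" "j e = N" by (rule bexE[OF j_lift[OF N(1)]])
      have "- \<phi> e \<le> v (j e)" using v(2) e(1) by blast
      moreover have "\<phi> e \<le> val (j e) z" using z N(2) e(1) unfolding cover_ideal_def by blast
      ultimately show ?thesis using e(2) by simp
    qed
    then show "z \<in> ideal_above (\<lambda>N. - v N)" unfolding ideal_above_def by blast
  qed
  moreover obtain d where "d \<noteq> 0" "\<forall>x\<in>(ideal_above (\<lambda>N. - v N) :: 'a fract set). emb d * x \<in> Rfr"
    using frac_idealD(3)[OF frac_ideal_ideal_above[OF sp v']] by blast
  ultimately show ?thesis using frac_idealI[OF cover_ideal_modl xD x(1), of d] by blast
qed

lemma mult_Rfr_iff:
  assumes "x \<noteq> 0" "y \<noteq> (0 :: 'a fract)"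
  shows "x * y \<in> Rfr \<longleftrightarrow> (\<forall>e\<in>topspace E. 0 \<le> val (j e) x + val (j e) y)"
proof -
  have "x * y \<in> Rfr \<longleftrightarrow> (\<forall>M\<in>Max_spec. 0 \<le> val M x + val M y)"
    using Rfr_iff[OF sp, of "x * y"] val_mult[OF sp _ assms] assms by simp
  then show ?thesis unfolding jsurj[symmetric] by simp
qed

lemma colon_iff:
  assumes "y \<noteq> 0"
  shows "y \<in> colon I \<longleftrightarrow> (\<forall>x\<in>I. x \<noteq> 0 \<longrightarrow> (\<forall>e\<in>topspace E. 0 \<le> val (j e) y + val (j e) x))"
proof -
  have eq: "y * x \<in> Rfr \<longleftrightarrow> (x \<noteq> 0 \<longrightarrow> (\<forall>e\<in>topspace E. 0 \<le> val (j e) y + val (j e) x))" for x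
    using mult_Rfr_iff[OF assms, of x] is_subringD(1)[OF Rfr_is_subring] by (cases "x = 0") auto
  show ?thesis unfolding colon_def mem_Collect_eq by (rule ball_cong[OF refl eq])
qed

lemma zero_colon: "0 \<in> colon (I :: 'a fract set)"
  by (simp add: colon_def is_subringD(1)[OF Rfr_is_subring])

lemma colon_cover_ideal: assumes \<phi>: "\<phi> \<in> Cc E" shows "colon (cover_ideal E j \<phi>) = cover_ideal E j (\<lambda>e. - \<phi> e)"
proof (rule Set.set_eqI)
  fix y
  show "y \<in> colon (cover_ideal E j \<phi>) \<longleftrightarrow> y \<in> cover_ideal E j (\<lambda>e. - \<phi> e)"
  proof (cases "y = 0")
    case True then show ?thesis using zero_colon by (simp add: cover_ideal_def)
  next
    case y: False
    show ?thesis
    proof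
      assume *: "y \<in> colon (cover_ideal E j \<phi>)"
      have "- \<phi> e \<le> val (j e) y" if "e \<in> topspace E" for e
      proof -
        have "openin E {e \<in> topspace E. val (j e) y = c}" for c using val_j_fiber[OF y, of "{c}"] by simp
        from cover_ideal_dual_bound[OF \<phi> this _ that] have "0 \<le> val (j e) y + \<phi> e"
          using * colon_iff[OF y, of "cover_ideal E j \<phi>"] by blast
        then show ?thesis by simp
      qed
      then show "y \<in> cover_ideal E j (\<lambda>e. - \<phi> e)" unfolding cover_ideal_def by blast
    next
      assume *: "y \<in> cover_ideal E j (\<lambda>e. - \<phi> e)"
      have "0 \<le> val (j e) y + val (j e) x" if "x \<in> cover_ideal E j \<phi>" "x \<noteq> 0" "e \<in> topspace E" for x e
      proof -
        have "\<phi> e \<le> val (j e) x" "- \<phi> e \<le> val (j e) y" using that * y unfolding cover_ideal_def by auto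
        then show ?thesis by simp
      qed
      then show "y \<in> colon (cover_ideal E j \<phi>)" using colon_iff[OF y, of "cover_ideal E j \<phi>"] by blast
    qed
  qed
qed

lemma cover_ideal_Div: assumes \<phi>: "\<phi> \<in> Cc E" shows "cover_ideal E j \<phi> \<in> Div"
  unfolding Div_def using frac_ideal_cover_ideal[OF \<phi>] colon_cover_ideal[OF \<phi>] colon_cover_ideal[OF Cc_uminus[OF cover_Hausdorff \<phi>]] by simp

lemma cover_ideal_le:
  assumes \<phi>: "\<phi> \<in> Cc E" and \<xi>: "\<xi> \<in> Cc E" and eq: "cover_ideal E j \<phi> \<subseteq> cover_ideal E j \<xi>" and e: "e \<in> topspace E"
  shows "\<xi> e \<le> \<phi> e"
proof -
  have "openin E {e \<in> topspace E. - \<xi> e = c}" for c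
    using Cc_fibers(1)[OF cover_Hausdorff Cc_uminus[OF cover_Hausdorff \<xi>], of "{c}"] by simp
  moreover have "0 \<le> - \<xi> e + val (j e) x" if "x \<in> cover_ideal E j \<phi>" "x \<noteq> 0" "e \<in> topspace E" for x e
    using subsetD[OF eq that(1)] that(2,3) unfolding cover_ideal_def by auto
  ultimately have "0 \<le> - \<xi> e + \<phi> e" by (rule cover_ideal_dual_bound[OF \<phi> _ _ e])
  then show ?thesis by simp
qed

lemma cover_ideal_inj: "inj_on (cover_ideal E j) (Cc E)"
proof (rule inj_onI)
  fix \<phi> \<xi> assume *: "\<phi> \<in> Cc E" "\<xi> \<in> Cc E" "cover_ideal E j \<phi> = cover_ideal E j \<xi>"
  show "\<phi> = \<xi>"
  proof
    fix e show "\<phi> e = \<xi> e"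
      using cover_ideal_le[OF *(1,2), of e] cover_ideal_le[OF *(2,1), of e] *(3) Cc_outside[OF *(1), of e] Cc_outside[OF *(2), of e]
      by (cases "e \<in> topspace E") auto
  qed
qed

text \<open>Only the dual of the product is computed. By \<open>colon_iprod\<close>, y belongs to it
  when the function val y + \<xi> has nonnegative sum with val x for all nonzero x in D(\<phi>), and
  \<open>cover_ideal_dual_bound\<close> applies to that function.\<close>

lemma cover_ideal_mult:
  assumes \<phi>: "\<phi> \<in> Cc E" and \<xi>: "\<xi> \<in> Cc E"
  shows "colon (colon (frac_mult (cover_ideal E j \<phi>) (cover_ideal E j \<xi>))) = cover_ideal E j (\<lambda>e. \<phi> e + \<xi> e)"
proof -
  let ?s = "\<lambda>e. - (\<phi> e + \<xi> e)"
  have s: "?s \<in> Cc E" by (rule Cc_uminus[OF cover_Hausdorff Cc_add[OF cover_Hausdorff \<phi> \<xi>]])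
  have "colon (iprod (cover_ideal E j \<phi>) (cover_ideal E j \<xi>)) = cover_ideal E j ?s"
  proof (rule Set.set_eqI)
    fix y
    show "y \<in> colon (iprod (cover_ideal E j \<phi>) (cover_ideal E j \<xi>)) \<longleftrightarrow> y \<in> cover_ideal E j ?s"
    proof (cases "y = 0")
      case True then show ?thesis using zero_colon by (simp add: cover_ideal_def)
    next
      case y: False
      have 1: "y \<in> colon (iprod (cover_ideal E j \<phi>) (cover_ideal E j \<xi>)) \<longleftrightarrow>
        (\<forall>x\<in>cover_ideal E j \<phi>. x \<noteq> 0 \<longrightarrow> (\<forall>e\<in>topspace E. 0 \<le> (val (j e) y + \<xi> e) + val (j e) x))"
      proof -
        have eq: "x * y \<in> cover_ideal E j (\<lambda>e. - \<xi> e) \<longleftrightarrow> (x \<noteq> 0 \<longrightarrow> (\<forall>e\<in>topspace E. 0 \<le> (val (j e) y + \<xi> e) + val (j e) x))" for x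
        proof (cases "x = 0")
          case False
          have "val (j e) (x * y) = val (j e) x + val (j e) y" if "e \<in> topspace E" for e
            by (rule val_mult[OF sp jMax[OF that] False y])
          then show ?thesis using False y unfolding cover_ideal_def by (simp, smt (verit))
        qed (simp add: cover_ideal_def)
        show ?thesis unfolding colon_iprod colon_cover_ideal[OF \<xi>] by (rule ball_cong[OF refl eq])
      qed
      show ?thesis
      proof
        assume "y \<in> colon (iprod (cover_ideal E j \<phi>) (cover_ideal E j \<xi>))"
        then have *: "\<And>x e. x \<in> cover_ideal E j \<phi> \<Longrightarrow> x \<noteq> 0 \<Longrightarrow> e \<in> topspace E \<Longrightarrow> 0 \<le> (val (j e) y + \<xi> e) + val (j e) x"
          unfolding 1 by blast
        have "openin E {e \<in> topspace E. val (j e) y + \<xi> e = c}" for c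
        proof -
          have "(\<lambda>e. psi E j (val_fun y) e + \<xi> e) \<in> Cc E" by (rule Cc_add[OF cover_Hausdorff psi_Cc[OF val_fun_Cc[OF sp y]] \<xi>])
          moreover have "{e \<in> topspace E. val (j e) y + \<xi> e = c} = {e \<in> topspace E. psi E j (val_fun y) e + \<xi> e \<in> {c}}"
            using jMax by (auto simp: psi_def val_fun_def)
          ultimately show ?thesis using Cc_fibers(1)[OF cover_Hausdorff, of _ "{c}"] by (simp only:)
        qed
        from cover_ideal_dual_bound[OF \<phi> this *] have "0 \<le> val (j e) y + \<xi> e + \<phi> e" if "e \<in> topspace E" for e
          using that by blast
        then show "y \<in> cover_ideal E j ?s" unfolding cover_ideal_def by (simp, smt (verit))
      next
        assume *: "y \<in> cover_ideal E j ?s"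
        have "0 \<le> (val (j e) y + \<xi> e) + val (j e) x" if "x \<in> cover_ideal E j \<phi>" "x \<noteq> 0" "e \<in> topspace E" for x e
        proof -
          have "\<phi> e \<le> val (j e) x" "- (\<phi> e + \<xi> e) \<le> val (j e) y" using that * y unfolding cover_ideal_def by auto
          then show ?thesis by simp
        qed
        then show "y \<in> colon (iprod (cover_ideal E j \<phi>) (cover_ideal E j \<xi>))" unfolding 1 by blast
      qed
    qed
  qed
  then show ?thesis unfolding frac_mult_eq_iprod[OF cover_ideal_modl] using colon_cover_ideal[OF s] by (simp add: add.commute)
qed

text \<open>The function \<open>\<nu>\<^sub>I \<circ> j\<close> is upper semicontinuous; \<open>\<phi>\<close> is its lower regularization, which is continuous
  because the closures \<open>C n\<close> are open.\<close>

lemma Div_eq_cover_ideal: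
  assumes I: "I \<in> (Div :: 'a fract set set)" shows "\<exists>\<phi>\<in>Cc E. I = cover_ideal E j \<phi>"
proof -
  have f: "frac_ideal I" and cc: "colon (colon I) = I" using I unfolding Div_def by auto
  obtain i where i: "i \<in> I" "i \<noteq> 0" using frac_idealD(2)[OF f] by blast
  obtain d where d: "d \<noteq> 0" "\<forall>M\<in>Max_spec. \<forall>i\<in>I. i \<noteq> 0 \<longrightarrow> - val M (emb d) \<le> val M i"
    using frac_bound[OF sp f] by (elim exE conjE)
  define h where "h e = nu I (j e)" for e
  define C where "C n = E closure_of {e \<in> topspace E. h e < n}" for n
  have h_le: "h e \<le> val (j e) x" if "e \<in> topspace E" "x \<in> I" "x \<noteq> 0" for e x
    unfolding h_def by (rule nu_props(2)[OF sp f jMax[OF that(1)] that(2,3)])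
  have h_att: "\<exists>x\<in>I. x \<noteq> 0 \<and> val (j e) x = h e" if "e \<in> topspace E" for e
    unfolding h_def by (rule nu_props(1)[OF sp f jMax[OF that]])
  have opA: "openin E {e \<in> topspace E. h e < n}" for n
  proof -
    have "openin E {e \<in> topspace E. j e \<in> {M \<in> Max_spec. nu I M < n}}"
      by (rule openin_continuous_map_preimage[OF jcont nu_usc[OF sp f]])
    moreover have "{e \<in> topspace E. j e \<in> {M \<in> Max_spec. nu I M < n}} = {e \<in> topspace E. h e < n}"
      using jMax by (auto simp: h_def)
    ultimately show ?thesis by simp
  qed
  have opC: "openin E (C n)" for n unfolding C_def by (rule cover_extremally_disconnected[OF opA])
  have clC: "closedin E (C n)" for n unfolding C_def by (rule closedin_closure_of)
  have AC: "e \<in> C n" if "e \<in> topspace E" "h e < n" for e n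
    using closure_of_subset[of "{e \<in> topspace E. h e < n}" E] that unfolding C_def by auto
  have Cmono: "C m \<subseteq> C n" if "m \<le> n" for m n unfolding C_def by (rule closure_of_mono) (use that in auto)
  \<comment> \<open>The values of x are locally constant on the cover, so the set where they are
    below n is closed. If they never exceed h, this set contains all points with h < n and hence C
    n; so \<phi> will dominate the values of x.\<close>
  have Cleast: "e \<notin> C (val (j e) x)" if e: "e \<in> topspace E" and x: "x \<noteq> 0" and le: "\<forall>e\<in>topspace E. val (j e) x \<le> h e" for e x
  proof -
    let ?n = "val (j e) x"
    have "closedin E (topspace E - {e \<in> topspace E. val (j e) x \<in> {?n..}})"
      using val_j_fiber[OF x, of "{?n..}"] by blast
    moreover have "{e \<in> topspace E. h e < ?n} \<subseteq> topspace E - {e \<in> topspace E. val (j e) x \<in> {?n..}}"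
      using le by fastforce
    ultimately have "C ?n \<subseteq> topspace E - {e \<in> topspace E. val (j e) x \<in> {?n..}}"
      unfolding C_def by (intro closure_of_minimal)
    then show ?thesis using e by auto
  qed
  let ?d = "inverse (emb d)"
  have d0: "?d \<noteq> 0" using d(1) by simp
  have vd: "val (j e) ?d = - val (j e) (emb d)" if "e \<in> topspace E" for e
    using val_inverse[OF sp jMax[OF that], of "emb d"] d(1) by simp
  have d_le: "\<forall>e\<in>topspace E. val (j e) ?d \<le> h e"
  proof
    fix e assume e: "e \<in> topspace E"
    obtain x where x: "x \<in> I" "x \<noteq> 0" "val (j e) x = h e" using h_att[OF e] by blast
    show "val (j e) ?d \<le> h e" using d(2)[rule_format, OF jMax[OF e] x(1,2)] x(3) vd[OF e] by simp
  qed
  \<comment> \<open>This m, the largest n with e outside C n, becomes \<phi> e. The denominator d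
    shows that such n exist, the element i of I that they are bounded.\<close>
  have "\<exists>m. \<forall>n. e \<notin> C n \<longleftrightarrow> n \<le> m" if e: "e \<in> topspace E" for e
  proof (rule antimono_int_threshold)
    show "e \<notin> C (val (j e) ?d)" by (rule Cleast[OF e d0 d_le])
    show "\<not> e \<notin> C (val (j e) i + 1)" using AC[OF e, of "val (j e) i + 1"] h_le[OF e i] by simp
    show "e \<notin> C m" if "e \<notin> C n" "m \<le> n" for m n using that Cmono by blast
  qed
  then have "\<exists>m. (e \<in> topspace E \<longrightarrow> (\<forall>n. e \<notin> C n \<longleftrightarrow> n \<le> m)) \<and> (e \<notin> topspace E \<longrightarrow> m = 0)" for e
    by (cases "e \<in> topspace E") auto
  then obtain \<phi> where \<phi>: "\<And>e n. e \<in> topspace E \<Longrightarrow> e \<notin> C n \<longleftrightarrow> n \<le> \<phi> e" "\<And>e. e \<notin> topspace E \<Longrightarrow> \<phi> e = 0"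
    by metis
  have \<phi>h: "\<phi> e \<le> h e" if e: "e \<in> topspace E" for e
    using AC[OF e, of "\<phi> e"] \<phi>(1)[OF e, of "\<phi> e"] by force
  have \<phi>g: "val (j e) x \<le> \<phi> e" if "e \<in> topspace E" "x \<noteq> 0" "\<forall>e\<in>topspace E. val (j e) x \<le> h e" for e x
    using Cleast[OF that] \<phi>(1)[OF that(1)] by blast
  have \<phi>C: "\<phi> \<in> Cc E" unfolding Cc_iff[OF cover_Hausdorff]
  proof (intro conjI allI impI)
    fix c
    \<comment> \<open>\<phi> e = c means outside C c but inside C (c + 1); both conditions are open
      because the sets C n are clopen.\<close>
    have "{e \<in> topspace E. \<phi> e = c} = (topspace E - C c) \<inter> C (c + 1)"
    proof (rule Set.set_eqI)
      fix e
      have "C n \<subseteq> topspace E" for n using openin_subset[OF opC] .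
      then show "e \<in> {e \<in> topspace E. \<phi> e = c} \<longleftrightarrow> e \<in> (topspace E - C c) \<inter> C (c + 1)"
        using \<phi>(1)[of e c] \<phi>(1)[of e "c + 1"] by (cases "e \<in> topspace E") auto
    qed
    then show "openin E {e \<in> topspace E. \<phi> e = c}" using clC[of c] opC[of "c + 1"] by (simp add: closedin_def openin_Int)
  next
    let ?K = "{e \<in> topspace E. psi E j (val_fun i) e \<in> - {0}} \<union> {e \<in> topspace E. psi E j (val_fun ?d) e \<in> - {0}}"
    have "compactin E ?K"
      by (intro compactin_Un Cc_fibers(3)[OF cover_Hausdorff] psi_Cc val_fun_Cc[OF sp] i d0) auto
    moreover have "{e \<in> topspace E. \<phi> e \<noteq> 0} \<subseteq> ?K"
    proof
      fix e assume "e \<in> {e \<in> topspace E. \<phi> e \<noteq> 0}"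
      then have e: "e \<in> topspace E" "\<phi> e \<noteq> 0" by auto
      have "\<phi> e \<le> val (j e) i" using \<phi>h[OF e(1)] h_le[OF e(1) i] by simp
      moreover have "val (j e) ?d \<le> \<phi> e" by (rule \<phi>g[OF e(1) d0 d_le])
      ultimately show "e \<in> ?K" using e jMax[OF e(1)] by (auto simp: psi_def val_fun_def)
    qed
    ultimately show "\<exists>K. compactin E K \<and> {e \<in> topspace E. \<phi> e \<noteq> 0} \<subseteq> K" by blast
  qed (rule \<phi>(2))
  \<comment> \<open>A nonzero y is in the dual exactly when the values of its inverse never exceed
    h, which by the maximality of \<phi> is the same as never exceeding \<phi>.\<close>
  have "colon I = cover_ideal E j (\<lambda>e. - \<phi> e)"
  proof (rule Set.set_eqI)
    fix y
    show "y \<in> colon I \<longleftrightarrow> y \<in> cover_ideal E j (\<lambda>e. - \<phi> e)"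
    proof (cases "y = 0")
      case True then show ?thesis using zero_colon by (simp add: cover_ideal_def)
    next
      case y: False
      have vy: "val (j e) (inverse y) = - val (j e) y" if "e \<in> topspace E" for e
        by (rule val_inverse[OF sp jMax[OF that] y])
      show ?thesis
      proof
        assume "y \<in> colon I"
        then have *: "0 \<le> val (j e) y + val (j e) x" if "x \<in> I" "x \<noteq> 0" "e \<in> topspace E" for x e
          using that unfolding colon_iff[OF y] by blast
        have "val (j e) (inverse y) \<le> h e" if e: "e \<in> topspace E" for e
        proof -
          obtain x where x: "x \<in> I" "x \<noteq> 0" "val (j e) x = h e" using h_att[OF e] by blast
          show ?thesis using *[OF x(1,2) e] x(3) vy[OF e] by simp
        qed
        then have "- \<phi> e \<le> val (j e) y" if "e \<in> topspace E" for e
          using \<phi>g[OF that, of "inverse y"] y vy[OF that] by simp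
        then show "y \<in> cover_ideal E j (\<lambda>e. - \<phi> e)" unfolding cover_ideal_def by blast
      next
        assume *: "y \<in> cover_ideal E j (\<lambda>e. - \<phi> e)"
        have "0 \<le> val (j e) y + val (j e) x" if "x \<in> I" "x \<noteq> 0" "e \<in> topspace E" for x e
        proof -
          have "- \<phi> e \<le> val (j e) y" using * y that(3) unfolding cover_ideal_def by blast
          then show ?thesis using \<phi>h[OF that(3)] h_le[OF that(3,1,2)] by simp
        qed
        then show "y \<in> colon I" unfolding colon_iff[OF y] by blast
      qed
    qed
  qed
  then have "I = cover_ideal E j \<phi>" using cc colon_cover_ideal[OF Cc_uminus[OF cover_Hausdorff \<phi>C]] by simp
  then show ?thesis using \<phi>C by blast
qed

lemma cover_ideal_iso: "cover_ideal E j \<in> iso (CcG E) (DivG :: 'a fract set monoid)"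
proof -
  have "cover_ideal E j ` Cc E = (Div :: 'a fract set set)" using cover_ideal_Div Div_eq_cover_ideal by blast
  then show ?thesis unfolding iso_def hom_def bij_betw_def CcG_def DivG_def
    using cover_ideal_inj cover_ideal_Div cover_ideal_mult by auto
qed

lemma cover_ideal_psi_Psi:
  assumes I: "I \<in> (Inv :: 'a fract set set)" shows "cover_ideal E j (psi E j (Psi I)) = I"
proof -
  have "cover_ideal E j (psi E j (Psi I)) = ideal_above (Psi I)"
    unfolding cover_ideal_def ideal_above_def jsurj[symmetric] psi_def by simp
  then show ?thesis using Inv_eq_ideal_above[OF sp I] by simp
qed

end

section \<open>Free groups\<close>

text \<open>Evaluation of an element of the free abelian group on sets as a function; it becomes an
  isomorphism onto \<open>CcG X\<close> once a basis of sets is known.\<close>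

definition char_comb :: "('x set \<Rightarrow>\<^sub>0 int) \<Rightarrow> 'x \<Rightarrow> int" where
  "char_comb c x = (\<Sum>U\<in>Poly_Mapping.keys c. Poly_Mapping.lookup c U * char_fn U x)"

lemma char_comb_superset:
  assumes "finite K" "Poly_Mapping.keys c \<subseteq> K"
  shows "char_comb c x = (\<Sum>U\<in>K. Poly_Mapping.lookup c U * char_fn U x)"
  unfolding char_comb_def by (rule sum.mono_neutral_left) (use assms in \<open>auto simp: in_keys_iff\<close>)

lemma char_comb_add: "char_comb (c + d) x = char_comb c x + char_comb d x"
proof -
  let ?K = "Poly_Mapping.keys c \<union> Poly_Mapping.keys d"
  have "char_comb (c + d) x = (\<Sum>U\<in>?K. Poly_Mapping.lookup (c + d) U * char_fn U x)"
    by (rule char_comb_superset) (use keys_add[of c d] in simp_all)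
  also have "\<dots> = (\<Sum>U\<in>?K. Poly_Mapping.lookup c U * char_fn U x) + (\<Sum>U\<in>?K. Poly_Mapping.lookup d U * char_fn U x)"
    by (simp add: lookup_add distrib_right sum.distrib)
  also have "\<dots> = char_comb c x + char_comb d x"
    using char_comb_superset[of ?K c x] char_comb_superset[of ?K d x] by simp
  finally show ?thesis .
qed

lemma char_comb_0: "char_comb 0 x = 0"
  by (simp add: char_comb_def)

lemma char_comb_cmul_of: "char_comb (frag_cmul k (frag_of U)) x = k * char_fn U x"
  using char_comb_superset[of "{U}" "frag_cmul k (frag_of U)" x] keys_cmul[of k "frag_of U"] by simp

lemma char_comb_diff: "char_comb (c - d) x = char_comb c x - char_comb d x"
  using char_comb_add[of "c - d" d x] by simp

lemma span_char_fn_iff: "f \<in> int_fun.span (char_fn ` H) \<longleftrightarrow> (\<exists>c. Poly_Mapping.keys c \<subseteq> H \<and> f = char_comb c)"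
proof
  assume "f \<in> int_fun.span (char_fn ` H)"
  then show "\<exists>c. Poly_Mapping.keys c \<subseteq> H \<and> f = char_comb c"
  proof (induction rule: int_fun.span_induct_alt)
    case base
    then show ?case by (intro exI[of _ 0]) (simp add: char_comb_0 fun_eq_iff)
  next
    case (step k x y)
    then obtain U c where U: "U \<in> H" "x = char_fn U" "Poly_Mapping.keys c \<subseteq> H" "y = char_comb c" by auto
    have "Poly_Mapping.keys (frag_cmul k (frag_of U) + c) \<subseteq> H"
      using keys_add[of "frag_cmul k (frag_of U)" c] keys_cmul[of k "frag_of U"] U by auto
    moreover have "(\<lambda>x'. k * x x') + y = char_comb (frag_cmul k (frag_of U) + c)"
      using U by (simp add: fun_eq_iff char_comb_add char_comb_cmul_of)
    ultimately show ?case by blast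
  qed
next
  assume "\<exists>c. Poly_Mapping.keys c \<subseteq> H \<and> f = char_comb c"
  then obtain c where c: "Poly_Mapping.keys c \<subseteq> H" "f = char_comb c" by blast
  have "(\<lambda>x. \<Sum>U\<in>K. a U * char_fn U x) \<in> int_fun.span (char_fn ` H)" if "finite K" "K \<subseteq> H" for K a
    using that
  proof (induction K)
    case empty then show ?case using int_fun.span_zero[of "char_fn ` H"] by (simp add: zero_fun_def)
  next
    case (insert U K)
    have "(\<lambda>x. a U * char_fn U x) \<in> int_fun.span (char_fn ` H)" using insert.prems by (intro int_fun.span_scale int_fun.span_base) auto
    from int_fun.span_add[OF this insert.IH] show ?case using insert by (simp add: plus_fun_def)
  qed
  from this[OF finite_keys c(1)] show "f \<in> int_fun.span (char_fn ` H)" unfolding c(2) char_comb_def .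
qed

text \<open>Restricted to the free group on H this is the projection onto the free group on H - G;
  its kernel consists of the combinations supported in G.\<close>

definition drop_keys :: "'x set \<Rightarrow> ('x \<Rightarrow>\<^sub>0 int) \<Rightarrow> ('x \<Rightarrow>\<^sub>0 int)" where
  "drop_keys G c = Abs_poly_mapping (\<lambda>U. if U \<in> G then 0 else Poly_Mapping.lookup c U)"

lemma lookup_drop_keys: "Poly_Mapping.lookup (drop_keys G c) U = (if U \<in> G then 0 else Poly_Mapping.lookup c U)"
proof -
  have "finite {U. (if U \<in> G then 0 else Poly_Mapping.lookup c U) \<noteq> 0}"
  proof (rule finite_subset[OF _ finite_keys[of c]], intro subsetI CollectI)
    fix U assume "U \<in> {U. (if U \<in> G then 0 else Poly_Mapping.lookup c U) \<noteq> 0}"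
    then show "U \<in> Poly_Mapping.keys c" by (cases "U \<in> G") (simp_all add: in_keys_iff)
  qed
  then show ?thesis unfolding drop_keys_def by simp
qed

lemma keys_drop_keys: "Poly_Mapping.keys (drop_keys G c) = Poly_Mapping.keys c - G"
  by (rule Set.set_eqI) (simp add: in_keys_iff lookup_drop_keys)

lemma drop_keys_add: "drop_keys G (c + d) = drop_keys G c + drop_keys G d"
  by (rule poly_mapping_eqI) (simp add: lookup_drop_keys lookup_add)

lemma Cc_comm_group: assumes X: "Hausdorff_space X" shows "comm_group (CcG X)"
proof (rule comm_groupI)
  fix f assume f: "f \<in> carrier (CcG X)"
  show "\<exists>g\<in>carrier (CcG X). g \<otimes>\<^bsub>CcG X\<^esub> f = \<one>\<^bsub>CcG X\<^esub>"
    by (rule bexI[of _ "\<lambda>x. - f x"]) (use f Cc_uminus[OF X] in \<open>auto simp: CcG_def\<close>)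
qed (auto simp: CcG_def Cc_zero intro: Cc_add[OF X])

definition compact_opens :: "'x topology \<Rightarrow> 'x set set" where
  "compact_opens X = {U. openin X U \<and> compactin X U}"

lemma compact_opens_Int:
  assumes X: "Hausdorff_space X" and "U \<in> compact_opens X" "V \<in> compact_opens X"
  shows "U \<inter> V \<in> compact_opens X"
  using assms(2,3) compact_Int_closedin[of X U V] compactin_imp_closedin[OF X, of V]
  unfolding compact_opens_def by auto

text \<open>A function in \<open>Cc X\<close> has finitely many nonzero values, and the fibres over
  these are compact open.\<close>

lemma Cc_span:
  assumes X: "Hausdorff_space X" shows "Cc X = int_fun.span (char_fn ` compact_opens X)"
proof
  show "Cc X \<subseteq> int_fun.span (char_fn ` compact_opens X)"
  proof
    fix f assume f: "f \<in> Cc X"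
    let ?C = "range f - {0}"
    let ?U = "\<lambda>c. {x \<in> topspace X. f x \<in> {c}}"
    have fin: "finite ?C" using Cc_finite_range[OF X f] by simp
    have "f x = (\<Sum>c\<in>?C. c * char_fn (?U c) x)" for x
    proof (cases "f x = 0")
      case True
      have "(\<Sum>c\<in>?C. c * char_fn (?U c) x) = 0" by (rule sum.neutral) (use True in \<open>auto simp: char_fn_def\<close>)
      then show ?thesis using True by simp
    next
      case False
      then have x: "x \<in> topspace X" using Cc_outside[OF f] by blast
      have "(\<Sum>c\<in>?C. c * char_fn (?U c) x) = (\<Sum>c\<in>?C. if c = f x then c else 0)"
        by (rule sum.cong) (use x in \<open>auto simp: char_fn_def\<close>)
      also have "\<dots> = f x" using fin False by (simp add: sum.delta)
      finally show ?thesis by simp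
    qed
    then have fe: "f = (\<lambda>x. \<Sum>c\<in>?C. c * char_fn (?U c) x)" by blast
    have "(\<lambda>x. \<Sum>c\<in>D. c * char_fn (?U c) x) \<in> int_fun.span (char_fn ` compact_opens X)" if "finite D" "D \<subseteq> ?C" for D
      using that
    proof (induction D)
      case empty then show ?case using int_fun.span_zero[of "char_fn ` compact_opens X"] by (simp add: zero_fun_def)
    next
      case (insert c D)
      have "?U c \<in> compact_opens X" unfolding compact_opens_def
        using Cc_fibers(1)[OF X f, of "{c}"] Cc_fibers(3)[OF X f, of "{c}"] insert.prems by auto
      then have "(\<lambda>x. c * char_fn (?U c) x) \<in> int_fun.span (char_fn ` compact_opens X)"
        by (intro int_fun.span_scale int_fun.span_base imageI)
      moreover have "(\<lambda>x. \<Sum>c\<in>D. c * char_fn (?U c) x) \<in> int_fun.span (char_fn ` compact_opens X)" using insert by blast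
      ultimately have "(\<lambda>x. c * char_fn (?U c) x) + (\<lambda>x. \<Sum>c\<in>D. c * char_fn (?U c) x) \<in> int_fun.span (char_fn ` compact_opens X)"
        by (rule int_fun.span_add)
      then show ?case using insert.hyps by (simp add: plus_fun_def)
    qed
    from this[OF fin order_refl] show "f \<in> int_fun.span (char_fn ` compact_opens X)" unfolding fe[symmetric] .
  qed
  show "int_fun.span (char_fn ` compact_opens X) \<subseteq> Cc X"
  proof
    fix f assume "f \<in> int_fun.span (char_fn ` compact_opens X)"
    then show "f \<in> Cc X"
    proof (induction rule: int_fun.span_induct_alt)
      case base then show ?case using Cc_zero by (simp add: zero_fun_def)
    next
      case (step k x y)
      then have "x \<in> Cc X" using Cc_char_fn[OF X] unfolding compact_opens_def by auto
      then show ?case using Cc_add[OF X Cc_cmul[OF X, of x k] step(2)] by (simp add: plus_fun_def)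
    qed
  qed
qed

lemma char_comb_iso:
  assumes X: "Hausdorff_space X" and span: "int_fun.span (char_fn ` H) = Cc X"
    and indep: "char_fn_independent H"
  shows "char_comb \<in> iso (free_Abelian_group H) (CcG X)"
proof -
  have img: "char_comb ` {c. Poly_Mapping.keys c \<subseteq> H} = Cc X"
    unfolding span[symmetric] using span_char_fn_iff by blast
  have "inj_on char_comb {c. Poly_Mapping.keys c \<subseteq> H}"
  proof (rule inj_onI)
    fix c d :: "'a set \<Rightarrow>\<^sub>0 int"
    assume cd: "c \<in> {c. Poly_Mapping.keys c \<subseteq> H}" "d \<in> {c. Poly_Mapping.keys c \<subseteq> H}" "char_comb c = char_comb d"
    have K: "Poly_Mapping.keys (c - d) \<subseteq> H" using keys_diff[of c d] cd by auto
    have z: "(\<Sum>U\<in>Poly_Mapping.keys (c - d). Poly_Mapping.lookup (c - d) U * char_fn U x) = 0" for x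
      using char_comb_diff[of c d x] cd(3) unfolding char_comb_def[of "c - d"] by simp
    have "Poly_Mapping.lookup (c - d) U = 0" if "U \<in> Poly_Mapping.keys (c - d)" for U
      using indep[unfolded char_fn_independent_def, rule_format, OF conjI[OF finite_keys conjI[OF K]]] z that by blast
    then have "Poly_Mapping.keys (c - d) = {}" by (meson all_not_in_conv in_keys_iff)
    then show "c = d" by simp
  qed
  then have "bij_betw char_comb (carrier (free_Abelian_group H)) (carrier (CcG X))"
    using img unfolding bij_betw_def free_Abelian_group_def CcG_def by simp
  moreover have "char_comb \<in> hom (free_Abelian_group H) (CcG X)"
  proof -
    have "char_comb c \<in> Cc X" if "Poly_Mapping.keys c \<subseteq> H" for c using img that by blast
    then show ?thesis unfolding hom_def by (auto simp: CcG_def char_comb_add fun_eq_iff)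
  qed
  ultimately show ?thesis unfolding iso_def by blast
qed

section \<open>Bases of the divisor group and of its quotient\<close>

context
  fixes E :: "'e topology" and j :: "'e \<Rightarrow> 'a::idom set"
  assumes sp: "SP_domain TYPE('a)"
    and gl: "gleason_cover (inverse_topology_Max :: 'a set topology) E j"
begin

text \<open>The subfamily of \<open>compact_opens E\<close> to which \<open>noebeling\<close> is
  applied; it spans the image of \<open>psi\<close>, that is, the functions belonging to invertible
  ideals.\<close>

definition pull_opens :: "'e set set" where
  "pull_opens = (\<lambda>W. {e \<in> topspace E. j e \<in> W}) ` compact_opens max_top"

lemma psi_comb: "psi E j ((\<lambda>x. k * f x) + g) = (\<lambda>x. k * psi E j f x) + psi E j g"
  by (auto simp: psi_def fun_eq_iff)

lemma psi_0: "psi E j 0 = 0"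
  by (auto simp: psi_def fun_eq_iff)

lemma psi_char_fn: "psi E j (char_fn W) = char_fn {e \<in> topspace E. j e \<in> W}"
  by (auto simp: psi_def char_fn_def fun_eq_iff)

lemma psi_span: "psi E j ` Cc max_top = int_fun.span (char_fn ` pull_opens)"
proof (intro equalityI subsetI)
  fix g assume "g \<in> psi E j ` Cc max_top"
  then obtain f where f: "f \<in> int_fun.span (char_fn ` compact_opens max_top)" "g = psi E j f"
    using Cc_span[OF Hausdorff_max_top] by blast
  have "psi E j f \<in> int_fun.span (char_fn ` pull_opens)" using f(1)
  proof (induction rule: int_fun.span_induct_alt)
    case base then show ?case unfolding psi_0 by (rule int_fun.span_zero)
  next
    case (step k x y)
    then have "psi E j x \<in> char_fn ` pull_opens" using psi_char_fn unfolding pull_opens_def by auto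
    then show ?case unfolding psi_comb by (rule int_fun.span_add[OF int_fun.span_scale[OF int_fun.span_base] step(2)])
  qed
  then show "g \<in> int_fun.span (char_fn ` pull_opens)" using f(2) by simp
next
  fix g assume "g \<in> int_fun.span (char_fn ` pull_opens)"
  then show "g \<in> psi E j ` Cc max_top"
  proof (induction rule: int_fun.span_induct_alt)
    case base
    have "(0 :: 'a set \<Rightarrow> int) \<in> Cc max_top" using Cc_zero[of max_top] by (simp add: zero_fun_def)
    then show ?case using psi_0 by (metis imageI)
  next
    case (step k x y)
    then obtain W f where W: "W \<in> compact_opens max_top" "x = psi E j (char_fn W)" and f: "f \<in> Cc max_top" "y = psi E j f"
      using psi_char_fn unfolding pull_opens_def by auto
    have "char_fn W \<in> Cc max_top" using W(1) Cc_char_fn[OF Hausdorff_max_top] unfolding compact_opens_def by blast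
    then have "(\<lambda>x. k * char_fn W x) + f \<in> Cc max_top"
      using Cc_add[OF Hausdorff_max_top Cc_cmul[OF Hausdorff_max_top] f(1)] by (simp add: plus_fun_def)
    moreover have "(\<lambda>e. k * x e) + y = psi E j ((\<lambda>x. k * char_fn W x) + f)" unfolding psi_comb W(2) f(2) ..
    ultimately show ?case by blast
  qed
qed

lemma pull_opens_sub: "pull_opens \<subseteq> compact_opens E"
proof
  fix U assume "U \<in> pull_opens"
  then obtain W where W: "openin max_top W" "compactin max_top W" "U = {e \<in> topspace E. j e \<in> W}"
    unfolding pull_opens_def compact_opens_def by blast
  show "U \<in> compact_opens E" unfolding compact_opens_def W(3)
    using openin_continuous_map_preimage[OF jcont[OF sp gl] W(1)]
      compactin_proper_map_preimage[OF jproper[OF sp gl] W(2)] by simp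
qed

lemma pull_opens_Int: "U \<in> pull_opens \<Longrightarrow> V \<in> pull_opens \<Longrightarrow> U \<inter> V \<in> pull_opens"
proof -
  assume "U \<in> pull_opens" "V \<in> pull_opens"
  then obtain A B where AB: "A \<in> compact_opens max_top" "B \<in> compact_opens max_top"
    "U = {e \<in> topspace E. j e \<in> A}" "V = {e \<in> topspace E. j e \<in> B}" unfolding pull_opens_def by blast
  have "U \<inter> V = {e \<in> topspace E. j e \<in> A \<inter> B}" using AB by auto
  then show ?thesis using compact_opens_Int[OF Hausdorff_max_top AB(1,2)] unfolding pull_opens_def by blast
qed

lemma cover_ideal_psi_Inv: assumes "w \<in> Cc max_top" shows "cover_ideal E j (psi E j w) \<in> Inv"
proof -
  have "cover_ideal E j (psi E j w) = cover_ideal E j (psi E j (Psi (ideal_above w :: 'a fract set)))" using ideal_above_Inv(2)[OF sp assms] by simp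
  also have "\<dots> = ideal_above w" by (rule cover_ideal_psi_Psi[OF sp gl ideal_above_Inv(1)[OF sp assms]])
  finally show ?thesis using ideal_above_Inv(1)[OF sp assms] by simp
qed

text \<open>The isomorphism \<beta>, as the inverse of the map that sends \<phi> to
  D(\<phi>).\<close>

definition div_fun :: "'a fract set \<Rightarrow> 'e \<Rightarrow> int" where
  "div_fun = inv_into (Cc E) (cover_ideal E j)"

lemma div_fun_iso: "div_fun \<in> iso (DivG :: 'a fract set monoid) (CcG E)"
proof -
  interpret comm_group "CcG E" by (rule Cc_comm_group[OF cover_Hausdorff[OF sp gl]])
  show ?thesis using iso_set_sym[OF cover_ideal_iso[OF sp gl]] unfolding div_fun_def CcG_def by simp
qed

lemma div_fun_cover_ideal: "\<phi> \<in> Cc E \<Longrightarrow> div_fun (cover_ideal E j \<phi>) = \<phi>"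
  unfolding div_fun_def by (rule inv_into_f_f[OF cover_ideal_inj[OF sp gl]])

lemma cover_ideal_div_fun: "I \<in> Div \<Longrightarrow> cover_ideal E j (div_fun I) = I \<and> div_fun I \<in> Cc E"
proof -
  assume "I \<in> Div"
  then obtain \<phi> where \<phi>: "\<phi> \<in> Cc E" "I = cover_ideal E j \<phi>" using Div_eq_cover_ideal[OF sp gl] by blast
  show ?thesis unfolding \<phi>(2) div_fun_cover_ideal[OF \<phi>(1)] using \<phi>(1) by blast
qed

text \<open>The group structure is transported from \<open>CcG E\<close>. The transport rule
  replaces the unit by the image D(0) of the zero function, which has to be identified with
  R.\<close>

lemma DivG_group: "group (DivG :: 'a fract set monoid)"
proof -
  interpret comm_group "CcG E" by (rule Cc_comm_group[OF cover_Hausdorff[OF sp gl]])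
  have "cover_ideal E j (\<lambda>e. 0) = Rfr"
    using Rfr_iff[OF sp] unfolding cover_ideal_def jsurj[OF sp gl, symmetric] by auto
  then have "DivG\<lparr>one := cover_ideal E j \<one>\<^bsub>CcG E\<^esub>\<rparr> = (DivG :: 'a fract set monoid)"
    unfolding DivG_def CcG_def by simp
  then show ?thesis using iso_imp_img_group[OF cover_ideal_iso[OF sp gl]] by simp
qed

lemma Inv_iff_div_fun:
  assumes I: "I \<in> (Div :: 'a fract set set)" shows "I \<in> Inv \<longleftrightarrow> div_fun I \<in> psi E j ` Cc max_top"
proof
  assume Inv: "I \<in> Inv"
  have "div_fun I = psi E j (Psi I)"
    using div_fun_cover_ideal[OF psi_Cc[OF sp gl Psi_Cc[OF sp Inv]]] cover_ideal_psi_Psi[OF sp gl Inv] by simp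
  then show "div_fun I \<in> psi E j ` Cc max_top" using Psi_Cc[OF sp Inv] by blast
next
  assume "div_fun I \<in> psi E j ` Cc max_top"
  then obtain w where w: "w \<in> Cc max_top" "div_fun I = psi E j w" by blast
  then show "I \<in> Inv" using cover_ideal_psi_Inv[OF w(1)] cover_ideal_div_fun[OF I] by simp
qed

lemma Inv_sub_Div: "Inv \<subseteq> (Div :: 'a fract set set)"
proof
  fix I :: "'a fract set" assume I: "I \<in> Inv"
  show "I \<in> Div" using cover_ideal_Div[OF sp gl psi_Cc[OF sp gl Psi_Cc[OF sp I]]] cover_ideal_psi_Psi[OF sp gl I] by simp
qed

text \<open>The generators have to be of type \<open>'a fract set set\<close>.\<close>

lemma free_relabel:
  assumes "H \<subseteq> compact_opens E"
  shows "\<exists>S :: 'a fract set set set. free_Abelian_group H \<cong> free_Abelian_group S"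
proof -
  have char_fn: "char_fn U \<in> Cc E" if "U \<in> H" for U
    using that assms Cc_char_fn[OF cover_Hausdorff[OF sp gl]] unfolding compact_opens_def by blast
  have inj: "inj (char_fn :: 'e set \<Rightarrow> 'e \<Rightarrow> int)"
    by (rule injI, rule Set.set_eqI) (metis char_fn_def of_bool_eq_iff)
  \<comment> \<open>The divisorial ideal of its characteristic function labels each compact open set
    injectively; the singleton raises this label to the required type.\<close>
  have "inj_on (\<lambda>U. {cover_ideal E j (char_fn U)}) H"
  proof (intro inj_onI)
    fix U V assume UV: "U \<in> H" "V \<in> H" "{cover_ideal E j (char_fn U)} = {cover_ideal E j (char_fn V)}"
    have "char_fn U = char_fn V" by (rule inj_onD[OF cover_ideal_inj[OF sp gl] _ char_fn[OF UV(1)] char_fn[OF UV(2)]]) (use UV(3) in simp)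
    then show "U = V" by (rule injD[OF inj])
  qed
  then have "H \<approx> (\<lambda>U. {cover_ideal E j (char_fn U)}) ` H" using inj_on_image_eqpoll_self eqpoll_sym by blast
  then show ?thesis using isomorphic_free_Abelian_groups by blast
qed

text \<open>In the coordinates given by H, forgetting those in G maps \<open>DivG\<close> onto the
  free group on H - G, and the kernel is \<open>Inv\<close> because G spans the functions of the
  invertible ideals.\<close>

lemma Div_free_and_quotient_free:
  "(\<exists>S :: 'a fract set set set. (DivG :: 'a fract set monoid) \<cong> free_Abelian_group S) \<and>
   (\<exists>S :: 'a fract set set set. (DivG Mod (Inv :: 'a fract set set)) \<cong> free_Abelian_group S)"
proof -
  note H = cover_Hausdorff[OF sp gl]
  obtain G H where GH: "G \<subseteq> H" "G \<subseteq> pull_opens" "H \<subseteq> compact_opens E"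
    "int_fun.span (char_fn ` pull_opens) = int_fun.span (char_fn ` G)" "int_fun.span (char_fn ` compact_opens E) = int_fun.span (char_fn ` H)"
    and indep: "char_fn_independent H"
    by (rule noebeling[OF pull_opens_sub]) (rule pull_opens_Int compact_opens_Int[OF H] that; assumption)+
  have spH: "int_fun.span (char_fn ` H) = Cc E" using Cc_span[OF H] GH(5) by simp
  have char_comb: "char_comb \<in> iso (free_Abelian_group H) (CcG E)" by (rule char_comb_iso[OF H spH indep])
  define unlin where "unlin = inv_into (carrier (free_Abelian_group H)) char_comb"
  have unlin: "unlin \<in> iso (CcG E) (free_Abelian_group H)"
    unfolding unlin_def by (rule group.iso_set_sym[OF group_free_Abelian_group char_comb])
  have coord: "unlin \<circ> div_fun \<in> iso DivG (free_Abelian_group H)"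
    by (rule iso_set_trans[OF div_fun_iso unlin])
  have first: "\<exists>S :: 'a fract set set set. (DivG :: 'a fract set monoid) \<cong> free_Abelian_group S"
    using is_isoI[OF coord] free_relabel[OF GH(3)] iso_trans by blast
  define q where "q = drop_keys G \<circ> (unlin \<circ> div_fun)"
  have dh: "drop_keys G \<in> hom (free_Abelian_group H) (free_Abelian_group (H - G))"
    unfolding hom_def by (auto simp: keys_drop_keys drop_keys_add)
  have "q \<in> hom DivG (free_Abelian_group (H - G))"
    unfolding q_def using hom_compose[OF _ dh] coord unfolding iso_def by blast
  then interpret q: group_hom DivG "free_Abelian_group (H - G)" q
    by (intro group_hom.intro DivG_group group_free_Abelian_group group_hom_axioms.intro)
  have bij: "(unlin \<circ> div_fun) ` carrier DivG = carrier (free_Abelian_group H)"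
    using coord unfolding iso_def bij_betw_def by blast
  have surj: "q ` carrier DivG = carrier (free_Abelian_group (H - G))"
  proof -
    have "c \<in> drop_keys G ` carrier (free_Abelian_group H)" if "Poly_Mapping.keys c \<subseteq> H - G" for c
    proof
      show "c = drop_keys G c"
        by (rule poly_mapping_eqI) (use that in \<open>auto simp: lookup_drop_keys in_keys_iff\<close>)
      show "c \<in> carrier (free_Abelian_group H)" using that by auto
    qed
    moreover have "drop_keys G ` carrier (free_Abelian_group H) \<subseteq> carrier (free_Abelian_group (H - G))"
      by (auto simp: keys_drop_keys)
    ultimately have "drop_keys G ` carrier (free_Abelian_group H) = carrier (free_Abelian_group (H - G))"
      by auto
    then show ?thesis unfolding q_def image_comp[symmetric] bij[symmetric] .
  qed
  have "kernel DivG (free_Abelian_group (H - G)) q = Inv"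
  proof (rule Set.set_eqI)
    fix I :: "'a fract set"
    show "I \<in> kernel DivG (free_Abelian_group (H - G)) q \<longleftrightarrow> I \<in> Inv"
    proof (cases "I \<in> Div")
      case False
      then show ?thesis using Inv_sub_Div unfolding kernel_def DivG_def by auto
    next
      case I: True
      define c where "c = unlin (div_fun I)"
      have "I \<in> carrier DivG" using I by (simp add: DivG_def)
      then have "(unlin \<circ> div_fun) I \<in> carrier (free_Abelian_group H)" unfolding bij[symmetric] by (rule imageI)
      then have "c \<in> carrier (free_Abelian_group H)" unfolding c_def by simp
      then have cH: "Poly_Mapping.keys c \<subseteq> H" by simp
      have \<phi>: "char_comb c = div_fun I" unfolding c_def unlin_def
        by (rule f_inv_into_f) (use char_comb cover_ideal_div_fun[OF I] in \<open>auto simp: iso_def bij_betw_def CcG_def\<close>)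
      have "I \<in> kernel DivG (free_Abelian_group (H - G)) q \<longleftrightarrow> drop_keys G c = 0"
        using I unfolding kernel_def q_def c_def DivG_def by simp
      also have "\<dots> \<longleftrightarrow> Poly_Mapping.keys c \<subseteq> G"
        using keys_drop_keys[of G c] by (metis Diff_eq_empty_iff keys_eq_empty)
      \<comment> \<open>Coordinates with respect to H are unique, so a function in the span of G has
        no coordinate outside G.\<close>
      also have "\<dots> \<longleftrightarrow> char_comb c \<in> int_fun.span (char_fn ` G)"
      proof
        assume "char_comb c \<in> int_fun.span (char_fn ` G)"
        then obtain d where d: "Poly_Mapping.keys d \<subseteq> G" "char_comb c = char_comb d" unfolding span_char_fn_iff by blast
        have "inj_on char_comb (carrier (free_Abelian_group H))" using char_comb unfolding iso_def bij_betw_def by blast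
        then have "c = d" by (rule inj_onD) (use d cH GH(1) in auto)
        then show "Poly_Mapping.keys c \<subseteq> G" using d by simp
      qed (use span_char_fn_iff in blast)
      also have "\<dots> \<longleftrightarrow> I \<in> Inv" unfolding \<phi> GH(4)[symmetric] psi_span[symmetric] using Inv_iff_div_fun[OF I] by simp
      finally show ?thesis .
    qed
  qed
  then have "DivG Mod (Inv :: 'a fract set set) \<cong> free_Abelian_group (H - G)"
    using q.FactGroup_iso[OF surj] by simp
  moreover have "H - G \<subseteq> compact_opens E" using GH(3) by blast
  ultimately have "\<exists>S :: 'a fract set set set. (DivG Mod (Inv :: 'a fract set set)) \<cong> free_Abelian_group S"
    using free_relabel[of "H - G"] iso_trans by blast
  then show ?thesis using first by blast
qed

end

theorem theorem6p2:
  fixes E :: "'e topology" and j :: "'e \<Rightarrow> 'a::idom set"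
  assumes "SP_domain TYPE('a)"
    and "gleason_cover (inverse_topology_Max :: 'a set topology) E j"
  shows "Psi \<in> iso (InvG :: 'a fract set monoid) (CcG inverse_topology_Max) \<and>
    (\<exists>\<beta>. \<beta> \<in> iso (DivG :: 'a fract set monoid) (CcG E) \<and>
         (\<forall>I \<in> (Inv :: 'a fract set set). \<beta> I = psi E j (Psi I))) \<and>
    (\<exists>S :: 'a fract set set set. (DivG :: 'a fract set monoid) \<cong> free_Abelian_group S) \<and>
    (\<exists>S :: 'a fract set set set. (DivG Mod (Inv :: 'a fract set set)) \<cong> free_Abelian_group S)"
proof (intro conjI)
  show "Psi \<in> iso (InvG :: 'a fract set monoid) (CcG inverse_topology_Max)" by (rule Psi_iso[OF assms(1)])
  have "div_fun E j I = psi E j (Psi I)" if I: "I \<in> Inv" for I :: "'a fract set"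
    using div_fun_cover_ideal[OF assms psi_Cc[OF assms Psi_Cc[OF assms(1) I]]] cover_ideal_psi_Psi[OF assms I] by simp
  then show "\<exists>\<beta>. \<beta> \<in> iso (DivG :: 'a fract set monoid) (CcG E) \<and>
         (\<forall>I \<in> (Inv :: 'a fract set set). \<beta> I = psi E j (Psi I))"
    using div_fun_iso[OF assms] by blast
qed (use Div_free_and_quotient_free[OF assms] in blast)+

end
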